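(* Fix a boundary condition $\hat{\mathbf{A}}\in\mathcal{B}^{\mathbb{C}}$. Assume that $\mu_1\ne0$ and $\mu_2\ne0$. Then for each $\boldsymbol\omega\in\mathcal{E}$, $(\boldsymbol\omega,\hat{\mathbf{A}})$ has exactly $N-1$ eigenvalues, and for each $\boldsymbol\omega\in\Omega_N^{\mathbb{R},+}\setminus\mathcal{E}$, $(\boldsymbol\omega,\hat{\mathbf{A}})$ has exactly $N$ eigenvalues $\lambda_n(\boldsymbol\omega):=\lambda_n(\boldsymbol\omega,\hat{\mathbf{A}})$, $0\le n\le N-1$, which satisfy that: (i) the $\lambda_n(\boldsymbol\omega)$ are continuous in $\Omega_N^{\mathbb{R},+}\setminus\mathcal{E}$; (ii) the $\lambda_n(\boldsymbol\omega)$ restricted in each connected component of $\mathcal{E}^+$ or $\mathcal{E}^-$ are non-increasing in every $(1/f_j)$-direction, independent of $f_N$, and non-decreasing in every $q_j$-direction, while their positive and negative parts are non-increasing and non-decreasing in every $w_j$-direction, respectively; (iii) the $\lambda_n(\boldsymbol\omega)$, $0\le n\le N-1$, are not continuous at each point of $\mathcal{E}$, and have the following asymptotic behaviors near any given $\boldsymbol\omega_0\in\mathcal{E}$: $$\lim_{\mathcal{E}^-\ni\boldsymbol\omega\to\boldsymbol\omega_0}\lambda_0(\boldsymbol\omega)=-\infty,\qquad \lim_{\mathcal{E}^-\ni\boldsymbol\omega\to\boldsymbol\omega_0}\lambda_n(\boldsymbol\omega)=\lambda_{n-1}(\boldsymbol\omega_0),\ 1\le n\le N-1,$$ $$\lim_{\mathcal{E}^+\cup\mathcal{E}\ni\boldsymbol\omega\to\boldsymbol\omega_0}\lambda_n(\boldsymbol\omega)=\lambda_n(\boldsymbol\omega_0),\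 0\le n\le N-2,\qquad \lim_{\mathcal{E}^+\ni\boldsymbol\omega\to\boldsymbol\omega_0}\lambda_{N-1}(\boldsymbol\omega)=+\infty.$$ Consequently, $\lambda_n(\boldsymbol\omega)$ restricted in $\mathcal{E}^+\cup\mathcal{E}$ is continuous for each $0\le n\le N-2$.
   Context: Fix an integer $N\ge 2$. A self-adjoint discrete Sturm–Liouville problem is a pair $(\boldsymbol\omega,\mathbf{A})$. Here $\boldsymbol\omega=(1/f,q,w)$ with real sequences $f=\{f_n\}_{n=0}^N$, $q=\{q_n\}_{n=1}^N$, $w=\{w_n\}_{n=1}^N$, $f_n\ne0$, $w_n>0$, encodes the equation $-\nabla(f_n\Delta y_n)+q_ny_n=\lambda w_ny_n$, $1\le n\le N$, for $y=(y_0,\dots,y_{N+1})$, with $\Delta y_n=y_{n+1}-y_n$, $\nabla y_n=y_n-y_{n-1}$; the set $\Omega_N^{\mathbb{R},+}$ of all such $(1/f,q,w)$ has the topology of a subset of $\mathbb{R}^{3N+1}$, with coordinates $1/f_0,\dots,1/f_N,q_1,\dots,q_N,w_1,\dots,w_N$. $\mathbf{A}=[A\,|\,B]$ encodes the boundary condition $A\begin{pmatrix}y_0\\ f_0\Delta y_0\end{pmatrix}+B\begin{pmatrix}y_N\\ f_N\Delta y_N\end{pmatrix}=0$, where $A,B$ are complex $2\times2$ matrices with $\mathrm{rank}(A,B)=2$ and $AJA^*=BJB^*$, $J=\begin{pmatrix}0&1\\-1&0\end{pmatrix}$; $[A\,|\,B]$ is the class of $(A,B)$ modulo left multiplication by $GL(2,\mathbb{C})$,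 and $\mathcal{B}^{\mathbb{C}}$ is the set of all such classes. An eigenvalue of $(\boldsymbol\omega,\mathbf{A})$ is a $\lambda$ for which a nonzero $y$ solves the equation and the boundary condition. Eigenvalues are real and finite in number; they are counted with multiplicity (the dimension of the solution space) and listed as $\lambda_0\le\lambda_1\le\cdots$; $\lambda_n$ is defined at a problem only if it has more than $n$ eigenvalues, and $\lambda_n$ is regarded as not continuous at a point where it is not defined. Write $\hat{\mathbf{A}}=\left[\begin{array}{cccc}\hat a_{11}&\hat a_{12}&\hat b_{11}&\hat b_{12}\\ \hat a_{21}&\hat a_{22}&\hat b_{21}&\hat b_{22}\end{array}\right]$ (left half $A$, right half $B$), $\mu_1:=\hat a_{11}\hat b_{22}-\hat a_{21}\hat b_{12}$, $\mu_2:=\hat a_{22}\hat b_{12}-\hat a_{12}\hat b_{22}$. When $\mu_1\ne0$, $\eta:=-\mu_2/\mu_1$ (a real number depending only on $\hat{\mathbf{A}}$), and $\mathcal{E}$, $\mathcal{E}^+$, $\mathcal{E}^-$ are the sets of $\boldsymbol\omega\in\Omega_N^{\mathbb{R},+}$ with $1/f_0=\eta$, $1/f_0>\eta$, $1/f_0<\eta$, respectively. "Monotone in a coordinate direction" means monotone in that coordinate with all other coordinates fixed. The positive and negative parts of $\lambda_n$ are $\max\{\lambda_n,0\}$ and $\min\{\lambda_n,0\}$.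
   Formalization: In (iii), λ_n is claimed not continuous at ω_0 in E except when 1≤n≤N-2 and λ_{n-1}(ω_0)=λ_n(ω_0): there the stated one-sided limits agree and λ_n is continuous, so the literal claim fails (e.g. N=3, f=w=1, q=0, a double eigenvalue 2). *)

theory Defs
  imports "HOL-Analysis.Analysis" "HOL-Library.Function_Algebras" "HOL-Library.Multiset"
begin

section \<open>Equations\<close>

text \<open>
  An equation \<open>\<omega>\<close> is a triple \<open>(1/f, q, w)\<close> of real sequences; its first component is the
  sequence of reciprocals, since these are the coordinates of the parameter space. The sequences
  are extensional (\<open>undefined\<close> outside their index range), so the product topology on the
  type induces on \<open>Omega N\<close> the topology of a subset of Euclidean space of dimension \<open>3N+1\<close>.
\<close>

type_synonym equation = "(nat \<Rightarrow> real) \<times> (nat \<Rightarrow> real) \<times> (nat \<Rightarrow> real)"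

definition Omega :: "nat \<Rightarrow> equation set" where
  "Omega N = ({0..N} \<rightarrow>\<^sub>E - {0}) \<times> ({1..N} \<rightarrow>\<^sub>E UNIV) \<times> ({1..N} \<rightarrow>\<^sub>E {0<..})"

definition recip_f :: "equation \<Rightarrow> nat \<Rightarrow> real" where
  "recip_f \<omega> = fst \<omega>"

definition f_of :: "equation \<Rightarrow> nat \<Rightarrow> real" where
  "f_of \<omega> n = 1 / recip_f \<omega> n"

definition q_of :: "equation \<Rightarrow> nat \<Rightarrow> real" where
  "q_of \<omega> = fst (snd \<omega>)"

definition w_of :: "equation \<Rightarrow> nat \<Rightarrow> real" where
  "w_of \<omega> = snd (snd \<omega>)"

definition fdiff :: "(nat \<Rightarrow> complex) \<Rightarrow> nat \<Rightarrow> complex" where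
  "fdiff y n = y (Suc n) - y n"

definition bdiff :: "(nat \<Rightarrow> complex) \<Rightarrow> nat \<Rightarrow> complex" where
  "bdiff y n = y n - y (n - 1)"

definition quasi_diff :: "equation \<Rightarrow> (nat \<Rightarrow> complex) \<Rightarrow> nat \<Rightarrow> complex" where
  "quasi_diff \<omega> y n = of_real (f_of \<omega> n) * fdiff y n"

definition satisfies_equation ::
  "nat \<Rightarrow> equation \<Rightarrow> complex \<Rightarrow> (nat \<Rightarrow> complex) \<Rightarrow> bool" where
  "satisfies_equation N \<omega> z y \<longleftrightarrow>
     (\<forall>n\<in>{1..N}. - bdiff (quasi_diff \<omega> y) n + of_real (q_of \<omega> n) * y n
                  = z * of_real (w_of \<omega> n) * y n)"


section \<open>Boundary conditions\<close>

type_synonym bc_pair = "(complex^2^2) \<times> (complex^2^2)"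

definition ctranspose :: "complex^'n^'m \<Rightarrow> complex^'m^'n" where
  "ctranspose A = (\<chi> i j. cnj (A $ j $ i))"

definition J_mat :: "complex^2^2" where
  "J_mat = vector [vector [0, 1], vector [-1, 0]]"

definition augmented :: "complex^2^2 \<Rightarrow> complex^2^2 \<Rightarrow> complex^4^2" where
  "augmented A B = (\<chi> i. vector [A $ i $ 1, A $ i $ 2, B $ i $ 1, B $ i $ 2])"

definition selfadjoint_pairs :: "bc_pair set" where
  "selfadjoint_pairs =
     {(A, B). rank (augmented A B) = 2 \<and>
              A ** J_mat ** ctranspose A = B ** J_mat ** ctranspose B}"

definition left_GL_rel :: "(bc_pair \<times> bc_pair) set" where
  "left_GL_rel =
     {((A, B), (A', B')). (A, B) \<in> selfadjoint_pairs \<and> (A', B') \<in> selfadjoint_pairs \<and>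
        (\<exists>T :: complex^2^2. invertible T \<and> A' = T ** A \<and> B' = T ** B)}"

text \<open>An element of \<open>bc_space\<close> is the class \<open>[A | B]\<close>, as the set of all its representatives.\<close>

definition bc_space :: "bc_pair set set" where
  "bc_space = selfadjoint_pairs // left_GL_rel"

definition satisfies_bc ::
  "nat \<Rightarrow> equation \<Rightarrow> bc_pair set \<Rightarrow> (nat \<Rightarrow> complex) \<Rightarrow> bool" where
  "satisfies_bc N \<omega> \<A> y \<longleftrightarrow>
     (\<forall>(A, B)\<in>\<A>. A *v vector [y 0, quasi_diff \<omega> y 0] + B *v vector [y N, quasi_diff \<omega> y N] = 0)"


section \<open>Eigenvalues\<close>

text \<open>
  Tuples \<open>(y\<^sub>0, \<dots>, y\<^sub>N\<^sub>+\<^sub>1)\<close> are represented by sequences vanishing beyond index \<open>N + 1\<close>. Eigenvalues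
  are a priori complex.
\<close>

definition eigenspace :: "nat \<Rightarrow> equation \<Rightarrow> bc_pair set \<Rightarrow> complex \<Rightarrow> (nat \<Rightarrow> complex) set" where
  "eigenspace N \<omega> \<A> z =
     {y. (\<forall>n>N + 1. y n = 0) \<and> satisfies_equation N \<omega> z y \<and> satisfies_bc N \<omega> \<A> y}"

definition eigenvalues :: "nat \<Rightarrow> equation \<Rightarrow> bc_pair set \<Rightarrow> complex set" where
  "eigenvalues N \<omega> \<A> = {z. \<exists>y\<in>eigenspace N \<omega> \<A> z. y \<noteq> 0}"

interpretation cseq: vector_space "\<lambda>(c :: complex) (y :: nat \<Rightarrow> complex) n. c * y n"
  by unfold_locales (auto simp: fun_eq_iff algebra_simps)

definition multiplicity_at :: "nat \<Rightarrow> equation \<Rightarrow> bc_pair set \<Rightarrow> complex \<Rightarrow> nat" where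
  "multiplicity_at N \<omega> \<A> z = cseq.dim (eigenspace N \<omega> \<A> z)"

definition num_eigenvalues :: "nat \<Rightarrow> equation \<Rightarrow> bc_pair set \<Rightarrow> nat" where
  "num_eigenvalues N \<omega> \<A> = (\<Sum>z\<in>eigenvalues N \<omega> \<A>. multiplicity_at N \<omega> \<A> z)"

definition eigenvalue_list :: "nat \<Rightarrow> equation \<Rightarrow> bc_pair set \<Rightarrow> real list" where
  "eigenvalue_list N \<omega> \<A> = sorted_list_of_multiset
     (\<Sum>z\<in>eigenvalues N \<omega> \<A>. replicate_mset (multiplicity_at N \<omega> \<A> z) (Re z))"

text \<open>\<open>nth_ev N \<A> n \<omega>\<close> is meaningful only if \<open>n < num_eigenvalues N \<omega> \<A>\<close>.\<close>

definition nth_ev :: "nat \<Rightarrow> bc_pair set \<Rightarrow> nat \<Rightarrow> equation \<Rightarrow> real" where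
  "nth_ev N \<A> n \<omega> = eigenvalue_list N \<omega> \<A> ! n"

text \<open>
  Continuity of the partial function \<open>\<lambda>\<^sub>n\<close> on \<open>Omega N\<close>, which by convention fails at points
  where \<open>\<lambda>\<^sub>n\<close> is not defined. At a singular point where the middle eigenvalues
  \<open>\<lambda>\<^sub>n\<^sub>-\<^sub>1\<close> and \<open>\<lambda>\<^sub>n\<close> coincide, the one-sided limits of \<open>\<lambda>\<^sub>n\<close> agree and \<open>\<lambda>\<^sub>n\<close> is continuous.
\<close>

definition nth_ev_continuous_at ::
  "nat \<Rightarrow> bc_pair set \<Rightarrow> nat \<Rightarrow> equation \<Rightarrow> bool" where
  "nth_ev_continuous_at N \<A> n \<omega> \<longleftrightarrow>
     n < num_eigenvalues N \<omega> \<A> \<and>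
     continuous (at \<omega> within {\<omega>'\<in>Omega N. n < num_eigenvalues N \<omega>' \<A>}) (nth_ev N \<A> n)"


section \<open>The singular set of a boundary condition\<close>

definition mu1 :: "bc_pair \<Rightarrow> complex" where
  "mu1 = (\<lambda>(A, B). A $ 1 $ 1 * B $ 2 $ 2 - A $ 2 $ 1 * B $ 1 $ 2)"

definition mu2 :: "bc_pair \<Rightarrow> complex" where
  "mu2 = (\<lambda>(A, B). A $ 2 $ 2 * B $ 1 $ 2 - A $ 1 $ 2 * B $ 2 $ 2)"

text \<open>The quotient is real for self-adjoint pairs, see \<open>of_real_eta\<close> below.\<close>

definition eta :: "bc_pair \<Rightarrow> real" where
  "eta P = Re (- mu2 P / mu1 P)"

definition E_sing :: "nat \<Rightarrow> bc_pair \<Rightarrow> equation set" where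
  "E_sing N P = {\<omega>\<in>Omega N. recip_f \<omega> 0 = eta P}"

definition E_plus :: "nat \<Rightarrow> bc_pair \<Rightarrow> equation set" where
  "E_plus N P = {\<omega>\<in>Omega N. recip_f \<omega> 0 > eta P}"

definition E_minus :: "nat \<Rightarrow> bc_pair \<Rightarrow> equation set" where
  "E_minus N P = {\<omega>\<in>Omega N. recip_f \<omega> 0 < eta P}"

lemma of_real_eta:
  assumes "P \<in> selfadjoint_pairs"
  shows "complex_of_real (eta P) = - mu2 P / mu1 P"
proof -
  obtain A B where P: "P = (A, B)" by (cases P)
  define a where "a i j = A $ i $ j" for i j
  define b where "b i j = B $ i $ j" for i j
  have eq: "A ** J_mat ** ctranspose A = B ** J_mat ** ctranspose B"
    using assms by (auto simp: P selfadjoint_pairs_def)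
  have rel: "a i 1 * cnj (a j 2) - a i 2 * cnj (a j 1)
           = b i 1 * cnj (b j 2) - b i 2 * cnj (b j 1)" for i j
    using arg_cong[OF eq, of "\<lambda>M. M $ i $ j"]
    by (simp add: a_def b_def matrix_matrix_mult_def ctranspose_def J_mat_def sum_2 algebra_simps)
  have m: "mu1 P = a 1 1 * b 2 2 - a 2 1 * b 1 2" "mu2 P = a 2 2 * b 1 2 - a 1 2 * b 2 2"
    by (auto simp: P mu1_def mu2_def a_def b_def)
  have "mu2 P * cnj (mu1 P) - mu1 P * cnj (mu2 P) =
      b 2 2 * cnj (b 2 2) * (a 1 1 * cnj (a 1 2) - a 1 2 * cnj (a 1 1))
    - b 2 2 * cnj (b 1 2) * (a 1 1 * cnj (a 2 2) - a 1 2 * cnj (a 2 1))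
    - b 1 2 * cnj (b 2 2) * (a 2 1 * cnj (a 1 2) - a 2 2 * cnj (a 1 1))
    + b 1 2 * cnj (b 1 2) * (a 2 1 * cnj (a 2 2) - a 2 2 * cnj (a 2 1))"
    unfolding m by (simp add: algebra_simps)
  also have "\<dots> = 0"
    unfolding rel by (simp add: algebra_simps)
  finally have "mu2 P * cnj (mu1 P) = cnj (mu2 P * cnj (mu1 P))"
    by (simp add: algebra_simps)
  then have "mu2 P * cnj (mu1 P) \<in> \<real>"
    by (metis Reals_cnj_iff)
  then have "- mu2 P / mu1 P \<in> \<real>"
    by (simp add: complex_div_cnj[of _ "mu1 P"] flip: of_real_power)
  then show ?thesis
    by (simp add: eta_def of_real_Re)
qed

lemma eta_representative_independent:
  assumes "(P, P') \<in> left_GL_rel"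
  shows "eta P' = eta P"
proof -
  obtain A B A' B' and T :: "complex^2^2" where P: "P = (A, B)" "P' = (A', B')"
    and T: "invertible T" "A' = T ** A" "B' = T ** B"
    using assms by (cases P; cases P') (auto simp: left_GL_rel_def)
  have "mu1 P' = det T * mu1 P" "mu2 P' = det T * mu2 P"
    by (auto simp: P T mu1_def mu2_def det_2 matrix_matrix_mult_def sum_2 algebra_simps)
  moreover have "det T \<noteq> 0"
    using T by (simp add: invertible_det_nz)
  ultimately show ?thesis
    by (simp add: eta_def)
qed

end

theory Submission
  imports Defs
begin

text \<open>
  Since \<open>\<mu>\<^sub>1 \<noteq> 0\<close>, the boundary condition can be solved for \<open>y\<^sub>0\<close> and \<open>p\<^sub>N = f\<^sub>N \<Delta>y\<^sub>N\<close>; self-adjointness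
  brings it to the form \<open>y\<^sub>0 + \<eta> p\<^sub>0 + cnj \<zeta> y\<^sub>N = 0\<close>, \<open>\<zeta> p\<^sub>0 + \<beta> y\<^sub>N + p\<^sub>N = 0\<close> with real \<open>\<beta>\<close>. Summation by parts
  then turns the problem into: find \<open>(y\<^sub>1, \<dots>, y\<^sub>N)\<close> and \<open>p\<^sub>0\<close> such that for all \<open>x\<close>
  \<open>Q(x, y) - \<lambda> W(x, y) + cnj (g x) p\<^sub>0 = 0\<close> and \<open>g y = (1/f\<^sub>0 - \<eta>) p\<^sub>0\<close>, where \<open>g y = y\<^sub>1 + cnj \<zeta> y\<^sub>N\<close>,
  \<open>W(y, y) = \<Sum>w\<^sub>n |y\<^sub>n|\<^sup>2\<close> and \<open>Q(y, y) = \<Sum>f\<^sub>n |\<Delta>y\<^sub>n|\<^sup>2 + \<Sum>q\<^sub>n |y\<^sub>n|\<^sup>2 + \<beta> |y\<^sub>N|\<^sup>2\<close> with \<open>f\<^sub>0\<close>, \<open>f\<^sub>N\<close> absent.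
  For \<open>1/f\<^sub>0 \<noteq> \<eta>\<close> this is the Hermitian pencil \<open>Q + |g|\<^sup>2/(1/f\<^sub>0 - \<eta>)\<close> against \<open>W\<close> on \<open>\<complex>\<^sup>N\<close>; for \<open>1/f\<^sub>0 = \<eta>\<close>,
  \<open>p\<^sub>0\<close> is a Lagrange multiplier and the pencil is \<open>Q\<close> against \<open>W\<close> on the hyperplane \<open>g = 0\<close>. Everything
  follows from the min-max principle: monotonicity and continuity directly, and the behaviour at
  \<open>\<E>\<close> because \<open>1/f\<^sub>0 \<rightarrow> \<eta>\<close> makes the coefficient of the penalty \<open>|g|\<^sup>2\<close> tend to \<open>+\<infinity>\<close> or \<open>-\<infinity>\<close>.
\<close>

section \<open>Hermitian forms on functions with finite support\<close>

text \<open>The min-max principle enters only as a comparison: some nonzero combination of the first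
  n + 1 eigenvectors of one pencil is orthogonal to the first n of another. So no infimum over
  subspaces is formed, every dimension count is a homogeneous system with more unknowns than
  equations, and the two pencils may live on different spaces. The last point is needed at
  \<open>1/f_0 = \<eta>\<close>, where a form on the full space meets one on a hyperplane. There the
  two bounds differ in difficulty. Upper bounds for a growing penalty are free, since it vanishes on
  the hyperplane. For lower bounds a trial vector has to be moved into the hyperplane; the move
  costs a fixed multiple of the squared modulus of \<open>g\<close>, and this cost is what the
  penalty pays for. Penalties tending to minus infinity are reduced to this case by negating the
  form and counting eigenvalues from the top. Since the hyperplane has one dimension less, the same
  position from the top is \<open>n\<close> on the full space and \<open>n - 1\<close> on the
  hyperplane.\<close>

lemma homogeneous_system_nontrivial:
  fixes a :: "'k \<Rightarrow> 'j \<Rightarrow> complex"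
  assumes "finite K" "finite J" "card K < card J"
  shows "\<exists>c. (\<exists>j\<in>J. c j \<noteq> 0) \<and> (\<forall>k\<in>K. (\<Sum>j\<in>J. c j * a k j) = 0)"
  using assms
proof (induction K arbitrary: J a rule: finite_induct)
  case empty
  then have "J \<noteq> {}" by auto
  then show ?case by (intro exI[of _ "\<lambda>_. 1"]) auto
next
  case (insert k K)
  show ?case
  proof (cases "\<forall>j\<in>J. a k j = 0")
    case True
    have "card K < card J" using insert by simp
    from insert.IH[OF insert.prems(1) this, of a] True show ?thesis by auto
  next
    case False
    then obtain j0 where j0: "j0 \<in> J" "a k j0 \<noteq> 0" by auto
    define J' where "J' = J - {j0}"
    have J: "J = insert j0 J'" "j0 \<notin> J'" "finite J'"
      using j0 insert.prems by (auto simp: J'_def)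
    have "card K < card J'" using insert.prems insert.hyps J by auto
    \<comment> \<open>Gaussian elimination with pivot \<open>j0\<close>: a multiple of equation
      \<open>k\<close> is subtracted from the other equations, and \<open>c'\<close> below obtains
      the pivot unknown by back-substitution.\<close>
    from insert.IH[OF J(3) this, of "\<lambda>k' j. a k' j - a k' j0 * a k j / a k j0"]
    obtain c where c: "\<exists>j\<in>J'. c j \<noteq> 0"
      "\<And>k'. k' \<in> K \<Longrightarrow> (\<Sum>j\<in>J'. c j * (a k' j - a k' j0 * a k j / a k j0)) = 0" by blast
    define s where "s = (\<Sum>j\<in>J'. c j * a k j)"
    define c' where "c' = c(j0 := - s / a k j0)"
    have eq: "(\<Sum>j\<in>J. c' j * a k' j) = (\<Sum>j\<in>J'. c j * a k' j) - s / a k j0 * a k' j0" for k'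
    proof -
      have "(\<Sum>j\<in>J'. c' j * a k' j) = (\<Sum>j\<in>J'. c j * a k' j)"
        using J(2) by (intro sum.cong) (auto simp: c'_def)
      then show ?thesis using J by (simp add: c'_def)
    qed
    have "(\<Sum>j\<in>J. c' j * a k j) = 0"
      unfolding eq using j0 by (simp add: s_def)
    moreover have "(\<Sum>j\<in>J. c' j * a k' j) = 0" if "k' \<in> K" for k'
    proof -
      have "(\<Sum>j\<in>J'. c j * (a k' j - a k' j0 * a k j / a k j0))
        = (\<Sum>j\<in>J'. c j * a k' j) - s / a k j0 * a k' j0"
        by (simp add: s_def algebra_simps sum_subtractf sum_distrib_left sum_divide_distrib)
      then show ?thesis unfolding eq using c(2)[OF that] by simp
    qed
    moreover have "\<exists>j\<in>J. c' j \<noteq> 0" using c(1) J by (auto simp: c'_def)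
    ultimately show ?thesis by (intro exI[of _ c']) auto
  qed
qed

text \<open>Vectors indexed by \<open>I\<close> are functions on the whole type that vanish off
  \<open>I\<close>, so pointwise algebra and the product topology apply without a separate vector
  type.\<close>

definition supported :: "'i set \<Rightarrow> ('i \<Rightarrow> complex) set" where
  "supported I = {y. \<forall>i. i \<notin> I \<longrightarrow> y i = 0}"

definition sqnorm :: "'i set \<Rightarrow> ('i \<Rightarrow> complex) \<Rightarrow> real" where
  "sqnorm I y = (\<Sum>i\<in>I. (cmod (y i))\<^sup>2)"

definition unit_vec :: "'i \<Rightarrow> 'i \<Rightarrow> complex" where
  "unit_vec i = (\<lambda>j. if j = i then 1 else 0)"

definition subsp :: "('i \<Rightarrow> complex) set \<Rightarrow> bool" where
  "subsp V \<longleftrightarrow> 0 \<in> V \<and> (\<forall>x\<in>V. \<forall>y\<in>V. \<forall>a b. (\<lambda>i. a * x i + b * y i) \<in> V)"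

definition hermitian_form :: "(('i \<Rightarrow> complex) \<Rightarrow> ('i \<Rightarrow> complex) \<Rightarrow> complex) \<Rightarrow> bool" where
  "hermitian_form Q \<longleftrightarrow>
     (\<forall>x y z a b. Q x (\<lambda>i. a * y i + b * z i) = a * Q x y + b * Q x z) \<and> (\<forall>x y. Q y x = cnj (Q x y))"

text \<open>A uniform constant instead of mere positivity: perturbation errors are measured by
  \<open>sqnorm\<close>, and \<open>m\<close> converts them into multiples of
  \<open>W\<close>.\<close>

definition coercive :: "'i set \<Rightarrow> (('i \<Rightarrow> complex) \<Rightarrow> ('i \<Rightarrow> complex) \<Rightarrow> complex) \<Rightarrow> bool" where
  "coercive I W \<longleftrightarrow> hermitian_form W \<and> (\<exists>m>0. \<forall>y\<in>supported I. m * sqnorm I y \<le> Re (W y y))"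

lemma hf_comb: "hermitian_form Q \<Longrightarrow> Q x (\<lambda>i. a * y i + b * z i) = a * Q x y + b * Q x z"
  unfolding hermitian_form_def by blast

lemma hf_cnj: "hermitian_form Q \<Longrightarrow> Q y x = cnj (Q x y)"
  unfolding hermitian_form_def by blast

lemma hf_scale: "hermitian_form Q \<Longrightarrow> Q x (\<lambda>i. a * y i) = a * Q x y"
  using hf_comb[of Q x a y 0 y] by simp

lemma hf_zero: "hermitian_form Q \<Longrightarrow> Q x 0 = 0"
  using hf_scale[of Q x 0 0] by (simp add: zero_fun_def)

lemma hf_comb_left: "hermitian_form Q \<Longrightarrow> Q (\<lambda>i. a * y i + b * z i) x = cnj a * Q y x + cnj b * Q z x"
  using hf_cnj[of Q "\<lambda>i. a * y i + b * z i" x] hf_comb[of Q x a y b z] hf_cnj[of Q y x] hf_cnj[of Q z x]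
  by (metis complex_cnj_add complex_cnj_cnj complex_cnj_mult)

lemma hf_scale_left: "hermitian_form Q \<Longrightarrow> Q (\<lambda>i. a * y i) x = cnj a * Q y x"
  using hf_comb_left[of Q a y 0 y] by simp

lemma hf_sum:
  assumes "hermitian_form Q" "finite S"
  shows "Q x (\<lambda>i. \<Sum>j\<in>S. c j * f j i) = (\<Sum>j\<in>S. c j * Q x (f j))"
  using assms(2)
proof (induction S)
  case empty
  then show ?case using hf_zero[OF assms(1)] by (simp add: zero_fun_def)
next
  case (insert j S)
  have "Q x (\<lambda>i. c j * f j i + 1 * (\<Sum>j\<in>S. c j * f j i)) = (\<Sum>j\<in>insert j S. c j * Q x (f j))"
    using insert by (subst hf_comb[OF assms(1)]) simp
  then show ?case using insert by simp
qed

lemma hf_self_real: "hermitian_form Q \<Longrightarrow> Q x x = of_real (Re (Q x x))"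
  using hf_cnj[of Q x x] by (simp add: complex_eq_iff)

lemma hf_self_scale:
  assumes "hermitian_form Q"
  shows "Re (Q (\<lambda>i. a * y i) (\<lambda>i. a * y i)) = (cmod a)\<^sup>2 * Re (Q y y)"
proof -
  have "Q (\<lambda>i. a * y i) (\<lambda>i. a * y i) = (a * cnj a) * Q y y"
    using assms by (simp add: hf_scale hf_scale_left)
  then show ?thesis by (simp add: complex_norm_square[symmetric] del: of_real_power)
qed

lemma hf_minus: "hermitian_form Q \<Longrightarrow> hermitian_form (\<lambda>x y. - Q x y)"
  unfolding hermitian_form_def
  by (metis (no_types, lifting) complex_cnj_minus minus_add_distrib mult_minus_right)

lemma hf_add_mult:
  assumes "hermitian_form Q" "hermitian_form R"
  shows "hermitian_form (\<lambda>x y. Q x y + complex_of_real t * R x y)"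
  unfolding hermitian_form_def
proof (intro conjI allI)
  fix x y show "Q y x + of_real t * R y x = cnj (Q x y + of_real t * R x y)"
    using hf_cnj[OF assms(1), of y x] hf_cnj[OF assms(2), of y x] by simp
qed (simp add: hf_comb assms algebra_simps)

lemma subsp_comb: "subsp V \<Longrightarrow> x \<in> V \<Longrightarrow> y \<in> V \<Longrightarrow> (\<lambda>i. a * x i + b * y i) \<in> V"
  by (auto simp: subsp_def)

lemma subsp_scale: "subsp V \<Longrightarrow> x \<in> V \<Longrightarrow> (\<lambda>i. a * x i) \<in> V"
  using subsp_comb[of V x x a 0] by simp

lemma subsp_sum:
  assumes "subsp V" "finite S" "\<And>j. j \<in> S \<Longrightarrow> f j \<in> V"
  shows "(\<lambda>i. \<Sum>j\<in>S. c j * f j i) \<in> V"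
  using assms(2,3)
proof (induction S)
  case empty
  then show ?case using assms(1) by (simp add: subsp_def zero_fun_def)
next
  case (insert j S)
  then have "(\<lambda>i. c j * f j i + 1 * (\<Sum>j\<in>S. c j * f j i)) \<in> V"
    using subsp_comb[OF assms(1), of "f j" "\<lambda>i. \<Sum>j\<in>S. c j * f j i" "c j" 1] by auto
  then show ?case using insert by simp
qed

lemma subsp_supported: "subsp (supported I)"
  by (auto simp: subsp_def supported_def)

lemma closed_supported: "closed (supported I)"
proof -
  have "supported I = (\<Inter>i\<in>-I. {y. y i = 0})" by (auto simp: supported_def)
  moreover have "closed {y :: 'a \<Rightarrow> complex. y i = 0}" for i
    by (intro closed_Collect_eq continuous_on_product_coordinates continuous_on_const)
  ultimately show ?thesis by auto
qed

lemma supported_expand: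
  assumes "finite I" "y \<in> supported I"
  shows "y = (\<lambda>k. \<Sum>i\<in>I. y i * unit_vec i k)"
proof
  fix k
  have "(\<Sum>i\<in>I. y i * unit_vec i k) = (\<Sum>i\<in>I. if k = i then y i else 0)"
    by (intro sum.cong) (auto simp: unit_vec_def)
  then show "y k = (\<Sum>i\<in>I. y i * unit_vec i k)"
    using assms by (auto simp: supported_def)
qed

lemma unit_vec_supported: "i \<in> I \<Longrightarrow> unit_vec i \<in> supported I"
  by (auto simp: unit_vec_def supported_def)

lemma hf_expand:
  assumes Q: "hermitian_form Q" and "finite I" "x \<in> supported I" "y \<in> supported I"
  shows "Q x y = (\<Sum>j\<in>I. \<Sum>i\<in>I. y j * cnj (x i) * Q (unit_vec i) (unit_vec j))"
proof -
  have right: "Q x y = (\<Sum>j\<in>I. y j * Q x (unit_vec j))"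
    using hf_sum[OF Q \<open>finite I\<close>, of x y unit_vec] supported_expand[OF assms(2,4)] by simp
  have left: "Q x v = (\<Sum>i\<in>I. cnj (x i) * Q (unit_vec i) v)" for v
  proof -
    have "Q v x = (\<Sum>i\<in>I. x i * Q v (unit_vec i))"
      using hf_sum[OF Q \<open>finite I\<close>, of v x unit_vec] supported_expand[OF assms(2,3)] by simp
    then have "cnj (Q v x) = (\<Sum>i\<in>I. cnj (x i) * cnj (Q v (unit_vec i)))" by simp
    then show ?thesis using hf_cnj[OF Q] by (metis (no_types, lifting) sum.cong)
  qed
  show ?thesis unfolding right by (simp add: left[of "unit_vec j" for j] sum_distrib_left mult.assoc)
qed

lemma hf_continuous:
  assumes "hermitian_form Q" "finite I"
  shows "continuous_on (supported I) (\<lambda>y. Q x y)" "continuous_on (supported I) (\<lambda>y. Q y y)"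
proof -
  have coord: "continuous_on (supported I) (\<lambda>y. y i)" for i :: 'a
    by (rule continuous_on_subset[OF continuous_on_product_coordinates]) simp
  have "continuous_on (supported I) (\<lambda>y. \<Sum>i\<in>I. y i * Q x (unit_vec i))"
    by (intro continuous_intros coord)
  moreover have "Q x y = (\<Sum>i\<in>I. y i * Q x (unit_vec i))" if "y \<in> supported I" for y
    using hf_sum[OF assms, of x y unit_vec] supported_expand[OF assms(2) that] by simp
  ultimately show "continuous_on (supported I) (\<lambda>y. Q x y)"
    by (simp cong: continuous_on_cong)
  have "continuous_on (supported I)
    (\<lambda>y. \<Sum>j\<in>I. \<Sum>i\<in>I. y j * cnj (y i) * Q (unit_vec i) (unit_vec j))"
    by (intro continuous_intros coord)
  then show "continuous_on (supported I) (\<lambda>y. Q y y)"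
    by (rule continuous_on_eq) (use hf_expand[OF assms] in auto)
qed

section \<open>Coercivity, Rayleigh minimisers and the variational equation\<close>

lemma sqnorm_nonneg: "0 \<le> sqnorm I y"
  by (simp add: sqnorm_def sum_nonneg)

lemma sqnorm_pos: "finite I \<Longrightarrow> y \<in> supported I \<Longrightarrow> y \<noteq> 0 \<Longrightarrow> 0 < sqnorm I y"
  unfolding sqnorm_def
proof -
  assume "finite I" "y \<in> supported I" "y \<noteq> 0"
  then obtain i where "i \<in> I" "y i \<noteq> 0" by (auto simp: supported_def fun_eq_iff)
  then show "0 < (\<Sum>i\<in>I. (cmod (y i))\<^sup>2)"
    using \<open>finite I\<close> by (intro sum_pos2[of I i]) auto
qed

lemma coercive_pos:
  assumes "coercive I W" "finite I" "y \<in> supported I" "y \<noteq> 0"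
  shows "0 < Re (W y y)"
proof -
  obtain m where "m > 0" "m * sqnorm I y \<le> Re (W y y)"
    using assms by (auto simp: coercive_def)
  with sqnorm_pos[OF assms(2-4)] show ?thesis
    by (meson less_le_trans mult_pos_pos)
qed

lemma coercive_hf: "coercive I W \<Longrightarrow> hermitian_form W"
  by (simp add: coercive_def)

text \<open>The sphere is closed in a product of unit discs over \<open>I\<close> and singletons
  \<open>{0}\<close> elsewhere, which is compact by Tychonoff even when the index type is
  infinite.\<close>

lemma compact_unit_sphere:
  assumes "finite I"
  shows "compact {y \<in> supported I. sqnorm I y = 1}"
proof -
  let ?B = "PiE UNIV (\<lambda>i. if i \<in> I then cball 0 1 else {0}) :: ('a \<Rightarrow> complex) set"
  have "compactin (product_topology (\<lambda>i. euclidean) UNIV) ?B"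
    by (subst compactin_PiE) (auto simp: compactin_euclidean_iff)
  then have "compact ?B"
    by (simp add: euclidean_product_topology flip: compactin_euclidean_iff)
  moreover have "closed {y. sqnorm I y = 1}"
    unfolding sqnorm_def
    by (intro closed_Collect_eq continuous_intros continuous_on_product_coordinates)
  moreover have "{y \<in> supported I. sqnorm I y = 1} = ?B \<inter> ({y. sqnorm I y = 1} \<inter> supported I)"
  proof -
    have "cmod (y i) \<le> 1" if "sqnorm I y = 1" "i \<in> I" for y i
    proof -
      have "(cmod (y i))\<^sup>2 \<le> sqnorm I y"
        unfolding sqnorm_def using assms that by (intro member_le_sum) auto
      then show ?thesis using that by (simp add: power_le_one_iff abs_square_le_1)
    qed
    then show ?thesis by (auto simp: supported_def PiE_def Pi_def)
  qed
  ultimately show ?thesis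
    by (simp add: compact_Int_closed closed_supported closed_Int)
qed

text \<open>The quotient of \<open>Q\<close> by \<open>W\<close> is continuous on the compact unit
  sphere of \<open>V\<close> and attains its minimum \<open>c\<close> there; homogeneity carries the
  bound to all of \<open>V\<close>, and the minimiser is rescaled to \<open>W\<close>-length
  one.\<close>

lemma rayleigh_minimiser:
  assumes I: "finite I" and Q: "hermitian_form Q" and W: "coercive I W"
    and V: "subsp V" "closed V" "V \<subseteq> supported I" and v: "v \<in> V" "v \<noteq> 0"
  shows "\<exists>e c. e \<in> V \<and> Re (W e e) = 1 \<and> Re (Q e e) = c \<and> (\<forall>y\<in>V. c * Re (W y y) \<le> Re (Q y y))"
proof -
  let ?K = "{y \<in> supported I. sqnorm I y = 1} \<inter> V"
  let ?g = "\<lambda>y. Re (Q y y) / Re (W y y)"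
  have hW: "hermitian_form W" using W by (rule coercive_hf)
  have nz: "y \<noteq> 0" if "sqnorm I y = 1" for y using that by (auto simp: sqnorm_def)
  have sc: "sqnorm I (\<lambda>i. of_real a * y i) = a\<^sup>2 * sqnorm I y" for a y
    by (simp add: sqnorm_def norm_mult power_mult_distrib sum_distrib_left)
  have "compact ?K" using compact_unit_sphere[OF I] V(2) by (rule compact_Int_closed)
  moreover have normalised: "(\<lambda>i. of_real (1 / sqrt (sqnorm I y)) * y i) \<in> ?K" if "y \<in> V" "y \<noteq> 0" for y
  proof -
    have "0 < sqnorm I y" using sqnorm_pos[OF I] that V(3) by auto
    then have "sqnorm I (\<lambda>i. of_real (1 / sqrt (sqnorm I y)) * y i) = 1"
      by (simp only: sc) (simp add: power_divide)
    moreover have "(\<lambda>i. of_real (1 / sqrt (sqnorm I y)) * y i) \<in> V"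
      by (rule subsp_scale[OF V(1) that(1)])
    ultimately show ?thesis using V(3) by blast
  qed
  then have "?K \<noteq> {}" using v by blast
  moreover have "continuous_on ?K ?g"
  proof (intro continuous_intros)
    have sub: "?K \<subseteq> supported I" by auto
    show "continuous_on ?K (\<lambda>x. Q x x)" "continuous_on ?K (\<lambda>x. W x x)"
      by (rule continuous_on_subset[OF hf_continuous(2) sub]; fact)+
    show "\<forall>x\<in>?K. Re (W x x) \<noteq> 0"
      using coercive_pos[OF W I] nz by fastforce
  qed
  ultimately obtain u where u: "u \<in> ?K" "\<And>y. y \<in> ?K \<Longrightarrow> ?g u \<le> ?g y"
    using continuous_attains_inf[of ?K ?g] by blast
  have Wu: "0 < Re (W u u)" using u(1) coercive_pos[OF W I, of u] nz by auto
  define c where "c = ?g u"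
  define e where "e = (\<lambda>i. of_real (1 / sqrt (Re (W u u))) * u i)"
  have e_form: "Re (F e e) = Re (F u u) / Re (W u u)" if "hermitian_form F" for F
    unfolding e_def hf_self_scale[OF that] using Wu by (simp add: norm_divide power_divide)
  have "c * Re (W y y) \<le> Re (Q y y)" if y: "y \<in> V" for y
  proof (cases "y = 0")
    case True
    then show ?thesis using hf_zero[OF Q] hf_zero[OF hW] by simp
  next
    case False
    define b where "b = 1 / sqrt (sqnorm I y)"
    have b: "b > 0" using sqnorm_pos[OF I] y V(3) False by (auto simp: b_def)
    have "c \<le> ?g (\<lambda>i. of_real b * y i)"
      unfolding c_def b_def by (rule u(2)[OF normalised[OF y False]])
    also have "\<dots> = ?g y"
      using b by (simp add: hf_self_scale[OF Q] hf_self_scale[OF hW])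
    finally show ?thesis
      using coercive_pos[OF W I, of y] y V(3) False by (auto simp: pos_le_divide_eq)
  qed
  moreover have "e \<in> V" unfolding e_def using u(1) by (intro subsp_scale[OF V(1)]) auto
  moreover have "Re (W e e) = 1" "Re (Q e e) = c"
    using Wu by (auto simp: e_form[OF hW] e_form[OF Q] c_def)
  ultimately show ?thesis by blast
qed

text \<open>First variation at a zero of a semidefinite form: moving from \<open>e\<close> in the
  direction of \<open>- \<beta> * x\<close> would make the form negative unless
  \<open>\<beta> = 0\<close>. Applied to \<open>Q - c W\<close> at a Rayleigh minimiser it yields
  the eigenvalue equation.\<close>

lemma semidefinite_null:
  assumes B: "hermitian_form B" and V: "subsp V" and psd: "\<And>y. y \<in> V \<Longrightarrow> 0 \<le> Re (B y y)"
    and e: "e \<in> V" "Re (B e e) = 0" and x: "x \<in> V"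
  shows "B x e = 0"
proof -
  define \<beta> where "\<beta> = B x e"
  have ex: "B e x = cnj \<beta>" using hf_cnj[OF B] \<beta>_def by blast
  \<comment> \<open>Any positive \<open>s\<close> with \<open>s * Re (B x x) < 2\<close> would
    serve; the added 1 keeps the denominator positive when \<open>x\<close> is itself a null
    vector.\<close>
  define s where "s = 1 / (Re (B x x) + 1)"
  have s: "s > 0" "s * Re (B x x) < 1" using psd[OF x] by (auto simp: s_def field_simps)
  define y where "y = (\<lambda>i. 1 * e i + (- of_real s * \<beta>) * x i)"
  have "y \<in> V" unfolding y_def by (intro subsp_comb V e x)
  have nb: "(complex_of_real (cmod \<beta>))\<^sup>2 = \<beta> * cnj \<beta>"
    using complex_norm_square[of \<beta>] by simp
  have "B y y = B e e + (- of_real s * \<beta>) * B e x + cnj (- of_real s * \<beta>) * B x e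
      + cnj (- of_real s * \<beta>) * (- of_real s * \<beta>) * B x x"
    unfolding y_def by (simp only: hf_comb[OF B] hf_comb_left[OF B]) (simp add: algebra_simps)
  also have "\<dots> = of_real (Re (B e e)) - of_real (2 * s * (cmod \<beta>)\<^sup>2) + of_real (s\<^sup>2 * (cmod \<beta>)\<^sup>2 * Re (B x x))"
    unfolding ex \<beta>_def[symmetric]
    using hf_self_real[OF B, of e] hf_self_real[OF B, of x]
    by (simp add: nb power2_eq_square[of "of_real s"] algebra_simps)
  finally have "B y y = of_real (Re (B e e) - 2 * s * (cmod \<beta>)\<^sup>2 + s\<^sup>2 * (cmod \<beta>)\<^sup>2 * Re (B x x))"
    by simp
  then have "Re (B y y) = Re (B e e) - 2 * s * (cmod \<beta>)\<^sup>2 + s\<^sup>2 * (cmod \<beta>)\<^sup>2 * Re (B x x)"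
    by (simp only: Re_complex_of_real)
  then have "Re (B y y) = s * (cmod \<beta>)\<^sup>2 * (s * Re (B x x) - 2)"
    using e(2) by (simp add: power2_eq_square algebra_simps)
  then have "0 \<le> s * (cmod \<beta>)\<^sup>2 * (s * Re (B x x) - 2)" using psd[OF \<open>y \<in> V\<close>] by simp
  moreover have "s * Re (B x x) - 2 < 0" using s by simp
  ultimately have "s * (cmod \<beta>)\<^sup>2 \<le> 0" by (simp add: zero_le_mult_iff)
  then show ?thesis using s by (simp add: mult_le_0_iff \<beta>_def)
qed

section \<open>Eigenbases and the min-max principle\<close>

text \<open>The eigenvalue equation is tested only against \<open>x\<close> in \<open>V\<close>, so
  constrained problems on a hyperplane are covered as well. The length \<open>d\<close> is a
  parameter because it is computed only after existence is known.\<close>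

definition eigenbasis where
  "eigenbasis V Q W d e l \<longleftrightarrow>
     (\<forall>i<d. e i \<in> V) \<and> (\<forall>i<d. \<forall>j<d. W (e i) (e j) = (if i = j then 1 else (0::complex))) \<and>
     (\<forall>i<d. \<forall>x\<in>V. Q x (e i) = complex_of_real (l i) * W x (e i)) \<and>
     (\<forall>y\<in>V. y = (\<lambda>k. \<Sum>i<d. W (e i) y * e i k)) \<and>
     (\<forall>i j. i \<le> j \<longrightarrow> j < (d::nat) \<longrightarrow> l i \<le> l j)"

lemma eigenbasisD:
  assumes "eigenbasis V Q W d e l"
  shows "i < d \<Longrightarrow> e i \<in> V"
    and "i < d \<Longrightarrow> j < d \<Longrightarrow> W (e i) (e j) = (if i = j then 1 else 0)"
    and "i < d \<Longrightarrow> x \<in> V \<Longrightarrow> Q x (e i) = complex_of_real (l i) * W x (e i)"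
    and "y \<in> V \<Longrightarrow> y = (\<lambda>k. \<Sum>i<d. W (e i) y * e i k)"
    and "i \<le> j \<Longrightarrow> j < d \<Longrightarrow> l i \<le> l j"
  using assms unfolding eigenbasis_def by blast+

text \<open>More vectors than coordinates satisfy a linear relation, and pairing it with each
  \<open>e i\<close> kills its coefficients. This bound makes the greedy construction of
  \<open>eigenbasis_exists\<close> stop.\<close>

lemma orthonormal_length_le:
  fixes k :: nat
  assumes I: "finite I" and W: "hermitian_form W" and e: "\<And>i. i < k \<Longrightarrow> e i \<in> supported I"
    and on: "\<And>i j. i < k \<Longrightarrow> j < k \<Longrightarrow> W (e i) (e j) = (if i = j then 1 else 0)"
  shows "k \<le> card I"
proof (rule ccontr)
  assume "\<not> k \<le> card I"
  then have "card I < card {..<k}" by simp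
  then obtain c where c: "\<exists>j<k. c j \<noteq> 0" "\<And>i. i \<in> I \<Longrightarrow> (\<Sum>j<k. c j * e j i) = 0"
    using homogeneous_system_nontrivial[OF I, of "{..<k}" "\<lambda>i j. e j i"] by auto
  have "(\<lambda>i. \<Sum>j<k. c j * e j i) = 0"
  proof
    fix i show "(\<Sum>j<k. c j * e j i) = 0 i"
      using c(2) e by (cases "i \<in> I") (auto simp: supported_def)
  qed
  moreover have "W (e i) (\<lambda>i. \<Sum>j<k. c j * e j i) = c i" if "i < k" for i
    using that by (subst hf_sum[OF W]) (simp_all add: on sum.delta if_distrib cong: if_cong)
  ultimately have "c i = 0" if "i < k" for i using that hf_zero[OF W] by metis
  then show False using c(1) by auto
qed

lemma orthogonal_residual:
  fixes k :: nat
  assumes W: "hermitian_form W" and V: "subsp V" and e: "\<And>i. i < k \<Longrightarrow> e i \<in> V"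
    and on: "\<And>i j. i < k \<Longrightarrow> j < k \<Longrightarrow> W (e i) (e j) = (if i = j then 1 else 0)" and y: "y \<in> V"
  defines "z \<equiv> \<lambda>m. 1 * y m + (- 1) * (\<Sum>i<k. W (e i) y * e i m)"
  shows "z \<in> V" "\<And>j. j < k \<Longrightarrow> W (e j) z = 0"
proof -
  have "(\<lambda>m. \<Sum>i<k. W (e i) y * e i m) \<in> V" by (rule subsp_sum[OF V finite_lessThan, where f = e]) (use e in auto)
  then show "z \<in> V" unfolding z_def by (rule subsp_comb[OF V y])
  show "W (e j) z = 0" if "j < k" for j
    unfolding z_def hf_comb[OF W] using that
    by (subst hf_sum[OF W]) (simp_all add: on if_distrib cong: if_cong)
qed

text \<open>Take an orthonormal family of successive minimisers of maximal length. If it did not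
  span \<open>V\<close>, a Rayleigh minimiser on its orthogonal complement would lengthen
  it.\<close>

lemma eigenbasis_exists:
  assumes I: "finite I" and Q: "hermitian_form Q" and W: "coercive I W"
    and V: "subsp V" "closed V" "V \<subseteq> supported I"
  shows "\<exists>d e l. eigenbasis V Q W d e l"
proof -
  have hW: "hermitian_form W" using W by (rule coercive_hf)
  \<comment> \<open>The fourth clause says that every value found so far bounds the quotient from
    below on the orthogonal complement. It is what keeps the list sorted when a further minimiser is
    appended.\<close>
  define part where "part k e l \<longleftrightarrow>
     (\<forall>i<k. e i \<in> V) \<and> (\<forall>i<k. \<forall>j<k. W (e i) (e j) = (if i = j then 1 else 0)) \<and>
     (\<forall>i<k. \<forall>x\<in>V. Q x (e i) = complex_of_real (l i) * W x (e i)) \<and>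
     (\<forall>y\<in>V. (\<forall>i<k. W (e i) y = 0) \<longrightarrow> (\<forall>i<k. l i * Re (W y y) \<le> Re (Q y y))) \<and>
     (\<forall>i j. i \<le> j \<longrightarrow> j < k \<longrightarrow> l i \<le> l j)" for k and e :: "nat \<Rightarrow> 'a \<Rightarrow> complex" and l
  have bound: "k \<le> card I" if "\<exists>e l. part k e l" for k
  proof -
    from that obtain e l where p: "part k e l" by auto
    show ?thesis
      by (rule orthonormal_length_le[OF I hW, of k e]) (use p V(3) in \<open>auto simp: part_def\<close>)
  qed
  have "\<exists>e l. part 0 e l" by (simp add: part_def)
  moreover define full where "full k \<longleftrightarrow> (\<exists>e l. part k e l)" for k
  ultimately have "full 0" "\<forall>k. full k \<longrightarrow> k \<le> card I" using bound by simp_all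
  then have "full (GREATEST k. full k)" "\<forall>k. full k \<longrightarrow> k \<le> (GREATEST k. full k)"
    by (auto intro: GreatestI_nat Greatest_le_nat)
  then obtain d where d: "\<exists>e l. part d e l" and max: "\<And>k. \<exists>e l. part k e l \<Longrightarrow> k \<le> d"
    unfolding full_def by metis
  from d obtain e l where p: "part d e l" by auto
  note eV = p[unfolded part_def, THEN conjunct1, rule_format]
    and on = p[unfolded part_def, THEN conjunct2, THEN conjunct1, rule_format]
    and eig = p[unfolded part_def, THEN conjunct2, THEN conjunct2, THEN conjunct1, rule_format]
    and rest = p[unfolded part_def, THEN conjunct2, THEN conjunct2, THEN conjunct2, THEN conjunct1, rule_format]
    and mono = p[unfolded part_def, THEN conjunct2, THEN conjunct2, THEN conjunct2, THEN conjunct2, rule_format]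
  have complete: "v = 0" if v: "v \<in> V" "\<And>i. i < d \<Longrightarrow> W (e i) v = 0" for v
  proof (rule ccontr)
    assume "v \<noteq> 0"
    \<comment> \<open>The orthogonal complement of the family inside \<open>V\<close>; it is closed,
      and \<open>v\<close> shows that it is nonzero.\<close>
    define V' where "V' = V \<inter> (\<Inter>i<d. {y \<in> V. W (e i) y = 0})"
    have V'_iff: "y \<in> V' \<longleftrightarrow> y \<in> V \<and> (\<forall>i<d. W (e i) y = 0)" for y by (auto simp: V'_def)
    have "closed V'" unfolding V'_def
      by (intro closed_Int V closed_INT ballI continuous_closed_preimage_constant
          continuous_on_subset[OF hf_continuous(1)[OF hW I] V(3)])
    moreover have "subsp V'"
      using V(1) by (auto simp: subsp_def V'_iff hf_zero[OF hW] hf_comb[OF hW])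
    moreover have "V' \<subseteq> supported I" using V(3) by (auto simp: V'_iff)
    moreover have "v \<in> V'" using v by (simp add: V'_iff)
    ultimately obtain u c where u: "u \<in> V'" "Re (W u u) = 1" "Re (Q u u) = c"
      and c: "\<And>y. y \<in> V' \<Longrightarrow> c * Re (W y y) \<le> Re (Q y y)"
      using rayleigh_minimiser[OF I Q W _ _ _ _ \<open>v \<noteq> 0\<close>, of V'] by blast
    have uV: "u \<in> V" and uo: "\<And>i. i < d \<Longrightarrow> W (e i) u = 0" using u(1) by (auto simp: V'_iff)
    have uo': "W u (e i) = 0" if "i < d" for i using uo[OF that] hf_cnj[OF hW, of u "e i"] by simp
    have Wuu: "W u u = 1" using hf_self_real[OF hW, of u] u(2) by simp
    let ?B = "\<lambda>x y. Q x y + complex_of_real (- c) * W x y"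
    have "?B x u = 0" if "x \<in> V'" for x
    proof (rule semidefinite_null[of ?B V'])
      show "hermitian_form ?B" by (rule hf_add_mult[OF Q hW])
      show "0 \<le> Re (?B y y)" if "y \<in> V'" for y using c[OF that] by simp
    qed (use u \<open>subsp V'\<close> that in auto)
    then have eigV': "Q x u = of_real c * W x u" if "x \<in> V'" for x using that by simp
    \<comment> \<open>Minimality gives the equation only for test vectors in \<open>V'\<close>. The
      remaining component \<open>s\<close> of \<open>x\<close> lies in the span of the old
      eigenvectors, where both forms vanish against \<open>u\<close>.\<close>
    have eigV: "Q x u = of_real c * W x u" if x: "x \<in> V" for x
    proof -
      define s where "s = (\<lambda>m. \<Sum>i<d. W (e i) x * e i m)"
      define z where "z = (\<lambda>m. 1 * x m + (- 1) * s m)"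
      have "z \<in> V'" unfolding V'_iff z_def s_def
        using orthogonal_residual[OF hW V(1) eV on x] by blast
      have "Q u s = 0"
        unfolding s_def by (subst hf_sum[OF Q]) (simp_all add: eig uV uo')
      then have Qs: "Q s u = 0" using hf_cnj[OF Q, of s u] by simp
      have "W u s = 0"
        unfolding s_def by (subst hf_sum[OF hW]) (simp_all add: uo')
      then have Ws: "W s u = 0" using hf_cnj[OF hW, of s u] by simp
      have x_eq: "x = (\<lambda>m. 1 * z m + 1 * s m)" by (auto simp: z_def)
      show ?thesis
        by (subst (1 2) x_eq) (simp only: hf_comb_left[OF Q] hf_comb_left[OF hW] Qs Ws eigV'[OF \<open>z \<in> V'\<close>], simp)
    qed
    have "part (Suc d) (e(d := u)) (l(d := c))"
      unfolding part_def
    proof (intro conjI allI impI ballI)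
      fix i j assume "i < Suc d" "j < Suc d"
      then show "W ((e(d := u)) i) ((e(d := u)) j) = (if i = j then 1 else 0)"
        by (auto simp: less_Suc_eq on uo uo' Wuu)
    next
      fix y i assume y: "y \<in> V" "\<forall>i<Suc d. W ((e(d := u)) i) y = 0" and i: "i < Suc d"
      from y(2) have "\<And>i. i < d \<Longrightarrow> W (e i) y = 0" by (metis fun_upd_other less_SucI less_irrefl)
      then show "(l(d := c)) i * Re (W y y) \<le> Re (Q y y)"
        using rest[OF y(1)] c[of y] y(1) i by (auto simp: less_Suc_eq V'_iff)
    next
      fix i j assume "i \<le> j" "j < Suc d"
      moreover have "l i \<le> c" if "i < d" for i
        using rest[OF uV uo that] u by simp
      ultimately show "(l(d := c)) i \<le> (l(d := c)) j"
        using mono by (auto simp: less_Suc_eq)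
    qed (use eV eig eigV uV in \<open>auto simp: less_Suc_eq\<close>)
    then show False using max[of "Suc d"] by auto
  qed
  have "y = (\<lambda>k. \<Sum>i<d. W (e i) y * e i k)" if y: "y \<in> V" for y
  proof -
    have "(\<lambda>m. 1 * y m + (- 1) * (\<Sum>i<d. W (e i) y * e i m)) = 0"
      using orthogonal_residual[OF hW V(1) eV on y] by (intro complete) blast+
    then show ?thesis by (auto simp: fun_eq_iff)
  qed
  then have "eigenbasis V Q W d e l"
    using eV on eig mono unfolding eigenbasis_def by blast
  then show ?thesis by blast
qed

section \<open>Comparison of the eigenvalues of two pencils\<close>

lemma eigenbasis_coord:
  assumes "eigenbasis V Q W d e l" "hermitian_form W" "J \<subseteq> {..<d}" "i < d"
  shows "W (e i) (\<lambda>k. \<Sum>j\<in>J. c j * e j k) = (if i \<in> J then c i else 0)"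
proof -
  have J: "finite J" using assms(3) finite_subset by auto
  have "(\<Sum>j\<in>J. c j * W (e i) (e j)) = (\<Sum>j\<in>J. if i = j then c j else 0)"
    using assms eigenbasisD(2)[OF assms(1)] by (intro sum.cong) auto
  then show ?thesis using J by (simp add: hf_sum[OF assms(2) J])
qed

lemma eigenbasis_quad:
  assumes E: "eigenbasis V Q W d e l" and Q: "hermitian_form Q" and W: "hermitian_form W"
    and y: "y \<in> V"
  shows "Re (W y y) = (\<Sum>i<d. (cmod (W (e i) y))\<^sup>2)"
    and "Re (Q y y) = (\<Sum>i<d. l i * (cmod (W (e i) y))\<^sup>2)"
proof -
  have *: "W (e i) y * W y (e i) = of_real ((cmod (W (e i) y))\<^sup>2)" for i
    using hf_cnj[OF W, of y "e i"] complex_norm_square[of "W (e i) y"] by simp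
  have "W y y = W y (\<lambda>k. \<Sum>i<d. W (e i) y * e i k)" using eigenbasisD(4)[OF E y] by simp
  also have "\<dots> = (\<Sum>i<d. of_real ((cmod (W (e i) y))\<^sup>2))"
    by (subst hf_sum[OF W]) (simp_all only: * finite_lessThan)
  finally show "Re (W y y) = (\<Sum>i<d. (cmod (W (e i) y))\<^sup>2)" by simp
  have "Q y y = Q y (\<lambda>k. \<Sum>i<d. W (e i) y * e i k)" using eigenbasisD(4)[OF E y] by simp
  also have "\<dots> = (\<Sum>i<d. W (e i) y * Q y (e i))"
    by (subst hf_sum[OF Q]) simp_all
  also have "\<dots> = (\<Sum>i<d. of_real (l i) * of_real ((cmod (W (e i) y))\<^sup>2))"
  proof (rule sum.cong)
    fix i assume "i \<in> {..<d}"
    then have "W (e i) y * Q y (e i) = of_real (l i) * (W (e i) y * W y (e i))"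
      using eigenbasisD(3)[OF E _ y, of i] by simp
    then show "W (e i) y * Q y (e i) = of_real (l i) * of_real ((cmod (W (e i) y))\<^sup>2)"
      unfolding * .
  qed simp
  also have "\<dots> = of_real (\<Sum>i<d. l i * (cmod (W (e i) y))\<^sup>2)" by simp
  finally show "Re (Q y y) = (\<Sum>i<d. l i * (cmod (W (e i) y))\<^sup>2)" by (metis Re_complex_of_real)
qed

text \<open>In eigencoordinates the quotient of \<open>Q\<close> by \<open>W\<close> is a weighted
  mean of the values \<open>l i\<close> with \<open>i \<le> n\<close>.\<close>

lemma eigenbasis_low:
  assumes E: "eigenbasis V Q W d e l" and Q: "hermitian_form Q" and W: "hermitian_form W"
    and n: "n < d" and y: "y \<in> V" "\<And>i. i < d \<Longrightarrow> n < i \<Longrightarrow> W (e i) y = 0"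
  shows "Re (Q y y) \<le> l n * Re (W y y)"
  unfolding eigenbasis_quad[OF E Q W y(1)] sum_distrib_left
proof (rule sum_mono)
  fix i assume "i \<in> {..<d}"
  then show "l i * (cmod (W (e i) y))\<^sup>2 \<le> l n * (cmod (W (e i) y))\<^sup>2"
    using eigenbasisD(5)[OF E, of i n] n y(2)[of i] by (cases "n < i") (auto intro: mult_right_mono)
qed

lemma eigenbasis_high:
  assumes E: "eigenbasis V Q W d e l" and Q: "hermitian_form Q" and W: "hermitian_form W"
    and n: "n < d" and y: "y \<in> V" "\<And>i. i < n \<Longrightarrow> W (e i) y = 0"
  shows "l n * Re (W y y) \<le> Re (Q y y)"
  unfolding eigenbasis_quad[OF E Q W y(1)] sum_distrib_left
proof (rule sum_mono)
  fix i assume "i \<in> {..<d}"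
  then show "l n * (cmod (W (e i) y))\<^sup>2 \<le> l i * (cmod (W (e i) y))\<^sup>2"
    using eigenbasisD(5)[OF E, of n i] n y(2)[of i] by (cases "i < n") (auto intro: mult_right_mono)
qed

text \<open>The dimension count of the min-max principle: n + 1 coefficients against n linear
  conditions. The functionals \<open>F i\<close> will express orthogonality to the first n
  eigenvectors of another pencil.\<close>

lemma eigenbasis_combination:
  assumes E: "eigenbasis V Q W d e l" and W: "hermitian_form W" and V: "subsp V" and n: "n < d"
    and F: "\<And>i x y a b. i < n \<Longrightarrow> F i (\<lambda>k. a * x k + b * y k) = a * F i x + b * (F i y :: complex)"
  shows "\<exists>y\<in>V. y \<noteq> 0 \<and> (\<forall>i<d. n < i \<longrightarrow> W (e i) y = 0) \<and> (\<forall>i<n. F i y = 0)"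
proof -
  obtain c where c: "\<exists>j\<le>n. c j \<noteq> 0" "\<And>i. i < n \<Longrightarrow> (\<Sum>j\<le>n. c j * F i (e j)) = 0"
    using homogeneous_system_nontrivial[of "{..<n}" "{..n}" "\<lambda>i j. F i (e j)"] by auto
  define y where "y = (\<lambda>k. \<Sum>j\<in>{..n}. c j * e j k)"
  have sub: "{..n} \<subseteq> {..<d}" using n by auto
  have coord: "W (e i) y = (if i \<le> n then c i else 0)" if "i < d" for i
    unfolding y_def using eigenbasis_coord[OF E W sub that] by simp
  have "F i (\<lambda>k. \<Sum>j\<in>S. c j * e j k) = (\<Sum>j\<in>S. c j * F i (e j))" if "i < n" "finite S" for i S
    using that(2)
  proof (induction S)
    case empty
    then show ?case using F[OF that(1), of 0 0 0 0] by simp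
  next
    case (insert j S)
    then show ?case using F[OF that(1), of "c j" "e j" 1] by simp
  qed
  then have "F i y = 0" if "i < n" for i using c(2) that by (simp add: y_def)
  moreover have "y \<in> V" unfolding y_def using n by (intro subsp_sum[OF V] eigenbasisD(1)[OF E]) auto
  moreover have "y \<noteq> 0"
  proof
    assume "y = 0"
    then have "c j = 0" if "j \<le> n" for j using coord[of j] hf_zero[OF W] that n by simp
    then show False using c(1) by blast
  qed
  ultimately show ?thesis using coord by (auto intro!: bexI[of _ y])
qed

text \<open>At a \<open>y\<close> spanned by the first n + 1 primed eigenvectors and orthogonal to
  the first n unprimed ones, \<open>l n * W \<le> Q \<le> c * W\<close>. The comparison is therefore
  needed only where the primed quotient is at most \<open>l' n\<close>.\<close>

lemma eigenvalue_le:
  assumes E: "eigenbasis V Q W d e l" and Q: "hermitian_form Q" and W: "coercive I W"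
    and E': "eigenbasis V' Q' W' d' e' l'" and Q': "hermitian_form Q'" and W': "hermitian_form W'"
    and V: "finite I" "V \<subseteq> supported I" "subsp V'" "V' \<subseteq> V" and n: "n < d" "n < d'"
    and cmp: "\<And>y. y \<in> V' \<Longrightarrow> Re (Q' y y) \<le> l' n * Re (W' y y) \<Longrightarrow> Re (Q y y) \<le> c * Re (W y y)"
  shows "l n \<le> c"
proof -
  have hW: "hermitian_form W" using W by (rule coercive_hf)
  obtain y where y: "y \<in> V'" "y \<noteq> 0" "\<And>i. i < d' \<Longrightarrow> n < i \<Longrightarrow> W' (e' i) y = 0"
    "\<And>i. i < n \<Longrightarrow> W (e i) y = 0"
    using eigenbasis_combination[OF E' W' V(3) n(2), of "\<lambda>i. W (e i)"] by (auto simp: hf_comb[OF hW])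
  have yV: "y \<in> V" using y V by auto
  have "l n * Re (W y y) \<le> Re (Q y y)"
    by (rule eigenbasis_high[OF E Q hW n(1) yV]) (use y in auto)
  also have "\<dots> \<le> c * Re (W y y)"
    by (intro cmp eigenbasis_low[OF E' Q' W' n(2)] y)
  finally show ?thesis
    using coercive_pos[OF W V(1), of y] y V(2) yV by auto
qed

text \<open>Here the unprimed space may be the larger one, so its vectors are carried to
  \<open>V'\<close> by a linear map \<open>P\<close>, and \<open>P y\<close> is made orthogonal to
  the first n primed eigenvectors. \<open>P\<close> may have a kernel: positivity of
  \<open>W\<close> is used at \<open>y\<close>, not at \<open>P y\<close>.\<close>

lemma eigenvalue_ge:
  assumes E: "eigenbasis V Q W d e l" and Q: "hermitian_form Q" and W: "coercive I W"
    and E': "eigenbasis V' Q' W' d' e' l'" and Q': "hermitian_form Q'" and W': "hermitian_form W'"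
    and V: "finite I" "V \<subseteq> supported I" "subsp V" and n: "n < d" "n < d'"
    and P: "\<And>y. y \<in> V \<Longrightarrow> P y \<in> V'"
      "\<And>x y a b. P (\<lambda>k. a * x k + b * y k) = (\<lambda>k. a * P x k + b * P y k)"
    and cmp: "\<And>y. y \<in> V \<Longrightarrow> l' n * Re (W' (P y) (P y)) \<le> Re (Q' (P y) (P y)) \<Longrightarrow> c * Re (W y y) \<le> Re (Q y y)"
  shows "c \<le> l n"
proof -
  have hW: "hermitian_form W" using W by (rule coercive_hf)
  obtain y where y: "y \<in> V" "y \<noteq> 0" "\<And>i. i < d \<Longrightarrow> n < i \<Longrightarrow> W (e i) y = 0"
    "\<And>i. i < n \<Longrightarrow> W' (e' i) (P y) = 0"
    using eigenbasis_combination[OF E hW V(3) n(1), of "\<lambda>i y. W' (e' i) (P y)"]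
    by (auto simp: P(2) hf_comb[OF W'])
  have "c * Re (W y y) \<le> Re (Q y y)"
    by (intro cmp eigenbasis_high[OF E' Q' W' n(2)] y P)
  also have "\<dots> \<le> l n * Re (W y y)"
    by (rule eigenbasis_low[OF E Q hW n(1) y(1)]) (use y in auto)
  finally show ?thesis
    using coercive_pos[OF W V(1), of y] y V(2) by auto
qed

text \<open>Negation exchanges upper with lower bounds and penalties tending to plus with those
  tending to minus infinity, at the price of counting indices from the top.\<close>

lemma eigenbasis_minus:
  assumes E: "eigenbasis V Q W d e l"
  shows "eigenbasis V (\<lambda>x y. - Q x y) W d (\<lambda>i. e (d - Suc i)) (\<lambda>i. - l (d - Suc i))"
  unfolding eigenbasis_def
proof (intro conjI allI ballI impI)
  fix y assume "y \<in> V"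
  then have "y = (\<lambda>k. \<Sum>i<d. W (e i) y * e i k)" by (rule eigenbasisD(4)[OF E])
  also have "\<dots> = (\<lambda>k. \<Sum>i<d. W (e (d - Suc i)) y * e (d - Suc i) k)"
    by (subst sum.nat_diff_reindex) simp
  finally show "y = (\<lambda>k. \<Sum>i<d. W (e (d - Suc i)) y * e (d - Suc i) k)" .
next
  fix i j assume "i < d" "j < d"
  then show "W (e (d - Suc i)) (e (d - Suc j)) = (if i = j then 1 else 0)"
    using eigenbasisD(2)[OF E, of "d - Suc i" "d - Suc j"] by auto
next
  fix i j :: nat assume "i \<le> j" "j < d"
  then show "- l (d - Suc i) \<le> - l (d - Suc j)"
    using eigenbasisD(5)[OF E, of "d - Suc j" "d - Suc i"] by simp
qed (use eigenbasisD(1,3)[OF E] in auto)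

section \<open>Perturbation and penalisation\<close>

definition lin_fun :: "'i set \<Rightarrow> ('i \<Rightarrow> complex) \<Rightarrow> ('i \<Rightarrow> complex) \<Rightarrow> complex" where
  "lin_fun I g y = (\<Sum>i\<in>I. g i * y i)"

definition hyperplane :: "'i set \<Rightarrow> ('i \<Rightarrow> complex) \<Rightarrow> ('i \<Rightarrow> complex) set" where
  "hyperplane I g = {y \<in> supported I. lin_fun I g y = 0}"

lemma lin_fun_comb: "lin_fun I g (\<lambda>k. a * x k + b * y k) = a * lin_fun I g x + b * lin_fun I g y"
  by (simp add: lin_fun_def sum.distrib sum_distrib_left algebra_simps)

lemma lin_fun_unit: "finite I \<Longrightarrow> k \<in> I \<Longrightarrow> lin_fun I g (unit_vec k) = g k"
  by (simp add: lin_fun_def unit_vec_def if_distrib cong: if_cong)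

lemma hf_rank_one: "hermitian_form (\<lambda>x y. cnj (lin_fun I g x) * lin_fun I g y)"
  unfolding hermitian_form_def by (simp add: lin_fun_comb algebra_simps)

lemma subsp_hyperplane: "subsp (hyperplane I g)"
proof -
  have "lin_fun I g 0 = 0" by (simp add: lin_fun_def)
  then show ?thesis
    using subsp_supported[of I] by (auto simp: subsp_def hyperplane_def lin_fun_comb)
qed

lemma closed_hyperplane: "closed (hyperplane I g)"
proof -
  have "closed {y. lin_fun I g y = 0}"
    unfolding lin_fun_def
    by (intro closed_Collect_eq continuous_intros continuous_on_product_coordinates)
  moreover have "hyperplane I g = supported I \<inter> {y. lin_fun I g y = 0}"
    by (auto simp: hyperplane_def)
  ultimately show ?thesis by (simp add: closed_Int closed_supported)
qed

lemma hyperplane_subset: "hyperplane I g \<subseteq> supported I"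
  by (auto simp: hyperplane_def)

section \<open>Dimensions of the full space and of a hyperplane\<close>

lemma orthogonal_to_eigenbasis:
  assumes "eigenbasis V Q W d e l" "y \<in> V" "\<And>i. i < d \<Longrightarrow> W (e i) y = 0"
  shows "y = 0"
  using eigenbasisD(4)[OF assms(1,2)] assms(3) by (auto simp: fun_eq_iff)

lemma eigenbasis_dim_supported:
  assumes E: "eigenbasis (supported I) Q W d e l" and I: "finite I" and W: "hermitian_form W"
  shows "d = card I"
proof (rule antisym)
  show "d \<le> card I"
    by (rule orthonormal_length_le[OF I W]) (use eigenbasisD(1,2)[OF E] in auto)
  show "card I \<le> d"
  proof (rule ccontr)
    assume "\<not> card I \<le> d"
    then have "card {..<d} < card I" by simp
    then obtain c where c: "\<exists>j\<in>I. c j \<noteq> 0" "\<And>i. i < d \<Longrightarrow> (\<Sum>j\<in>I. c j * W (e i) (unit_vec j)) = 0"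
      using homogeneous_system_nontrivial[of "{..<d}" I "\<lambda>i j. W (e i) (unit_vec j)"] I by auto
    define y where "y = (\<lambda>i. if i \<in> I then c i else 0)"
    have y: "y \<in> supported I" by (auto simp: y_def supported_def)
    have "W (e i) y = 0" if "i < d" for i
      using c(2)[OF that] hf_sum[OF W I, of "e i" y unit_vec] supported_expand[OF I y] by (simp add: y_def)
    then have "y = 0" by (rule orthogonal_to_eigenbasis[OF E y])
    then show False using c(1) by (auto simp: y_def fun_eq_iff split: if_splits)
  qed
qed

text \<open>Upper bound: since \<open>g k\<close> is nonzero, the other coordinates determine
  coordinate \<open>k\<close> on the hyperplane. Lower bound: orthogonality to the basis and
  membership in the hyperplane are only \<open>d + 1\<close> equations.\<close>

lemma eigenbasis_dim_hyperplane:
  assumes E: "eigenbasis (hyperplane I g) Q W d e l" and I: "finite I" and W: "hermitian_form W"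
    and k: "k \<in> I" "g k \<noteq> 0"
  shows "d = card I - 1"
proof (rule antisym)
  have cI: "card (I - {k}) = card I - 1" "card I > 0" using I k by (auto simp: card_gt_0_iff)
  show "d \<le> card I - 1"
  proof (rule ccontr)
    assume "\<not> d \<le> card I - 1"
    then have "card (I - {k}) < card {..<d}" using cI by simp
    then obtain c where c: "\<exists>j<d. c j \<noteq> 0" "\<And>i. i \<in> I - {k} \<Longrightarrow> (\<Sum>j<d. c j * e j i) = 0"
      using homogeneous_system_nontrivial[of "I - {k}" "{..<d}" "\<lambda>i j. e j i"] I by auto
    define y where "y = (\<lambda>i. \<Sum>j<d. c j * e j i)"
    have y: "y \<in> hyperplane I g" unfolding y_def
      by (rule subsp_sum[OF subsp_hyperplane]) (use eigenbasisD(1)[OF E] in auto)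
    have "lin_fun I g y = g k * y k"
      unfolding lin_fun_def using I k c(2) by (subst sum.remove[of I k]) (auto simp: y_def)
    then have "y k = 0" using y k by (simp add: hyperplane_def)
    then have "y = 0" using y c(2) by (auto simp: fun_eq_iff y_def hyperplane_def supported_def)
    moreover have "W (e j) y = c j" if "j < d" for j
      unfolding y_def using eigenbasis_coord[OF E W _ that, of "{..<d}" c] that by simp
    ultimately show False using c(1) hf_zero[OF W] by auto
  qed
  show "card I - 1 \<le> d"
  proof (rule ccontr)
    assume "\<not> card I - 1 \<le> d"
    then have less: "card {..d} < card I" by simp
    \<comment> \<open>Index \<open>d\<close>, which is free among the eigenvectors, carries the
      equation of the hyperplane.\<close>
    define F where "F i = (if i = d then lin_fun I g else W (e i))" for i
    obtain c where c: "\<exists>j\<in>I. c j \<noteq> 0" "\<And>i. i \<le> d \<Longrightarrow> (\<Sum>j\<in>I. c j * F i (unit_vec j)) = 0"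
      using homogeneous_system_nontrivial[OF _ I less, of "\<lambda>i j. F i (unit_vec j)"] by auto
    define y where "y = (\<lambda>i. if i \<in> I then c i else 0)"
    have y: "y \<in> supported I" by (auto simp: y_def supported_def)
    have "lin_fun I g y = (\<Sum>j\<in>I. c j * F d (unit_vec j))"
      unfolding lin_fun_def F_def using I by (intro sum.cong) (auto simp: y_def lin_fun_unit lin_fun_def[symmetric])
    then have y': "y \<in> hyperplane I g" using y c(2) by (simp add: hyperplane_def)
    have "W (e i) y = 0" if "i < d" for i
      using c(2)[of i] that hf_sum[OF W I, of "e i" y unit_vec] supported_expand[OF I y]
      by (simp add: y_def F_def)
    then have "y = 0" by (rule orthogonal_to_eigenbasis[OF E y'])
    then show False using c(1) by (auto simp: y_def fun_eq_iff split: if_splits)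
  qed
qed

section \<open>Convergence of eigenvalues under convergence of the forms\<close>

lemma cmod_le_sqnorm: "finite I \<Longrightarrow> i \<in> I \<Longrightarrow> (cmod (y i))\<^sup>2 \<le> sqnorm I y"
  unfolding sqnorm_def by (rule member_le_sum) auto

lemma hf_bound:
  assumes "hermitian_form R" "finite I" "y \<in> supported I"
  shows "\<bar>Re (R y y)\<bar> \<le> (\<Sum>j\<in>I. \<Sum>i\<in>I. cmod (R (unit_vec i) (unit_vec j))) * sqnorm I y"
proof -
  have "cmod (y j * cnj (y i) * R (unit_vec i) (unit_vec j)) \<le>
      cmod (R (unit_vec i) (unit_vec j)) * sqnorm I y" if "i \<in> I" "j \<in> I" for i j
  proof -
    have "0 \<le> (cmod (y j) - cmod (y i))\<^sup>2" by simp
    then have "2 * (cmod (y j) * cmod (y i)) \<le> (cmod (y j))\<^sup>2 + (cmod (y i))\<^sup>2"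
      by (simp add: power2_diff)
    then have "cmod (y j) * cmod (y i) \<le> sqnorm I y"
      using cmod_le_sqnorm[OF assms(2) that(1), of y] cmod_le_sqnorm[OF assms(2) that(2), of y] by linarith
    from mult_right_mono[OF this, of "cmod (R (unit_vec i) (unit_vec j))"] show ?thesis
      by (simp add: norm_mult mult.commute)
  qed
  then have "cmod (R y y) \<le> (\<Sum>j\<in>I. \<Sum>i\<in>I. cmod (R (unit_vec i) (unit_vec j)) * sqnorm I y)"
    unfolding hf_expand[OF assms(1,2,3,3)] by (intro order.trans[OF norm_sum] sum_mono)
  then show ?thesis
    using abs_Re_le_cmod[of "R y y"] by (simp add: sum_distrib_right)
qed

text \<open>A form on a finite-dimensional space is controlled by its finitely many entries on unit
  vectors, so pointwise convergence is already uniform relative to \<open>sqnorm\<close>.\<close>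

lemma hf_perturbation:
  assumes I: "finite I" and Q: "\<And>\<omega>. hermitian_form (Q \<omega>)" "hermitian_form Q0"
    and lim: "\<And>x y. ((\<lambda>\<omega>. Q \<omega> x y) \<longlongrightarrow> Q0 x y) F" and \<epsilon>: "\<epsilon> > 0"
  shows "\<forall>\<^sub>F \<omega> in F. \<forall>y\<in>supported I. \<bar>Re (Q \<omega> y y) - Re (Q0 y y)\<bar> \<le> \<epsilon> * sqnorm I y"
proof -
  let ?R = "\<lambda>\<omega> x y. Q \<omega> x y + complex_of_real (- 1) * Q0 x y"
  let ?S = "\<lambda>\<omega>. \<Sum>j\<in>I. \<Sum>i\<in>I. cmod (?R \<omega> (unit_vec i) (unit_vec j))"
  have "(?S \<longlongrightarrow> (\<Sum>j\<in>I. \<Sum>i\<in>I. cmod (Q0 (unit_vec i) (unit_vec j) + complex_of_real (- 1) * Q0 (unit_vec i) (unit_vec j)))) F"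
    by (intro tendsto_intros lim)
  then have "(?S \<longlongrightarrow> 0) F" by simp
  then have "\<forall>\<^sub>F \<omega> in F. ?S \<omega> < \<epsilon>" using \<epsilon> by (simp add: order_tendstoD(2))
  then show ?thesis
  proof (rule eventually_mono, intro ballI)
    fix \<omega> y assume S: "?S \<omega> < \<epsilon>" and y: "y \<in> supported I"
    have "\<bar>Re (?R \<omega> y y)\<bar> \<le> ?S \<omega> * sqnorm I y"
      by (rule hf_bound[OF hf_add_mult[OF Q] I y])
    also have "\<dots> \<le> \<epsilon> * sqnorm I y" using S by (intro mult_right_mono sqnorm_nonneg) auto
    finally show "\<bar>Re (Q \<omega> y y) - Re (Q0 y y)\<bar> \<le> \<epsilon> * sqnorm I y" by simp
  qed
qed

lemma pencil_perturbation:
  assumes I: "finite I" and Q: "\<And>\<omega>. hermitian_form (Q \<omega>)" "hermitian_form Q0"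
    and W: "\<And>\<omega>. hermitian_form (W \<omega>)" "hermitian_form W0"
    and lim: "\<And>x y. ((\<lambda>\<omega>. Q \<omega> x y) \<longlongrightarrow> Q0 x y) F" "\<And>x y. ((\<lambda>\<omega>. W \<omega> x y) \<longlongrightarrow> W0 x y) F"
    and \<epsilon>: "\<epsilon> > 0"
  shows "\<forall>\<^sub>F \<omega> in F. \<forall>y\<in>supported I.
     \<bar>(Re (Q \<omega> y y) - c * Re (W \<omega> y y)) - (Re (Q0 y y) - c * Re (W0 y y))\<bar> \<le> \<epsilon> * sqnorm I y"
proof -
  have "\<forall>\<^sub>F \<omega> in F. \<forall>y\<in>supported I.
     \<bar>Re (Q \<omega> y y + complex_of_real (- c) * W \<omega> y y) - Re (Q0 y y + complex_of_real (- c) * W0 y y)\<bar>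
       \<le> \<epsilon> * sqnorm I y"
    by (rule hf_perturbation[OF I hf_add_mult[OF Q(1) W(1)] hf_add_mult[OF Q(2) W(2)] _ \<epsilon>])
      (intro tendsto_intros lim)
  then show ?thesis by simp
qed

text \<open>The forms \<open>R \<omega>\<close> and \<open>Q \<omega>\<close> only have to agree on the smaller space \<open>V'\<close>, so that this also
  bounds the eigenvalues of a penalised form by those of the constrained one.\<close>

lemma eventually_eigenvalue_le:
  assumes I: "finite I" and Q: "\<And>\<omega>. hermitian_form (Q \<omega>)" "hermitian_form Q0"
    and W: "\<And>\<omega>. hermitian_form (W \<omega>)" "coercive I W0"
    and lim: "\<And>x y. ((\<lambda>\<omega>. Q \<omega> x y) \<longlongrightarrow> Q0 x y) F" "\<And>x y. ((\<lambda>\<omega>. W \<omega> x y) \<longlongrightarrow> W0 x y) F"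
    and R: "\<And>\<omega>. hermitian_form (R \<omega>)" "\<And>\<omega> y. y \<in> V' \<Longrightarrow> R \<omega> y y = Q \<omega> y y"
    and E: "\<forall>\<^sub>F \<omega> in F. coercive I (W \<omega>) \<and> eigenbasis V (R \<omega>) (W \<omega>) d (e \<omega>) (l \<omega>)"
    and E0: "eigenbasis V' Q0 W0 d' e' l'"
    and V: "V \<subseteq> supported I" "subsp V'" "V' \<subseteq> V" and n: "n < d" "n < d'" and c: "l' n < c"
  shows "\<forall>\<^sub>F \<omega> in F. l \<omega> n \<le> c"
proof -
  have W0: "hermitian_form W0" using W(2) by (rule coercive_hf)
  obtain m where m: "m > 0" "\<And>y. y \<in> supported I \<Longrightarrow> m * sqnorm I y \<le> Re (W0 y y)"
    using W(2) by (auto simp: coercive_def)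
  \<comment> \<open>This is the admissible error: the gap between \<open>c\<close> and
    \<open>l' n\<close>, multiplied by \<open>W0\<close>, dominates that multiple of
    \<open>sqnorm\<close>.\<close>
  have "0 < (c - l' n) * m" using c m by simp
  from pencil_perturbation[OF I Q W(1) W0 lim this, of c] E show ?thesis
  proof eventually_elim
    case (elim \<omega>)
    then have E1: "coercive I (W \<omega>)" "eigenbasis V (R \<omega>) (W \<omega>) d (e \<omega>) (l \<omega>)" by auto
    show ?case
    proof (rule eigenvalue_le[OF E1(2) R(1) E1(1) E0 Q(2) W0 I V n])
      fix y assume y: "y \<in> V'" and le: "Re (Q0 y y) \<le> l' n * Re (W0 y y)"
      have ys: "y \<in> supported I" using y V by auto
      have "(Re (Q \<omega> y y) - c * Re (W \<omega> y y)) - (Re (Q0 y y) - c * Re (W0 y y)) \<le> (c - l' n) * (m * sqnorm I y)"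
        using elim(1) ys by (force simp: mult.assoc)
      also have "\<dots> \<le> (c - l' n) * Re (W0 y y)" using c m(2)[OF ys] by (intro mult_left_mono) auto
      finally have "Re (Q \<omega> y y) \<le> c * Re (W \<omega> y y)" using le by (simp add: algebra_simps)
      then show "Re (R \<omega> y y) \<le> c * Re (W \<omega> y y)" using R(2)[OF y] by simp
    qed
  qed
qed

text \<open>Upper bounds come from \<open>eventually_eigenvalue_le\<close>; the same bound for the
  negated forms supplies the lower ones.\<close>

lemma eigenvalue_tendsto:
  assumes I: "finite I" and Q: "\<And>\<omega>. hermitian_form (Q \<omega>)" "hermitian_form Q0"
    and W: "\<And>\<omega>. hermitian_form (W \<omega>)" "coercive I W0"
    and lim: "\<And>x y. ((\<lambda>\<omega>. Q \<omega> x y) \<longlongrightarrow> Q0 x y) F" "\<And>x y. ((\<lambda>\<omega>. W \<omega> x y) \<longlongrightarrow> W0 x y) F"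
    and E: "\<forall>\<^sub>F \<omega> in F. coercive I (W \<omega>) \<and> eigenbasis V (Q \<omega>) (W \<omega>) d (e \<omega>) (l \<omega>)"
    and E0: "eigenbasis V Q0 W0 d e' l'"
    and V: "V \<subseteq> supported I" "subsp V" and n: "n < d"
  shows "((\<lambda>\<omega>. l \<omega> n) \<longlongrightarrow> l' n) F"
proof (rule order_tendstoI)
  fix a assume "l' n < a"
  then obtain c where c: "l' n < c" "c < a" using dense by blast
  have "\<forall>\<^sub>F \<omega> in F. l \<omega> n \<le> c"
    by (rule eventually_eigenvalue_le[OF I Q W lim Q(1) refl E E0 V order.refl n n c(1)])
  then show "\<forall>\<^sub>F \<omega> in F. l \<omega> n < a" by eventually_elim (use c in auto)
next
  fix a assume "a < l' n"
  then obtain c where c: "a < c" "c < l' n" using dense by blast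
  \<comment> \<open>The index \<open>d - Suc (d - Suc n)\<close> equals \<open>n\<close> because
    \<open>n < d\<close>; it is the shape in which \<open>eigenbasis_minus\<close> delivers
    it.\<close>
  have "\<forall>\<^sub>F \<omega> in F. - l \<omega> (d - Suc (d - Suc n)) \<le> - c"
  proof (rule eventually_eigenvalue_le[where l = "\<lambda>\<omega> i. - l \<omega> (d - Suc i)" and Q = "\<lambda>\<omega> x y. - Q \<omega> x y"
        and W = W and R = "\<lambda>\<omega> x y. - Q \<omega> x y" and e = "\<lambda>\<omega> i. e \<omega> (d - Suc i)", OF I hf_minus[OF Q(1)] hf_minus[OF Q(2)] W tendsto_minus[OF lim(1)] lim(2)
        hf_minus[OF Q(1)] refl _ eigenbasis_minus[OF E0] V order.refl])
    show "\<forall>\<^sub>F \<omega> in F. coercive I (W \<omega>) \<and>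
       eigenbasis V (\<lambda>x y. - Q \<omega> x y) (W \<omega>) d (\<lambda>i. e \<omega> (d - Suc i)) (\<lambda>i. - l \<omega> (d - Suc i))"
      using E by eventually_elim (auto intro: eigenbasis_minus)
  qed (use n c in auto)
  then have "\<forall>\<^sub>F \<omega> in F. c \<le> l \<omega> n" using n by simp
  then show "\<forall>\<^sub>F \<omega> in F. a < l \<omega> n" by eventually_elim (use c in auto)
qed

section \<open>Penalising the distance from a hyperplane\<close>

lemma coordinate_le_root_sqnorm: "finite I \<Longrightarrow> i \<in> I \<Longrightarrow> cmod (y i) \<le> sqrt (sqnorm I y)"
  by (rule real_le_rsqrt) (rule cmod_le_sqnorm)

text \<open>For \<open>g k = 1\<close> this is the oblique projection onto the hyperplane along the
  \<open>k\<close>-th axis. Unlike a \<open>W\<close>-orthogonal projection it does not vary with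
  the equation.\<close>

definition hyperplane_proj :: "'i set \<Rightarrow> ('i \<Rightarrow> complex) \<Rightarrow> 'i \<Rightarrow> ('i \<Rightarrow> complex) \<Rightarrow> 'i \<Rightarrow> complex" where
  "hyperplane_proj I g k y = (\<lambda>i. 1 * y i + (- lin_fun I g y) * unit_vec k i)"

lemma hyperplane_proj_mem:
  assumes "finite I" "k \<in> I" "g k = 1" "y \<in> supported I"
  shows "hyperplane_proj I g k y \<in> hyperplane I g"
  unfolding hyperplane_def hyperplane_proj_def mem_Collect_eq lin_fun_comb
  using assms lin_fun_unit[OF assms(1,2), of g]
    subsp_comb[OF subsp_supported assms(4) unit_vec_supported[OF assms(2)], of 1 "- lin_fun I g y"]
  by auto

lemma hyperplane_proj_comb:
  "hyperplane_proj I g k (\<lambda>i. a * x i + b * y i) = (\<lambda>i. a * hyperplane_proj I g k x i + b * hyperplane_proj I g k y i)"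
  by (simp add: hyperplane_proj_def lin_fun_comb fun_eq_iff algebra_simps)

text \<open>Write \<open>y = u + s * unit_vec k\<close> with \<open>s = lin_fun I g y\<close>. The
  mixed terms are split by Young's inequality into a small multiple of \<open>sqnorm I u\<close> and
  a large multiple of the squared modulus of \<open>s\<close>, so one may take
  \<open>K = C\<^sup>2 / \<delta> + \<bar>Re (B ?v ?v)\<bar>\<close>.\<close>

lemma hf_hyperplane_proj_bound:
  assumes B: "hermitian_form B" and I: "finite I" and k: "k \<in> I" "g k = 1" and \<delta>: "\<delta> > 0"
  shows "\<exists>K. \<forall>y\<in>supported I. let u = hyperplane_proj I g k y in
     Re (B u u) - \<delta> * sqnorm I u - K * (cmod (lin_fun I g y))\<^sup>2 \<le> Re (B y y)"
proof -
  let ?v = "unit_vec k"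
  define C where "C = (\<Sum>i\<in>I. cmod (B ?v (unit_vec i)))"
  have "Re (B u u) - \<delta> * sqnorm I u - (C\<^sup>2 / \<delta> + \<bar>Re (B ?v ?v)\<bar>) * (cmod (lin_fun I g y))\<^sup>2 \<le> Re (B y y)"
    if y: "y \<in> supported I" and u: "u = hyperplane_proj I g k y" for y u
  proof -
    define s where "s = lin_fun I g y"
    define a where "a = sqrt (sqnorm I u)"
    have a: "a\<^sup>2 = sqnorm I u" "a \<ge> 0" by (simp_all add: a_def sqnorm_nonneg)
    have us: "u \<in> supported I" using hyperplane_proj_mem[where g = g and k = k, OF I k y] u hyperplane_subset by auto
    have y_eq: "y = (\<lambda>i. 1 * u i + s * ?v i)" by (simp add: u hyperplane_proj_def s_def)
    have "B ?v u = (\<Sum>i\<in>I. u i * B ?v (unit_vec i))"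
      using hf_sum[OF B I, of ?v u unit_vec] supported_expand[OF I us] by simp
    then have "cmod (B ?v u) \<le> (\<Sum>i\<in>I. a * cmod (B ?v (unit_vec i)))"
      unfolding a_def
      by (auto intro!: order.trans[OF norm_sum] sum_mono mult_right_mono coordinate_le_root_sqnorm I simp: norm_mult)
    then have cross: "cmod (B ?v u) \<le> a * C" by (simp add: C_def sum_distrib_left)
    have "B y y = B u u + s * B u ?v + cnj s * B ?v u + (s * cnj s) * B ?v ?v"
      by (subst (1 2) y_eq) (simp only: hf_comb[OF B] hf_comb_left[OF B], simp add: algebra_simps)
    moreover have "B u ?v = cnj (B ?v u)" by (rule hf_cnj[OF B])
    moreover have "Re ((s * cnj s) * B ?v ?v) = (cmod s)\<^sup>2 * Re (B ?v ?v)"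
      by (simp add: complex_norm_square[symmetric] del: of_real_power)
    ultimately have "Re (B y y) = Re (B u u) + 2 * Re (cnj s * B ?v u) + (cmod s)\<^sup>2 * Re (B ?v ?v)"
      by simp
    moreover have "- (cmod s * (a * C)) \<le> Re (cnj s * B ?v u)"
    proof -
      have "\<bar>Re (cnj s * B ?v u)\<bar> \<le> cmod s * cmod (B ?v u)"
        using abs_Re_le_cmod[of "cnj s * B ?v u"] by (simp add: norm_mult)
      also have "\<dots> \<le> cmod s * (a * C)" using cross by (intro mult_left_mono) auto
      finally show ?thesis by simp
    qed
    moreover have "- ((cmod s)\<^sup>2 * \<bar>Re (B ?v ?v)\<bar>) \<le> (cmod s)\<^sup>2 * Re (B ?v ?v)"
    proof -
      have "(cmod s)\<^sup>2 * - \<bar>Re (B ?v ?v)\<bar> \<le> (cmod s)\<^sup>2 * Re (B ?v ?v)" by (intro mult_left_mono) auto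
      then show ?thesis by simp
    qed
    moreover have "2 * (cmod s * (a * C)) \<le> \<delta> * a\<^sup>2 + C\<^sup>2 / \<delta> * (cmod s)\<^sup>2"
    proof -
      \<comment> \<open>Young's inequality, read off from a square divided by
        \<open>\<delta>\<close>.\<close>
      have "0 \<le> (\<delta> * a - C * cmod s)\<^sup>2 / \<delta>" using \<delta> by simp
      also have "\<dots> = \<delta> * a\<^sup>2 + C\<^sup>2 / \<delta> * (cmod s)\<^sup>2 - 2 * (cmod s * (a * C))"
        using \<delta> by (simp add: power2_eq_square field_simps)
      finally show ?thesis by simp
    qed
    ultimately show ?thesis unfolding s_def[symmetric] a(1)[symmetric] by (simp add: algebra_simps)
  qed
  then show ?thesis unfolding Let_def by blast
qed

text \<open>The polarised \<open>sqnorm\<close>, so that an error term can be absorbed into a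
  Hermitian form.\<close>

definition std_form :: "'i set \<Rightarrow> ('i \<Rightarrow> complex) \<Rightarrow> ('i \<Rightarrow> complex) \<Rightarrow> complex" where
  "std_form I x y = (\<Sum>i\<in>I. cnj (x i) * y i)"

lemma hf_std_form: "hermitian_form (std_form I)"
  unfolding hermitian_form_def std_form_def
  by (simp add: sum.distrib sum_distrib_left algebra_simps)

lemma std_form_self: "Re (std_form I y y) = sqnorm I y"
  unfolding std_form_def sqnorm_def Re_sum
  by (intro sum.cong refl) (simp add: cmod_power2, simp add: power2_eq_square)

text \<open>\<open>eigenvalue_ge\<close> is applied with the projection to the hyperplane. The gap
  above \<open>c\<close> on the hyperplane covers both the change of the forms and the small part of
  the projection error; once \<open>t \<omega> \<ge> K\<close>, the penalty covers the rest.\<close>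

lemma eventually_penalised_eigenvalue_ge:
  assumes I: "finite I" and Q: "\<And>\<omega>. hermitian_form (Q \<omega>)" "hermitian_form Q0"
    and W: "\<And>\<omega>. hermitian_form (W \<omega>)" "coercive I W0"
    and lim: "\<And>x y. ((\<lambda>\<omega>. Q \<omega> x y) \<longlongrightarrow> Q0 x y) F" "\<And>x y. ((\<lambda>\<omega>. W \<omega> x y) \<longlongrightarrow> W0 x y) F"
    and t: "filterlim t at_top F"
    and k: "k \<in> I" "g k = 1"
    and E: "\<forall>\<^sub>F \<omega> in F. coercive I (W \<omega>) \<and> eigenbasis (supported I)
        (\<lambda>x y. Q \<omega> x y + complex_of_real (t \<omega>) * (cnj (lin_fun I g x) * lin_fun I g y)) (W \<omega>) d (e \<omega>) (l \<omega>)"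
    and E0: "eigenbasis (hyperplane I g) Q0 W0 d' e' l'"
    and n: "n < d" "n < d'" and c: "c < l' n"
  shows "\<forall>\<^sub>F \<omega> in F. c \<le> l \<omega> n"
proof -
  have W0: "hermitian_form W0" using W(2) by (rule coercive_hf)
  obtain m where m: "m > 0" "\<And>y. y \<in> supported I \<Longrightarrow> m * sqnorm I y \<le> Re (W0 y y)"
    using W(2) by (auto simp: coercive_def)
  \<comment> \<open>Half of the gap: one \<open>\<delta>\<close> is spent on the perturbation at
    \<open>y\<close> and is built into \<open>B\<close>, the other on the mixed terms at the
    projected vector \<open>u\<close>.\<close>
  define \<delta> where "\<delta> = (l' n - c) * m / 2"
  have \<delta>: "\<delta> > 0" and \<delta>2: "2 * \<delta> = (l' n - c) * m" using c m by (simp_all add: \<delta>_def)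
  define B where "B x y = (Q0 x y + complex_of_real (- c) * W0 x y) + complex_of_real (- \<delta>) * std_form I x y" for x y
  have B: "hermitian_form B" unfolding B_def by (intro hf_add_mult Q W0 hf_std_form)
  have ReB: "Re (B y y) = Re (Q0 y y) - c * Re (W0 y y) - \<delta> * sqnorm I y" for y
    by (simp add: B_def std_form_self)
  obtain K where K: "\<And>y u. y \<in> supported I \<Longrightarrow> u = hyperplane_proj I g k y \<Longrightarrow>
     Re (B u u) - \<delta> * sqnorm I u - K * (cmod (lin_fun I g y))\<^sup>2 \<le> Re (B y y)"
    using hf_hyperplane_proj_bound[where g = g and k = k, OF B I k \<delta>] unfolding Let_def by blast
  have "\<forall>\<^sub>F \<omega> in F. K \<le> t \<omega>" using t by (simp add: filterlim_at_top)
  with pencil_perturbation[OF I Q W(1) W0 lim \<delta>, of c] E show ?thesis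
  proof eventually_elim
    case (elim \<omega>)
    let ?R = "\<lambda>x y. Q \<omega> x y + complex_of_real (t \<omega>) * (cnj (lin_fun I g x) * lin_fun I g y)"
    from elim have E1: "coercive I (W \<omega>)" "eigenbasis (supported I) ?R (W \<omega>) d (e \<omega>) (l \<omega>)" by auto
    show ?case
    proof (rule eigenvalue_ge[OF E1(2) hf_add_mult[OF Q(1) hf_rank_one] E1(1) E0 Q(2) W0 I order.refl
          subsp_supported n, of "hyperplane_proj I g k"])
      fix y assume y: "y \<in> supported I"
      define u where "u = hyperplane_proj I g k y"
      assume le: "l' n * Re (W0 (hyperplane_proj I g k y) (hyperplane_proj I g k y)) \<le>
         Re (Q0 (hyperplane_proj I g k y) (hyperplane_proj I g k y))"
      have us: "u \<in> supported I" using hyperplane_proj_mem[where g = g and k = k, OF I k y] u_def hyperplane_subset by auto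
      have "(l' n - c) * (m * sqnorm I u) \<le> (l' n - c) * Re (W0 u u)"
        using c m(2)[OF us] by (intro mult_left_mono) auto
      then have "0 \<le> Re (Q0 u u) - c * Re (W0 u u) - 2 * \<delta> * sqnorm I u"
        using le unfolding u_def[symmetric] \<delta>2 by (simp add: algebra_simps)
      then have "- K * (cmod (lin_fun I g y))\<^sup>2 \<le> Re (B y y)"
        using K[OF y u_def] unfolding ReB by linarith
      moreover have "K * (cmod (lin_fun I g y))\<^sup>2 \<le> t \<omega> * (cmod (lin_fun I g y))\<^sup>2"
        using elim(3) by (intro mult_right_mono) auto
      moreover have "Re (Q0 y y) - c * Re (W0 y y) - \<delta> * sqnorm I y \<le> Re (Q \<omega> y y) - c * Re (W \<omega> y y)"
        using elim(1) y by (force simp: abs_le_iff)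
      moreover have "Re (of_real (t \<omega>) * (cnj (lin_fun I g y) * lin_fun I g y)) = t \<omega> * (cmod (lin_fun I g y))\<^sup>2"
        by (simp add: cmod_power2, simp add: power2_eq_square algebra_simps)
      ultimately show "c * Re (W \<omega> y y) \<le> Re (Q \<omega> y y + of_real (t \<omega>) * (cnj (lin_fun I g y) * lin_fun I g y))"
        unfolding ReB plus_complex.sel by linarith
    qed (use hyperplane_proj_mem[where g = g and k = k, OF I k] hyperplane_proj_comb in auto)
  qed
qed

text \<open>Only the lower bound uses the growth of \<open>t\<close>; the upper one holds because
  the penalty is zero on the hyperplane.\<close>

lemma penalised_eigenvalue_tendsto:
  assumes I: "finite I" and Q: "\<And>\<omega>. hermitian_form (Q \<omega>)" "hermitian_form Q0"
    and W: "\<And>\<omega>. hermitian_form (W \<omega>)" "coercive I W0"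
    and lim: "\<And>x y. ((\<lambda>\<omega>. Q \<omega> x y) \<longlongrightarrow> Q0 x y) F" "\<And>x y. ((\<lambda>\<omega>. W \<omega> x y) \<longlongrightarrow> W0 x y) F"
    and t: "filterlim t at_top F"
    and k: "k \<in> I" "g k = 1"
    and E: "\<forall>\<^sub>F \<omega> in F. coercive I (W \<omega>) \<and> eigenbasis (supported I)
        (\<lambda>x y. Q \<omega> x y + complex_of_real (t \<omega>) * (cnj (lin_fun I g x) * lin_fun I g y)) (W \<omega>) d (e \<omega>) (l \<omega>)"
    and E0: "eigenbasis (hyperplane I g) Q0 W0 d' e' l'"
    and n: "n < d" "n < d'"
  shows "((\<lambda>\<omega>. l \<omega> n) \<longlongrightarrow> l' n) F"
proof (rule order_tendstoI)
  fix a assume "l' n < a"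
  then obtain c where c: "l' n < c" "c < a" using dense by blast
  have "\<forall>\<^sub>F \<omega> in F. l \<omega> n \<le> c"
    by (rule eventually_eigenvalue_le[OF I Q W lim hf_add_mult[OF Q(1) hf_rank_one] _ E E0 order.refl
          subsp_hyperplane hyperplane_subset n c(1)]) (simp add: hyperplane_def)
  then show "\<forall>\<^sub>F \<omega> in F. l \<omega> n < a" by eventually_elim (use c in auto)
next
  fix a assume "a < l' n"
  then obtain c where c: "a < c" "c < l' n" using dense by blast
  have "\<forall>\<^sub>F \<omega> in F. c \<le> l \<omega> n"
    by (rule eventually_penalised_eigenvalue_ge[OF I Q W lim t k E E0 n c(2)])
  then show "\<forall>\<^sub>F \<omega> in F. a < l \<omega> n" by eventually_elim (use c in auto)
qed

text \<open>Negation makes the penalty tend to plus infinity. Eigenvalues in equal position from the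
  top then correspond, and the total numbers \<open>Suc d\<close> and \<open>d\<close> account for
  the shift from \<open>n\<close> to \<open>Suc n\<close>.\<close>

lemma penalised_eigenvalue_tendsto_below:
  assumes I: "finite I" and Q: "\<And>\<omega>. hermitian_form (Q \<omega>)" "hermitian_form Q0"
    and W: "\<And>\<omega>. hermitian_form (W \<omega>)" "coercive I W0"
    and lim: "\<And>x y. ((\<lambda>\<omega>. Q \<omega> x y) \<longlongrightarrow> Q0 x y) F" "\<And>x y. ((\<lambda>\<omega>. W \<omega> x y) \<longlongrightarrow> W0 x y) F"
    and t: "filterlim t at_bot F"
    and k: "k \<in> I" "g k = 1"
    and E: "\<forall>\<^sub>F \<omega> in F. coercive I (W \<omega>) \<and> eigenbasis (supported I)
        (\<lambda>x y. Q \<omega> x y + complex_of_real (t \<omega>) * (cnj (lin_fun I g x) * lin_fun I g y)) (W \<omega>) (Suc d) (e \<omega>) (l \<omega>)"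
    and E0: "eigenbasis (hyperplane I g) Q0 W0 d e' l'"
    and n: "n < d"
  shows "((\<lambda>\<omega>. l \<omega> (Suc n)) \<longlongrightarrow> l' n) F"
proof -
  have "((\<lambda>\<omega>. - l \<omega> (Suc d - Suc (d - Suc n))) \<longlongrightarrow> - l' (d - Suc (d - Suc n))) F"
  proof (rule penalised_eigenvalue_tendsto[where Q = "\<lambda>\<omega> x y. - Q \<omega> x y" and W = W and g = g and k = k
        and l = "\<lambda>\<omega> i. - l \<omega> (Suc d - Suc i)" and e = "\<lambda>\<omega> i. e \<omega> (Suc d - Suc i)", OF I hf_minus[OF Q(1)] hf_minus[OF Q(2)] W tendsto_minus[OF lim(1)]
        lim(2) _ k _ eigenbasis_minus[OF E0]])
    show "filterlim (\<lambda>\<omega>. - t \<omega>) at_top F" using t by (simp add: filterlim_uminus_at_top)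
    show "\<forall>\<^sub>F \<omega> in F. coercive I (W \<omega>) \<and> eigenbasis (supported I)
        (\<lambda>x y. - Q \<omega> x y + complex_of_real (- t \<omega>) * (cnj (lin_fun I g x) * lin_fun I g y)) (W \<omega>) (Suc d)
        (\<lambda>i. e \<omega> (Suc d - Suc i)) (\<lambda>i. - l \<omega> (Suc d - Suc i))"
      using E
    proof eventually_elim
      case (elim \<omega>)
      then show ?case using eigenbasis_minus[OF elim[THEN conjunct2]] by simp
    qed
  qed (use n in auto)
  then have "((\<lambda>\<omega>. - l \<omega> (Suc n)) \<longlongrightarrow> - l' n) F" using n by (simp add: Suc_diff_Suc)
  then show ?thesis by (simp add: tendsto_minus_cancel_left)
qed

text \<open>The top eigenvalue bounds every quotient, and \<open>unit_vec k\<close> violates the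
  constraint: its quotient is \<open>(Q + t) / W\<close> with convergent \<open>Q\<close> and
  \<open>W\<close>.\<close>

lemma penalised_last_eigenvalue_at_top:
  assumes I: "finite I" and Q: "\<And>\<omega>. hermitian_form (Q \<omega>)"
    and W: "\<And>\<omega>. hermitian_form (W \<omega>)" "coercive I W0"
    and lim: "\<And>x y. ((\<lambda>\<omega>. Q \<omega> x y) \<longlongrightarrow> Q0 x y) F" "\<And>x y. ((\<lambda>\<omega>. W \<omega> x y) \<longlongrightarrow> W0 x y) F"
    and t: "filterlim t at_top F"
    and k: "k \<in> I" "g k = 1"
    and E: "\<forall>\<^sub>F \<omega> in F. coercive I (W \<omega>) \<and> eigenbasis (supported I)
        (\<lambda>x y. Q \<omega> x y + complex_of_real (t \<omega>) * (cnj (lin_fun I g x) * lin_fun I g y)) (W \<omega>) (Suc d) (e \<omega>) (l \<omega>)"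
  shows "filterlim (\<lambda>\<omega>. l \<omega> d) at_top F"
proof -
  let ?v = "unit_vec k"
  have v: "?v \<in> supported I" "?v \<noteq> 0"
    by (rule unit_vec_supported[OF k(1)]) (auto simp: unit_vec_def fun_eq_iff)
  have W0: "0 < Re (W0 ?v ?v)" by (rule coercive_pos[OF W(2) I v])
  have "filterlim (\<lambda>\<omega>. Re (Q \<omega> ?v ?v) + t \<omega>) at_top F"
    by (rule filterlim_tendsto_add_at_top[OF tendsto_Re[OF lim(1)] t])
  moreover have "((\<lambda>\<omega>. inverse (Re (W \<omega> ?v ?v))) \<longlongrightarrow> inverse (Re (W0 ?v ?v))) F"
    using W0 by (intro tendsto_inverse tendsto_Re lim) simp
  ultimately have "filterlim (\<lambda>\<omega>. inverse (Re (W \<omega> ?v ?v)) * (Re (Q \<omega> ?v ?v) + t \<omega>)) at_top F"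
    using filterlim_tendsto_pos_mult_at_top W0 by (metis (no_types) positive_imp_inverse_positive)
  then have "filterlim (\<lambda>\<omega>. (Re (Q \<omega> ?v ?v) + t \<omega>) / Re (W \<omega> ?v ?v)) at_top F"
    by (simp only: divide_inverse mult.commute)
  then show ?thesis
  proof (rule filterlim_at_top_mono)
    show "\<forall>\<^sub>F \<omega> in F. (Re (Q \<omega> ?v ?v) + t \<omega>) / Re (W \<omega> ?v ?v) \<le> l \<omega> d"
      using E
    proof eventually_elim
      case (elim \<omega>)
      have "Re (Q \<omega> ?v ?v + complex_of_real (t \<omega>) * (cnj (lin_fun I g ?v) * lin_fun I g ?v)) \<le> l \<omega> d * Re (W \<omega> ?v ?v)"
        by (rule eigenbasis_low[OF elim[THEN conjunct2] hf_add_mult[OF Q hf_rank_one] W(1)]) (use v in auto)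
      then show ?case
        using coercive_pos[OF elim[THEN conjunct1] I v] lin_fun_unit[OF I k(1), of g] k(2)
        by (simp add: pos_divide_le_eq)
    qed
  qed
qed

lemma penalised_first_eigenvalue_at_bot:
  assumes I: "finite I" and Q: "\<And>\<omega>. hermitian_form (Q \<omega>)"
    and W: "\<And>\<omega>. hermitian_form (W \<omega>)" "coercive I W0"
    and lim: "\<And>x y. ((\<lambda>\<omega>. Q \<omega> x y) \<longlongrightarrow> Q0 x y) F" "\<And>x y. ((\<lambda>\<omega>. W \<omega> x y) \<longlongrightarrow> W0 x y) F"
    and t: "filterlim t at_bot F"
    and k: "k \<in> I" "g k = 1"
    and E: "\<forall>\<^sub>F \<omega> in F. coercive I (W \<omega>) \<and> eigenbasis (supported I)
        (\<lambda>x y. Q \<omega> x y + complex_of_real (t \<omega>) * (cnj (lin_fun I g x) * lin_fun I g y)) (W \<omega>) (Suc d) (e \<omega>) (l \<omega>)"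
  shows "filterlim (\<lambda>\<omega>. l \<omega> 0) at_bot F"
proof -
  have "filterlim (\<lambda>\<omega>. - l \<omega> (Suc d - Suc d)) at_top F"
  proof (rule penalised_last_eigenvalue_at_top[where Q = "\<lambda>\<omega> x y. - Q \<omega> x y" and W = W and g = g and k = k
        and l = "\<lambda>\<omega> i. - l \<omega> (Suc d - Suc i)" and e = "\<lambda>\<omega> i. e \<omega> (Suc d - Suc i)", OF I hf_minus[OF Q] W tendsto_minus[OF lim(1)] lim(2) _ k])
    show "filterlim (\<lambda>\<omega>. - t \<omega>) at_top F" using t by (simp add: filterlim_uminus_at_top)
    show "\<forall>\<^sub>F \<omega> in F. coercive I (W \<omega>) \<and> eigenbasis (supported I)
        (\<lambda>x y. - Q \<omega> x y + complex_of_real (- t \<omega>) * (cnj (lin_fun I g x) * lin_fun I g y)) (W \<omega>) (Suc d)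
        (\<lambda>i. e \<omega> (Suc d - Suc i)) (\<lambda>i. - l \<omega> (Suc d - Suc i))"
      using E
    proof eventually_elim
      case (elim \<omega>)
      then show ?case using eigenbasis_minus[OF elim[THEN conjunct2]] by simp
    qed
  qed
  then show ?thesis by (simp add: filterlim_uminus_at_top)
qed

section \<open>The spectrum of a Sturm-Liouville problem\<close>

lemma sum_func_apply: "(\<Sum>x\<in>A. F x) k = (\<Sum>x\<in>A. F x k :: complex)"
  by (induction A rule: infinite_finite_induct) auto

lemma eigenbasis_cong:
  assumes "eigenbasis V Q W d e l" "\<And>i. i < d \<Longrightarrow> l' i = l i"
  shows "eigenbasis V Q W d e l'"
  unfolding eigenbasis_def
proof (intro conjI allI impI ballI)
  show "y = (\<lambda>k. \<Sum>i<d. W (e i) y * e i k)" if "y \<in> V" for y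
    by (rule eigenbasisD(4)[OF assms(1) that])
qed (simp_all add: eigenbasisD(1,2,3,5)[OF assms(1)] assms(2))

text \<open>Forgets the end values \<open>y 0\<close> and \<open>y (N + 1)\<close>, which the
  boundary condition and the equation determine.\<close>

definition trunc :: "nat \<Rightarrow> (nat \<Rightarrow> complex) \<Rightarrow> nat \<Rightarrow> complex" where
  "trunc N y = (\<lambda>i. if i \<in> {1..N} then y i else 0)"

lemma sum_replicate_mset: "finite A \<Longrightarrow> (\<Sum>x\<in>A. {#a#}) = replicate_mset (card A) a"
  by (induction A rule: finite_induct) auto

lemma mset_map_upt: "mset (map l [0..<d]) = (\<Sum>i<d. {#l i#})"
  by (induction d) auto

text \<open>\<open>trunc\<close> identifies \<open>ES\<close> with the weak eigenvectors of the
  pencil for \<open>z\<close>, and these are spanned by the \<open>e i\<close> whose value is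
  \<open>z\<close>. The vectors \<open>u i\<close> are their preimages.\<close>

lemma dim_from_eigenbasis:
  fixes ES :: "(nat \<Rightarrow> complex) set"
  assumes E: "eigenbasis V R W d e l" and R: "hermitian_form R" and W: "hermitian_form W"
    and sub: "cseq.subspace ES"
    and fwd: "\<And>y. y \<in> ES \<Longrightarrow> trunc N y \<in> V \<and> (\<forall>x\<in>V. R x (trunc N y) = z * W x (trunc N y))"
    and bwd: "\<And>v. v \<in> V \<Longrightarrow> \<forall>x\<in>V. R x v = z * W x v \<Longrightarrow> \<exists>y\<in>ES. trunc N y = v"
    and inj: "\<And>y. y \<in> ES \<Longrightarrow> trunc N y = 0 \<Longrightarrow> y = 0"
  shows "cseq.dim ES = card {i. i < d \<and> complex_of_real (l i) = z}"
proof -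
  let ?S = "{i. i < d \<and> complex_of_real (l i) = z}"
  have S: "finite ?S" "?S \<subseteq> {..<d}" by auto
  have "\<forall>i\<in>?S. \<exists>y. y \<in> ES \<and> trunc N y = e i"
  proof
    fix i assume i: "i \<in> ?S"
    then have "\<forall>x\<in>V. R x (e i) = z * W x (e i)" using eigenbasisD(3)[OF E] by auto
    then show "\<exists>y. y \<in> ES \<and> trunc N y = e i" using bwd[of "e i"] eigenbasisD(1)[OF E] i by auto
  qed
  from bchoice[OF this] obtain u
    where u: "\<And>i. i \<in> ?S \<Longrightarrow> u i \<in> ES" "\<And>i. i \<in> ?S \<Longrightarrow> trunc N (u i) = e i"
    by auto
  have inj_u: "inj_on u ?S"
  proof (rule inj_onI)
    fix i j assume ij: "i \<in> ?S" "j \<in> ?S" "u i = u j"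
    then have "e i = e j" using u(2) by metis
    then show "i = j" using eigenbasisD(2)[OF E, of i j] eigenbasisD(2)[OF E, of i i] ij
      by (auto split: if_splits)
  qed
  have trunc_comb: "trunc N (\<Sum>i\<in>?S. (\<lambda>n. c i * u i n)) = (\<lambda>n. \<Sum>i\<in>?S. c i * e i n)" for c
  proof
    fix n
    have "(\<Sum>i\<in>?S. c i * e i n) = (\<Sum>i\<in>?S. c i * trunc N (u i) n)"
      using u(2) by (intro sum.cong) auto
    then show "trunc N (\<Sum>i\<in>?S. (\<lambda>n. c i * u i n)) n = (\<Sum>i\<in>?S. c i * e i n)"
      unfolding trunc_def sum_func_apply by auto
  qed
  show ?thesis
  proof (rule cseq.dim_unique)
    show "u ` ?S \<subseteq> ES" using u(1) by blast
    show "card (u ` ?S) = card ?S" by (rule card_image[OF inj_u])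
    show "ES \<subseteq> cseq.span (u ` ?S)"
    proof
      fix y assume y: "y \<in> ES"
      define v where "v = trunc N y"
      have v: "v \<in> V" "\<And>x. x \<in> V \<Longrightarrow> R x v = z * W x v" using fwd[OF y] by (auto simp: v_def)
      \<comment> \<open>Evaluating \<open>R (e i) v\<close> once through \<open>v\<close> and once
        through \<open>e i\<close> leaves \<open>(z - l i) * W (e i) v = 0\<close>.\<close>
      have zero: "W (e i) v = 0" if "i < d" "i \<notin> ?S" for i
      proof -
        have "R (e i) v = cnj (R v (e i))" by (rule hf_cnj[OF R])
        also have "\<dots> = of_real (l i) * W (e i) v"
          using eigenbasisD(3)[OF E that(1) v(1)] hf_cnj[OF W, of "e i" v] by simp
        finally have "(z - of_real (l i)) * W (e i) v = 0"
          using v(2)[OF eigenbasisD(1)[OF E that(1)]] by (simp add: algebra_simps)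
        then show ?thesis using that by auto
      qed
      define y' where "y' = (\<Sum>i\<in>?S. (\<lambda>n. W (e i) v * u i n))"
      have y': "y' \<in> ES" unfolding y'_def
        using u(1) cseq.subspace_scale[OF sub] by (intro cseq.subspace_sum[OF sub]) auto
      have "trunc N y' = (\<lambda>n. \<Sum>i\<in>?S. W (e i) v * e i n)" unfolding y'_def by (rule trunc_comb)
      also have "\<dots> = (\<lambda>n. \<Sum>i<d. W (e i) v * e i n)"
        using zero by (intro ext sum.mono_neutral_left) auto
      also have "\<dots> = v" using eigenbasisD(4)[OF E v(1)] by simp
      finally have "trunc N y' = trunc N y" by (simp add: v_def)
      moreover have "trunc N (y - y') = trunc N y - trunc N y'" by (auto simp: trunc_def fun_eq_iff)
      ultimately have "trunc N (y - y') = 0" by simp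
      then have "y - y' = 0" by (rule inj[OF cseq.subspace_diff[OF sub y y']])
      moreover have "y' \<in> cseq.span (u ` ?S)" unfolding y'_def
        by (intro cseq.span_sum cseq.span_scale cseq.span_base) auto
      ultimately show "y \<in> cseq.span (u ` ?S)" by (simp only: right_minus_eq)
    qed
    show "cseq.independent (u ` ?S)"
    proof (rule cseq.independent_if_scalars_zero)
      fix f x assume eq: "(\<Sum>x\<in>u ` ?S. (\<lambda>n. f x * x n)) = 0" and "x \<in> u ` ?S"
      then obtain i where i: "i \<in> ?S" "x = u i" by auto
      have "(\<Sum>i\<in>?S. (\<lambda>n. f (u i) * u i n)) = 0" using eq by (simp add: sum.reindex[OF inj_u])
      then have "(\<lambda>n. \<Sum>i\<in>?S. f (u i) * e i n) = 0"
        unfolding trunc_comb[symmetric] by (simp add: trunc_def fun_eq_iff)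
      moreover have "W (e i) (\<lambda>n. \<Sum>i\<in>?S. f (u i) * e i n) = f (u i)"
        using eigenbasis_coord[OF E W S(2), of i "\<lambda>i. f (u i)"] i by simp
      ultimately show "f x = 0" using i hf_zero[OF W] by simp
    qed (use S in simp)
  qed
qed

text \<open>Multiplicity of \<open>z\<close> is the number of indices with \<open>l i = z\<close>,
  so the sorted list of eigenvalues is \<open>l\<close> itself. From here on \<open>nth_ev\<close>
  serves as the eigenvalue function of an eigenbasis.\<close>

lemma spectrum_from_eigenbasis:
  assumes E: "eigenbasis V R W d e l" and R: "hermitian_form R" and W: "hermitian_form W"
    and sub: "\<And>z. cseq.subspace (eigenspace N \<omega> \<A> z)"
    and fwd: "\<And>y z. y \<in> eigenspace N \<omega> \<A> z \<Longrightarrow> trunc N y \<in> V \<and> (\<forall>x\<in>V. R x (trunc N y) = z * W x (trunc N y))"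
    and bwd: "\<And>v z. v \<in> V \<Longrightarrow> \<forall>x\<in>V. R x v = z * W x v \<Longrightarrow> \<exists>y\<in>eigenspace N \<omega> \<A> z. trunc N y = v"
    and inj: "\<And>y z. y \<in> eigenspace N \<omega> \<A> z \<Longrightarrow> trunc N y = 0 \<Longrightarrow> y = 0"
  shows "eigenvalues N \<omega> \<A> \<subseteq> \<real>" "num_eigenvalues N \<omega> \<A> = d"
    "eigenbasis V R W d e (\<lambda>n. nth_ev N \<A> n \<omega>)"
proof -
  let ?S = "\<lambda>z. {i. i < d \<and> complex_of_real (l i) = z}"
  have mult: "multiplicity_at N \<omega> \<A> z = card (?S z)" for z
    unfolding multiplicity_at_def by (rule dim_from_eigenbasis[OF E R W sub fwd bwd inj])
  have ev: "eigenvalues N \<omega> \<A> = (\<lambda>i. complex_of_real (l i)) ` {..<d}"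
  proof (intro set_eqI iffI)
    fix z assume "z \<in> eigenvalues N \<omega> \<A>"
    then obtain y where y: "y \<in> eigenspace N \<omega> \<A> z" "y \<noteq> 0" by (auto simp: eigenvalues_def)
    have v: "trunc N y \<in> V" "\<And>x. x \<in> V \<Longrightarrow> R x (trunc N y) = z * W x (trunc N y)"
      using fwd[OF y(1)] by auto
    obtain i where i: "i < d" "W (e i) (trunc N y) \<noteq> 0"
      using orthogonal_to_eigenbasis[OF E v(1)] inj[OF y(1)] y(2) by blast
    have "R (e i) (trunc N y) = cnj (R (trunc N y) (e i))" by (rule hf_cnj[OF R])
    also have "\<dots> = of_real (l i) * W (e i) (trunc N y)"
      using eigenbasisD(3)[OF E i(1) v(1)] hf_cnj[OF W, of "e i" "trunc N y"] by simp
    finally have "z = of_real (l i)" using v(2)[OF eigenbasisD(1)[OF E i(1)]] i(2) by simp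
    then show "z \<in> (\<lambda>i. complex_of_real (l i)) ` {..<d}" using i by auto
  next
    fix z assume "z \<in> (\<lambda>i. complex_of_real (l i)) ` {..<d}"
    then obtain i where i: "i < d" "z = of_real (l i)" by auto
    obtain y where y: "y \<in> eigenspace N \<omega> \<A> z" "trunc N y = e i"
      using bwd[OF eigenbasisD(1)[OF E i(1)]] eigenbasisD(3)[OF E i(1)] i(2) by blast
    have "y \<noteq> 0"
    proof
      assume "y = 0"
      moreover have "trunc N 0 = 0" by (simp add: trunc_def fun_eq_iff)
      ultimately have "e i = 0" using y(2) by simp
      then show False using eigenbasisD(2)[OF E i(1) i(1)] hf_zero[OF W, of "e i"] by simp
    qed
    then show "z \<in> eigenvalues N \<omega> \<A>" using y by (auto simp: eigenvalues_def)
  qed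
  show "eigenvalues N \<omega> \<A> \<subseteq> \<real>" unfolding ev by auto
  \<comment> \<open>Grouping the indices by their eigenvalue; used with numbers for the count and
    with multisets for the list.\<close>
  have grp: "(\<Sum>z\<in>eigenvalues N \<omega> \<A>. \<Sum>i\<in>?S z. h i) = (\<Sum>i<d. h i)" for h :: "nat \<Rightarrow> 'z :: comm_monoid_add"
  proof -
    have "(\<Sum>z\<in>eigenvalues N \<omega> \<A>. \<Sum>i\<in>{i \<in> {..<d}. complex_of_real (l i) = z}. h i) = (\<Sum>i<d. h i)"
      by (rule sum.group) (auto simp: ev)
    then show ?thesis by simp
  qed
  show "num_eigenvalues N \<omega> \<A> = d"
    unfolding num_eigenvalues_def mult using grp[of "\<lambda>_. 1 :: nat"] by simp
  have "(\<Sum>z\<in>eigenvalues N \<omega> \<A>. replicate_mset (multiplicity_at N \<omega> \<A> z) (Re z))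
      = (\<Sum>z\<in>eigenvalues N \<omega> \<A>. \<Sum>i\<in>?S z. {#l i#})"
  proof (rule sum.cong)
    fix z
    have "(\<Sum>i\<in>?S z. {#l i#}) = (\<Sum>i\<in>?S z. {#Re z#})" by (rule sum.cong) auto
    then show "replicate_mset (multiplicity_at N \<omega> \<A> z) (Re z) = (\<Sum>i\<in>?S z. {#l i#})"
      by (simp add: sum_replicate_mset mult)
  qed simp
  also have "\<dots> = mset (map l [0..<d])" unfolding grp mset_map_upt ..
  finally have "eigenvalue_list N \<omega> \<A> = sort (map l [0..<d])"
    unfolding eigenvalue_list_def by (simp only: sorted_list_of_multiset_mset)
  also have "\<dots> = map l [0..<d]"
    by (rule sorted_sort_id) (auto simp: sorted_iff_nth_mono intro: eigenbasisD(5)[OF E])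
  finally have "nth_ev N \<A> i \<omega> = l i" if "i < d" for i using that by (simp add: nth_ev_def)
  then show "eigenbasis V R W d e (\<lambda>n. nth_ev N \<A> n \<omega>)" by (rule eigenbasis_cong[OF E])
qed

section \<open>Weak formulation of the Sturm-Liouville problem\<close>

definition weight_form :: "nat \<Rightarrow> equation \<Rightarrow> (nat \<Rightarrow> complex) \<Rightarrow> (nat \<Rightarrow> complex) \<Rightarrow> complex" where
  "weight_form N \<omega> x y = (\<Sum>n\<in>{1..N}. of_real (w_of \<omega> n) * (cnj (x n) * y n))"

definition energy_form :: "nat \<Rightarrow> real \<Rightarrow> equation \<Rightarrow> (nat \<Rightarrow> complex) \<Rightarrow> (nat \<Rightarrow> complex) \<Rightarrow> complex" where
  "energy_form N \<beta> \<omega> x y =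
     (\<Sum>n\<in>{1..<N}. of_real (f_of \<omega> n) * (cnj (fdiff x n) * fdiff y n)) +
     (\<Sum>n\<in>{1..N}. of_real (q_of \<omega> n) * (cnj (x n) * y n)) + of_real \<beta> * (cnj (x N) * y N)"

text \<open>These are the coefficients of \<open>y 1 + cnj \<zeta> * y N\<close> only when
  \<open>N \<ge> 2\<close> keeps the indices 1 and \<open>N\<close> apart.\<close>

definition bc_functional :: "nat \<Rightarrow> complex \<Rightarrow> nat \<Rightarrow> complex" where
  "bc_functional N \<zeta> i = (if i = 1 then 1 else if i = N then cnj \<zeta> else 0)"

lemma hf_weight_form: "hermitian_form (weight_form N \<omega>)"
  unfolding hermitian_form_def weight_form_def
  by (simp add: sum.distrib sum_distrib_left algebra_simps)

lemma hf_energy_form: "hermitian_form (energy_form N \<beta> \<omega>)"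
  unfolding hermitian_form_def energy_form_def
  by (simp add: sum.distrib sum_distrib_left sum_subtractf fdiff_def algebra_simps)

lemma coercive_weight_form:
  assumes "\<omega> \<in> Omega N" "N \<ge> 1"
  shows "coercive {1..N} (weight_form N \<omega>)"
  unfolding coercive_def
proof (intro conjI hf_weight_form)
  define m where "m = Min (w_of \<omega> ` {1..N})"
  have w: "w_of \<omega> n > 0" if "n \<in> {1..N}" for n
    using assms that by (auto simp: Omega_def w_of_def PiE_def Pi_def)
  have "m > 0" unfolding m_def using assms w by (subst Min_gr_iff) auto
  moreover have "m * sqnorm {1..N} y \<le> Re (weight_form N \<omega> y y)" for y
  proof -
    have "Re (weight_form N \<omega> y y) = (\<Sum>n\<in>{1..N}. w_of \<omega> n * (cmod (y n))\<^sup>2)"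
      unfolding weight_form_def Re_sum
      by (intro sum.cong refl) (simp add: cmod_power2, simp add: power2_eq_square)
    also have "\<dots> \<ge> (\<Sum>n\<in>{1..N}. m * (cmod (y n))\<^sup>2)"
      by (intro sum_mono mult_right_mono) (auto simp: m_def)
    finally show ?thesis by (simp add: sqnorm_def sum_distrib_left)
  qed
  ultimately show "\<exists>m>0. \<forall>y\<in>supported {1..N}. m * sqnorm {1..N} y \<le> Re (weight_form N \<omega> y y)" by blast
qed

lemma bc_functional_eq:
  assumes "N \<ge> 2"
  shows "lin_fun {1..N} (bc_functional N \<zeta>) y = y 1 + cnj \<zeta> * y N"
proof -
  have "lin_fun {1..N} (bc_functional N \<zeta>) y =
      (\<Sum>i\<in>{1..N}. (if i = 1 then y i else 0) + (if i = N then cnj \<zeta> * y i else 0))"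
    unfolding lin_fun_def bc_functional_def using assms by (intro sum.cong) auto
  also have "\<dots> = y 1 + cnj \<zeta> * y N" using assms by (simp add: sum.distrib)
  finally show ?thesis .
qed

lemma summation_by_parts:
  assumes "N \<ge> 1"
  shows "(\<Sum>n\<in>{1..N}. cnj (x n) * (p (n - 1) - p n)) =
    cnj (x 1) * p 0 - cnj (x N) * p N + (\<Sum>n\<in>{1..<N}. cnj (fdiff x n) * p n)"
  using assms
  by (induction N rule: nat_induct_at_least) (simp_all add: fdiff_def algebra_simps)

text \<open>The two terms in \<open>\<beta>\<close> cancel, so this is plain summation by parts.
  They are inserted so that the second boundary equation can replace the bracket at \<open>N\<close>
  by a multiple of the quasi-difference at 0.\<close>

lemma weak_form:
  assumes "N \<ge> 1"
  shows "(\<Sum>n\<in>{1..N}. cnj (x n) * (- bdiff (quasi_diff \<omega> y) n + of_real (q_of \<omega> n) * y n - z * of_real (w_of \<omega> n) * y n))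
    = energy_form N \<beta> \<omega> x y - z * weight_form N \<omega> x y
      + cnj (x 1) * quasi_diff \<omega> y 0 - cnj (x N) * (quasi_diff \<omega> y N + of_real \<beta> * y N)"
proof -
  let ?p = "quasi_diff \<omega> y"
  have "(\<Sum>n\<in>{1..N}. cnj (x n) * (- bdiff ?p n + of_real (q_of \<omega> n) * y n - z * of_real (w_of \<omega> n) * y n))
    = (\<Sum>n\<in>{1..N}. cnj (x n) * (?p (n - 1) - ?p n)) + (\<Sum>n\<in>{1..N}. of_real (q_of \<omega> n) * (cnj (x n) * y n))
      - z * weight_form N \<omega> x y"
    unfolding weight_form_def sum_distrib_left sum.distrib[symmetric] sum_subtractf[symmetric]
    by (intro sum.cong) (auto simp: bdiff_def algebra_simps)
  moreover have "(\<Sum>n\<in>{1..<N}. cnj (fdiff x n) * ?p n) =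
      (\<Sum>n\<in>{1..<N}. of_real (f_of \<omega> n) * (cnj (fdiff x n) * fdiff y n))"
    by (intro sum.cong) (auto simp: quasi_diff_def)
  ultimately show ?thesis
    unfolding summation_by_parts[OF assms, of x ?p] by (simp add: energy_form_def algebra_simps)
qed

lemma trunc_supported: "trunc N y \<in> supported {1..N}"
  by (auto simp: trunc_def supported_def)

lemma trunc_supported_id: "v \<in> supported {1..N} \<Longrightarrow> (\<And>i. i \<in> {1..N} \<Longrightarrow> y i = v i) \<Longrightarrow> trunc N y = v"
  by (auto simp: trunc_def supported_def fun_eq_iff)

lemma forms_cong:
  assumes "N \<ge> 1" "\<And>i. i \<in> {1..N} \<Longrightarrow> y i = y' i"
  shows "energy_form N \<beta> \<omega> x y = energy_form N \<beta> \<omega> x y'" "weight_form N \<omega> x y = weight_form N \<omega> x y'"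
    "lin_fun {1..N} g y = lin_fun {1..N} g y'"
  using assms unfolding energy_form_def weight_form_def lin_fun_def fdiff_def
  by (auto intro!: sum.cong arg_cong2[of _ _ _ _ "(+)"])

definition bc_normal :: "nat \<Rightarrow> equation \<Rightarrow> real \<Rightarrow> complex \<Rightarrow> real \<Rightarrow> (nat \<Rightarrow> complex) \<Rightarrow> bool" where
  "bc_normal N \<omega> \<eta> \<zeta> \<beta> y \<longleftrightarrow>
     y 0 + of_real \<eta> * quasi_diff \<omega> y 0 + cnj \<zeta> * y N = 0 \<and>
     \<zeta> * quasi_diff \<omega> y 0 + of_real \<beta> * y N + quasi_diff \<omega> y N = 0"

lemma quasi_diff_comb:
  "quasi_diff \<omega> (\<lambda>n. a * x n + b * y n) k = a * quasi_diff \<omega> x k + b * quasi_diff \<omega> y k"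
  by (simp add: quasi_diff_def fdiff_def algebra_simps)

lemma subspace_eigenspace:
  assumes bc: "\<And>y. satisfies_bc N \<omega> \<A> y \<longleftrightarrow> bc_normal N \<omega> \<eta> \<zeta> \<beta> y"
  shows "cseq.subspace (eigenspace N \<omega> \<A> z)"
proof -
  have comb: "(\<lambda>n. a * x n + b * y n) \<in> eigenspace N \<omega> \<A> z"
    if x: "x \<in> eigenspace N \<omega> \<A> z" and y: "y \<in> eigenspace N \<omega> \<A> z" for a b x y
    unfolding eigenspace_def mem_Collect_eq
  proof (intro conjI)
    show "\<forall>n>N + 1. a * x n + b * y n = 0" using x y by (simp add: eigenspace_def)
    show "satisfies_equation N \<omega> z (\<lambda>n. a * x n + b * y n)"
      unfolding satisfies_equation_def
    proof
      fix n assume n: "n \<in> {1..N}"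
      have "- bdiff (quasi_diff \<omega> y) n + of_real (q_of \<omega> n) * y n = z * of_real (w_of \<omega> n) * y n"
        "- bdiff (quasi_diff \<omega> x) n + of_real (q_of \<omega> n) * x n = z * of_real (w_of \<omega> n) * x n"
        using x y n by (auto simp: eigenspace_def satisfies_equation_def)
      then have "a * (- bdiff (quasi_diff \<omega> x) n + of_real (q_of \<omega> n) * x n) + b * (- bdiff (quasi_diff \<omega> y) n + of_real (q_of \<omega> n) * y n)
        = a * (z * of_real (w_of \<omega> n) * x n) + b * (z * of_real (w_of \<omega> n) * y n)" by simp
      then show "- bdiff (quasi_diff \<omega> (\<lambda>n. a * x n + b * y n)) n + of_real (q_of \<omega> n) * (a * x n + b * y n)
          = z * of_real (w_of \<omega> n) * (a * x n + b * y n)"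
        unfolding bdiff_def quasi_diff_comb by (simp add: algebra_simps)
    qed
    have "bc_normal N \<omega> \<eta> \<zeta> \<beta> x" "bc_normal N \<omega> \<eta> \<zeta> \<beta> y"
      using x y bc by (auto simp: eigenspace_def)
    then have "a * (x 0 + of_real \<eta> * quasi_diff \<omega> x 0 + cnj \<zeta> * x N) + b * (y 0 + of_real \<eta> * quasi_diff \<omega> y 0 + cnj \<zeta> * y N) = 0"
      "a * (\<zeta> * quasi_diff \<omega> x 0 + of_real \<beta> * x N + quasi_diff \<omega> x N)
       + b * (\<zeta> * quasi_diff \<omega> y 0 + of_real \<beta> * y N + quasi_diff \<omega> y N) = 0"
      unfolding bc_normal_def by simp_all
    then show "satisfies_bc N \<omega> \<A> (\<lambda>n. a * x n + b * y n)"
      unfolding bc bc_normal_def quasi_diff_comb by (simp_all add: algebra_simps)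
  qed
  have zero: "0 \<in> eigenspace N \<omega> \<A> z"
    by (simp add: eigenspace_def satisfies_equation_def bc bc_normal_def bdiff_def quasi_diff_def fdiff_def)
  show ?thesis
    unfolding cseq.subspace_def
  proof (intro conjI ballI allI zero)
    fix x y c assume x: "x \<in> eigenspace N \<omega> \<A> z"
    show "(\<lambda>n. c * x n) \<in> eigenspace N \<omega> \<A> z" using comb[OF x zero, of c 0] by simp
    assume y: "y \<in> eigenspace N \<omega> \<A> z"
    show "x + y \<in> eigenspace N \<omega> \<A> z" using comb[OF x y, of 1 1] by (simp add: plus_fun_def)
  qed
qed

lemma quasi_diff_0:
  assumes "\<omega> \<in> Omega N"
  shows "of_real (recip_f \<omega> 0) * quasi_diff \<omega> y 0 = y 1 - y 0"
proof -
  have "recip_f \<omega> 0 \<noteq> 0" using assms by (auto simp: Omega_def recip_f_def PiE_def Pi_def)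
  then show ?thesis by (simp add: quasi_diff_def f_of_def fdiff_def)
qed

text \<open>The quasi-difference \<open>p\<^sub>0\<close> is kept as an unknown, which makes the weak formulation uniform in
  \<open>1/f\<^sub>0\<close>.\<close>

lemma eigenspace_weak:
  assumes N: "N \<ge> 2" and \<omega>: "\<omega> \<in> Omega N"
    and bc: "\<And>y. satisfies_bc N \<omega> \<A> y \<longleftrightarrow> bc_normal N \<omega> \<eta> \<zeta> \<beta> y"
    and y: "y \<in> eigenspace N \<omega> \<A> z"
  defines "g \<equiv> lin_fun {1..N} (bc_functional N \<zeta>)"
  shows "energy_form N \<beta> \<omega> x y - z * weight_form N \<omega> x y + cnj (g x) * quasi_diff \<omega> y 0 = 0"
    and "g y = of_real (recip_f \<omega> 0 - \<eta>) * quasi_diff \<omega> y 0"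
proof -
  let ?p = "quasi_diff \<omega> y"
  have b1: "y 0 + of_real \<eta> * ?p 0 + cnj \<zeta> * y N = 0" and b2: "\<zeta> * ?p 0 + of_real \<beta> * y N + ?p N = 0"
    using y bc by (auto simp: eigenspace_def bc_normal_def)
  have gx: "g x = x 1 + cnj \<zeta> * x N" for x unfolding g_def by (rule bc_functional_eq[OF N])
  have "0 = (\<Sum>n\<in>{1..N}. cnj (x n) * (- bdiff ?p n + of_real (q_of \<omega> n) * y n - z * of_real (w_of \<omega> n) * y n))"
    using y by (intro sum.neutral[symmetric]) (auto simp: eigenspace_def satisfies_equation_def)
  also have "\<dots> = energy_form N \<beta> \<omega> x y - z * weight_form N \<omega> x y
      + cnj (x 1) * ?p 0 - cnj (x N) * (?p N + of_real \<beta> * y N)"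
    using N by (intro weak_form) auto
  also have "?p N + of_real \<beta> * y N = - \<zeta> * ?p 0" using b2 by (simp add: eq_neg_iff_add_eq_0 algebra_simps)
  finally show "energy_form N \<beta> \<omega> x y - z * weight_form N \<omega> x y + cnj (g x) * ?p 0 = 0"
    by (simp add: gx algebra_simps)
  have "g y = y 1 - y 0 - of_real \<eta> * ?p 0" using b1 by (simp add: gx add_eq_0_iff algebra_simps)
  moreover have "of_real (recip_f \<omega> 0 - \<eta>) * ?p 0 = y 1 - y 0 - of_real \<eta> * ?p 0"
    using quasi_diff_0[OF \<omega>, of y] by (simp add: left_diff_distrib)
  ultimately show "g y = of_real (recip_f \<omega> 0 - \<eta>) * ?p 0" by simp
qed

text \<open>Given the multiplier \<open>p\<close>, the end values can be chosen to realise the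
  prescribed quasi-differences. The condition on \<open>g v\<close> is then the first boundary
  equation, and testing with \<open>unit_vec m\<close> isolates the difference equation at
  \<open>m\<close>.\<close>

lemma eigenspace_of_weak:
  assumes N: "N \<ge> 2" and \<omega>: "\<omega> \<in> Omega N"
    and bc: "\<And>y. satisfies_bc N \<omega> \<A> y \<longleftrightarrow> bc_normal N \<omega> \<eta> \<zeta> \<beta> y"
    and v: "v \<in> supported {1..N}"
  defines "g \<equiv> lin_fun {1..N} (bc_functional N \<zeta>)"
  assumes weak: "\<And>x. x \<in> supported {1..N} \<Longrightarrow>
      energy_form N \<beta> \<omega> x v - z * weight_form N \<omega> x v + cnj (g x) * p = 0"
    and gv: "g v = of_real (recip_f \<omega> 0 - \<eta>) * p"
  shows "\<exists>y\<in>eigenspace N \<omega> \<A> z. trunc N y = v"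
proof -
  have gx: "g x = x 1 + cnj \<zeta> * x N" for x unfolding g_def by (rule bc_functional_eq[OF N])
  have r: "recip_f \<omega> 0 \<noteq> 0" "recip_f \<omega> N \<noteq> 0"
    using \<omega> by (auto simp: Omega_def recip_f_def PiE_def Pi_def)
  \<comment> \<open>The first entry makes the quasi-difference at 0 equal to \<open>p\<close>, the
    last one makes it satisfy the second boundary equation at \<open>N\<close>.\<close>
  define y where "y = (\<lambda>n. if n = 0 then v 1 - of_real (recip_f \<omega> 0) * p
     else if n = Suc N then v N + of_real (recip_f \<omega> N) * (- \<zeta> * p - of_real \<beta> * v N) else v n)"
  have yv: "y i = v i" if "i \<in> {1..N}" for i using that by (simp add: y_def)
  have y1: "y 1 = v 1" "y N = v N" using N by (simp_all add: yv)
  have tr: "trunc N y = v" using v yv by (rule trunc_supported_id)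
  have p0: "quasi_diff \<omega> y 0 = p"
  proof -
    have "quasi_diff \<omega> y 0 = of_real (f_of \<omega> 0) * (v 1 - y 0)"
      using y1(1) by (simp add: quasi_diff_def fdiff_def)
    then show ?thesis using r by (simp add: y_def f_of_def)
  qed
  have pN: "quasi_diff \<omega> y N = - \<zeta> * p - of_real \<beta> * v N"
  proof -
    have "quasi_diff \<omega> y N = of_real (f_of \<omega> N) * (y (Suc N) - v N)"
      using y1(2) by (simp add: quasi_diff_def fdiff_def)
    then show ?thesis using r by (simp add: y_def f_of_def)
  qed
  have "bc_normal N \<omega> \<eta> \<zeta> \<beta> y"
    unfolding bc_normal_def p0 pN y1
  proof
    have "y 0 + of_real \<eta> * p + cnj \<zeta> * v N = g v - of_real (recip_f \<omega> 0 - \<eta>) * p"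
      by (simp add: y_def gx algebra_simps)
    then show "y 0 + of_real \<eta> * p + cnj \<zeta> * v N = 0" using gv by simp
  qed (simp add: algebra_simps)
  moreover have "satisfies_equation N \<omega> z y"
    unfolding satisfies_equation_def
  proof
    fix m assume m: "m \<in> {1..N}"
    let ?res = "\<lambda>n. - bdiff (quasi_diff \<omega> y) n + of_real (q_of \<omega> n) * y n - z * of_real (w_of \<omega> n) * y n"
    have "?res m = (\<Sum>n\<in>{1..N}. if m = n then ?res n else 0)" using m by simp
    also have "\<dots> = (\<Sum>n\<in>{1..N}. cnj (unit_vec m n) * ?res n)"
      by (intro sum.cong) (auto simp: unit_vec_def)
    also have "\<dots> = energy_form N \<beta> \<omega> (unit_vec m) y - z * weight_form N \<omega> (unit_vec m) y
      + cnj (unit_vec m 1) * quasi_diff \<omega> y 0 - cnj (unit_vec m N) * (quasi_diff \<omega> y N + of_real \<beta> * y N)"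
      using N by (intro weak_form) auto
    also have "\<dots> = energy_form N \<beta> \<omega> (unit_vec m) v - z * weight_form N \<omega> (unit_vec m) v + cnj (g (unit_vec m)) * p"
      using N forms_cong[where N = N and y = y and y' = v, OF _ yv] by (simp add: p0 pN y1(2) gx algebra_simps)
    also have "\<dots> = 0" using m by (intro weak unit_vec_supported)
    finally show "- bdiff (quasi_diff \<omega> y) m + of_real (q_of \<omega> m) * y m = z * of_real (w_of \<omega> m) * y m" by simp
  qed
  moreover have "\<forall>n>N + 1. y n = 0" using v by (auto simp: y_def supported_def)
  ultimately have "y \<in> eigenspace N \<omega> \<A> z" using bc by (simp add: eigenspace_def)
  with tr show ?thesis by blast
qed

text \<open>If the interior values vanish, the weak equation tested with \<open>unit_vec 1\<close>
  leaves the quasi-difference at 0, which is therefore zero. The boundary condition then annihilates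
  both end values.\<close>

lemma eigenspace_trunc_inj:
  assumes N: "N \<ge> 2" and \<omega>: "\<omega> \<in> Omega N"
    and bc: "\<And>y. satisfies_bc N \<omega> \<A> y \<longleftrightarrow> bc_normal N \<omega> \<eta> \<zeta> \<beta> y"
    and y: "y \<in> eigenspace N \<omega> \<A> z" and "trunc N y = 0"
  shows "y = 0"
proof -
  let ?p = "quasi_diff \<omega> y"
  have y0: "y i = 0" if "i \<in> {1..N}" for i
    using fun_cong[OF \<open>trunc N y = 0\<close>, of i] that by (simp add: trunc_def)
  have one: "bc_functional N \<zeta> 1 = 1" "1 \<in> {1..N}" using N by (auto simp: bc_functional_def)
  have zero: "energy_form N \<beta> \<omega> x y = 0" "weight_form N \<omega> x y = 0" for x
    using forms_cong[where N = N and y = y and y' = 0] y0 N hf_zero[OF hf_energy_form] hf_zero[OF hf_weight_form] by auto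
  have p0: "?p 0 = 0"
    using eigenspace_weak(1)[OF N \<omega> bc y, of "unit_vec 1"] lin_fun_unit[OF _ one(2), of "bc_functional N \<zeta>"] one
    by (simp add: zero)
  have b: "y 0 + of_real \<eta> * ?p 0 + cnj \<zeta> * y N = 0" "\<zeta> * ?p 0 + of_real \<beta> * y N + ?p N = 0"
    using y bc by (auto simp: eigenspace_def bc_normal_def)
  have yN: "y N = 0" using y0 N by simp
  have "y 0 = 0" "?p N = 0" using b p0 yN by simp_all
  moreover have "recip_f \<omega> N \<noteq> 0"
    using \<omega> by (auto simp: Omega_def recip_f_def PiE_def Pi_def)
  ultimately have "y (Suc N) = 0" using yN by (simp add: quasi_diff_def fdiff_def f_of_def)
  moreover have "y n = 0" if "n > N + 1" for n using y that by (simp add: eigenspace_def)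
  ultimately show ?thesis using y0 \<open>y 0 = 0\<close>
    by (intro ext) (metis Suc_eq_plus1 Suc_leI atLeastAtMost_iff le_eq_less_or_eq not_less_eq_eq not_less_eq One_nat_def gr0I zero_fun_apply)
qed

text \<open>The constraint can be solved for the multiplier,
  \<open>p = g y / (1/f_0 - \<eta>)\<close>, and substituting this into the weak equation produces
  the rank-one penalty.\<close>

lemma spectrum_regular:
  assumes N: "N \<ge> 2" and \<omega>: "\<omega> \<in> Omega N" and r: "recip_f \<omega> 0 \<noteq> \<eta>"
    and bc: "\<And>y. satisfies_bc N \<omega> \<A> y \<longleftrightarrow> bc_normal N \<omega> \<eta> \<zeta> \<beta> y"
  defines "g \<equiv> lin_fun {1..N} (bc_functional N \<zeta>)"
  shows "eigenvalues N \<omega> \<A> \<subseteq> \<real>" "num_eigenvalues N \<omega> \<A> = N"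
    "\<exists>e. eigenbasis (supported {1..N})
       (\<lambda>x y. energy_form N \<beta> \<omega> x y + complex_of_real (1 / (recip_f \<omega> 0 - \<eta>)) * (cnj (g x) * g y))
       (weight_form N \<omega>) N e (\<lambda>n. nth_ev N \<A> n \<omega>)"
proof -
  let ?t = "1 / (recip_f \<omega> 0 - \<eta>)"
  let ?R = "\<lambda>x y. energy_form N \<beta> \<omega> x y + complex_of_real ?t * (cnj (g x) * g y)"
  have W: "coercive {1..N} (weight_form N \<omega>)" using coercive_weight_form[OF \<omega>] N by simp
  have R: "hermitian_form ?R" unfolding g_def by (rule hf_add_mult[OF hf_energy_form hf_rank_one])
  obtain d e l where E: "eigenbasis (supported {1..N}) ?R (weight_form N \<omega>) d e l"
    using eigenbasis_exists[OF finite_atLeastAtMost R W subsp_supported closed_supported order.refl] by blast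
  have d: "d = N" using eigenbasis_dim_supported[OF E _ hf_weight_form] by simp
  have N1: "N \<ge> 1" using N by simp
  have trunc_eq: "trunc N y i = y i" if "i \<in> {1..N}" for y i using that by (simp add: trunc_def)
  have rt: "of_real (recip_f \<omega> 0 - \<eta>) * (of_real ?t * u) = u" "of_real ?t * (of_real (recip_f \<omega> 0 - \<eta>) * u) = u" for u :: complex
    using r by (simp_all flip: of_real_mult mult.assoc)
  have fwd: "trunc N y \<in> supported {1..N} \<and>
      (\<forall>x\<in>supported {1..N}. ?R x (trunc N y) = z * weight_form N \<omega> x (trunc N y))"
    if y: "y \<in> eigenspace N \<omega> \<A> z" for y z
  proof (intro conjI ballI trunc_supported)
    fix x
    have "?R x y = energy_form N \<beta> \<omega> x y + cnj (g x) * (of_real ?t * g y)" by (simp add: algebra_simps)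
    also have "\<dots> = z * weight_form N \<omega> x y"
      using eigenspace_weak(1)[OF N \<omega> bc y, of x] eigenspace_weak(2)[OF N \<omega> bc y] unfolding g_def by (simp only: rt) (simp add: algebra_simps)
    finally show "?R x (trunc N y) = z * weight_form N \<omega> x (trunc N y)"
      unfolding g_def using forms_cong[where N = N and y = "trunc N y" and y' = y, OF N1 trunc_eq] by simp
  qed
  have bwd: "\<exists>y\<in>eigenspace N \<omega> \<A> z. trunc N y = v"
    if v: "v \<in> supported {1..N}" and w: "\<forall>x\<in>supported {1..N}. ?R x v = z * weight_form N \<omega> x v" for v z
  proof (rule eigenspace_of_weak[OF N \<omega> bc v])
    show "lin_fun {1..N} (bc_functional N \<zeta>) v = of_real (recip_f \<omega> 0 - \<eta>) * (of_real ?t * g v)"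
      unfolding rt g_def ..
    fix x assume "x \<in> supported {1..N}"
    with w have "?R x v = z * weight_form N \<omega> x v" by blast
    then show "energy_form N \<beta> \<omega> x v - z * weight_form N \<omega> x v
      + cnj (lin_fun {1..N} (bc_functional N \<zeta>) x) * (of_real ?t * g v) = 0"
      unfolding g_def by (simp add: algebra_simps)
  qed
  have inj: "y = 0" if "y \<in> eigenspace N \<omega> \<A> z" "trunc N y = 0" for y z
    by (rule eigenspace_trunc_inj[OF N \<omega> bc that])
  note spec = spectrum_from_eigenbasis[OF E[unfolded d] R hf_weight_form subspace_eigenspace[OF bc]]
  show "eigenvalues N \<omega> \<A> \<subseteq> \<real>" "num_eigenvalues N \<omega> \<A> = N"
    by (rule spec(1,2); (erule fwd | erule (1) bwd | erule (1) inj))+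
  have "eigenbasis (supported {1..N}) ?R (weight_form N \<omega>) N e (\<lambda>n. nth_ev N \<A> n \<omega>)"
    by (rule spec(3); (erule fwd | erule (1) bwd | erule (1) inj))
  then show "\<exists>e. eigenbasis (supported {1..N}) ?R (weight_form N \<omega>) N e (\<lambda>n. nth_ev N \<A> n \<omega>)" by (rule exI[of _ e])
qed

text \<open>Test vectors in the hyperplane do not see the multiplier. In the converse direction it
  has to be recovered from a test vector transverse to the hyperplane, for which
  \<open>unit_vec 1\<close> serves.\<close>

lemma spectrum_singular:
  assumes N: "N \<ge> 2" and \<omega>: "\<omega> \<in> Omega N" and r: "recip_f \<omega> 0 = \<eta>"
    and bc: "\<And>y. satisfies_bc N \<omega> \<A> y \<longleftrightarrow> bc_normal N \<omega> \<eta> \<zeta> \<beta> y"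
  shows "eigenvalues N \<omega> \<A> \<subseteq> \<real>" "num_eigenvalues N \<omega> \<A> = N - 1"
    "\<exists>e. eigenbasis (hyperplane {1..N} (bc_functional N \<zeta>)) (energy_form N \<beta> \<omega>)
       (weight_form N \<omega>) (N - 1) e (\<lambda>n. nth_ev N \<A> n \<omega>)"
proof -
  let ?g = "lin_fun {1..N} (bc_functional N \<zeta>)"
  let ?H = "hyperplane {1..N} (bc_functional N \<zeta>)"
  let ?B = "\<lambda>x y z. energy_form N \<beta> \<omega> x y - z * weight_form N \<omega> x y"
  have one: "bc_functional N \<zeta> 1 = 1" "bc_functional N \<zeta> 1 \<noteq> 0" "1 \<in> {1..N}"
    using N by (auto simp: bc_functional_def)
  have W: "coercive {1..N} (weight_form N \<omega>)" using coercive_weight_form[OF \<omega>] N by simp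
  obtain d e l where E: "eigenbasis ?H (energy_form N \<beta> \<omega>) (weight_form N \<omega>) d e l"
    using eigenbasis_exists[OF finite_atLeastAtMost hf_energy_form W subsp_hyperplane closed_hyperplane hyperplane_subset] by blast
  have d: "d = N - 1"
    using eigenbasis_dim_hyperplane[OF E _ hf_weight_form one(3,2)] by simp
  have N1: "N \<ge> 1" using N by simp
  have trunc_eq: "trunc N y i = y i" if "i \<in> {1..N}" for y i using that by (simp add: trunc_def)
  have fwd: "trunc N y \<in> ?H \<and> (\<forall>x\<in>?H. energy_form N \<beta> \<omega> x (trunc N y) = z * weight_form N \<omega> x (trunc N y))"
    if y: "y \<in> eigenspace N \<omega> \<A> z" for y z
  proof -
    have "?g y = 0" using eigenspace_weak(2)[OF N \<omega> bc y] r by simp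
    then have "trunc N y \<in> ?H"
      using trunc_supported forms_cong(3)[where N = N and y = "trunc N y" and y' = y, OF N1 trunc_eq] by (simp add: hyperplane_def)
    moreover have "?B x y z = 0" if "x \<in> ?H" for x
      using eigenspace_weak(1)[OF N \<omega> bc y, of x] that by (simp add: hyperplane_def)
    ultimately show ?thesis
      using forms_cong[where N = N and y = "trunc N y" and y' = y, OF N1 trunc_eq] by simp
  qed
  have bwd: "\<exists>y\<in>eigenspace N \<omega> \<A> z. trunc N y = v"
    if v: "v \<in> ?H" and w: "\<forall>x\<in>?H. energy_form N \<beta> \<omega> x v = z * weight_form N \<omega> x v" for v z
  proof (rule eigenspace_of_weak[OF N \<omega> bc])
    \<comment> \<open>The multiplier is the value forced by the test vector
      \<open>unit_vec 1\<close>; any other \<open>x\<close> differs from a multiple of it by a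
      vector \<open>u\<close> in the hyperplane.\<close>
    show "v \<in> supported {1..N}" "?g v = of_real (recip_f \<omega> 0 - \<eta>) * (- ?B (unit_vec 1) v z)"
      using v r by (simp_all add: hyperplane_def)
    fix x assume x: "x \<in> supported {1..N}"
    define u where "u = hyperplane_proj {1..N} (bc_functional N \<zeta>) 1 x"
    have "u \<in> ?H" unfolding u_def
      by (rule hyperplane_proj_mem[where g = "bc_functional N \<zeta>" and k = 1, OF _ one(3) one(1) x]) simp
    then have u: "energy_form N \<beta> \<omega> u v = z * weight_form N \<omega> u v" using w by blast
    have x_eq: "x = (\<lambda>i. 1 * u i + ?g x * unit_vec 1 i)" by (simp add: u_def hyperplane_proj_def)
    have F: "F x v = F u v + cnj (?g x) * F (unit_vec 1) v" if "hermitian_form F" for F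
      using hf_comb_left[OF that, of 1 u "?g x" "unit_vec 1" v] x_eq by simp
    show "?B x v z + cnj (?g x) * (- ?B (unit_vec 1) v z) = 0"
      unfolding F[OF hf_energy_form] F[OF hf_weight_form] u by (simp add: algebra_simps)
  qed
  have inj: "y = 0" if "y \<in> eigenspace N \<omega> \<A> z" "trunc N y = 0" for y z
    by (rule eigenspace_trunc_inj[OF N \<omega> bc that])
  note spec = spectrum_from_eigenbasis[OF E[unfolded d] hf_energy_form hf_weight_form subspace_eigenspace[OF bc]]
  show "eigenvalues N \<omega> \<A> \<subseteq> \<real>" "num_eigenvalues N \<omega> \<A> = N - 1"
    by (rule spec(1,2); (erule fwd | erule (1) bwd | erule (1) inj))+
  have "eigenbasis ?H (energy_form N \<beta> \<omega>) (weight_form N \<omega>) (N - 1) e (\<lambda>n. nth_ev N \<A> n \<omega>)"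
    by (rule spec(3); (erule fwd | erule (1) bwd | erule (1) inj))
  then show "\<exists>e. eigenbasis ?H (energy_form N \<beta> \<omega>) (weight_form N \<omega>) (N - 1) e (\<lambda>n. nth_ev N \<A> n \<omega>)" by (rule exI[of _ e])
qed

section \<open>Normal form of the boundary condition\<close>

lemma matrix_vector_pair_2:
  fixes A B :: "complex^2^2"
  shows "A *v vector [a, b] + B *v vector [c, d] = 0 \<longleftrightarrow>
    A$1$1 * a + A$1$2 * b + B$1$1 * c + B$1$2 * d = 0 \<and> A$2$1 * a + A$2$2 * b + B$2$1 * c + B$2$2 * d = 0"
  by (simp add: vec_eq_iff forall_2 matrix_vector_mult_def sum_2 add.assoc)

text \<open>Representatives differ by an invertible left factor, which can be cancelled to reach
  \<open>(A0, B0)\<close> and multiplied back for any other pair.\<close>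

lemma satisfies_bc_representative:
  assumes "\<A> \<in> bc_space" "(A, B) \<in> \<A>"
  shows "satisfies_bc N \<omega> \<A> y \<longleftrightarrow>
     A *v vector [y 0, quasi_diff \<omega> y 0] + B *v vector [y N, quasi_diff \<omega> y N] = 0"
proof
  let ?u = "vector [y 0, quasi_diff \<omega> y 0] :: complex^2"
  let ?v = "vector [y N, quasi_diff \<omega> y N] :: complex^2"
  assume 0: "A *v ?u + B *v ?v = 0"
  obtain A0 B0 where \<A>: "\<A> = left_GL_rel `` {(A0, B0)}"
    using assms(1) by (auto simp: bc_space_def quotient_def)
  obtain T where T: "invertible T" "A = T ** A0" "B = T ** B0"
    using assms(2) by (auto simp: \<A> left_GL_rel_def)
  obtain S where "S ** T = mat 1" using T(1) by (auto simp: invertible_def)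
  moreover have "T *v (A0 *v ?u + B0 *v ?v) = 0"
    using 0 by (simp add: T matrix_vector_mul_assoc matrix_vector_right_distrib)
  ultimately have 1: "A0 *v ?u + B0 *v ?v = 0"
    by (metis matrix_vector_mul_assoc matrix_vector_mul_lid matrix_vector_mult_0_right)
  have "A' *v ?u + B' *v ?v = 0" if "(A', B') \<in> \<A>" for A' B'
  proof -
    obtain T' where "A' = T' ** A0" "B' = T' ** B0" using \<open>(A', B') \<in> \<A>\<close> by (auto simp: \<A> left_GL_rel_def)
    then have "A' *v ?u + B' *v ?v = T' *v (A0 *v ?u + B0 *v ?v)"
      by (simp add: matrix_vector_mul_assoc matrix_vector_right_distrib)
    then show ?thesis by (simp add: 1)
  qed
  then show "satisfies_bc N \<omega> \<A> y" by (auto simp: satisfies_bc_def)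
qed (use assms(2) in \<open>auto simp: satisfies_bc_def\<close>)

text \<open>\<open>mu1 P\<close> is the minor of the columns of \<open>y 0\<close> and of the
  quasi-difference at \<open>N\<close>, so Cramer's rule solves for these two. Self-adjointness
  makes the mixed coefficients conjugate to each other (\<open>dAB\<close>) and
  \<open>\<beta>\<close> real (\<open>s_real\<close>).\<close>

lemma bc_normal_form:
  assumes \<A>: "\<A> \<in> bc_space" "P \<in> \<A>" and m: "mu1 P \<noteq> 0"
  shows "\<exists>\<zeta> \<beta>. \<forall>N \<omega> y. satisfies_bc N \<omega> \<A> y \<longleftrightarrow> bc_normal N \<omega> (eta P) \<zeta> \<beta> y"
proof -
  obtain A B where P: "P = (A, B)" by (cases P)
  have sa: "P \<in> selfadjoint_pairs"
    using \<A> by (auto simp: bc_space_def quotient_def left_GL_rel_def)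
  define a where "a i j = A $ i $ j" for i j
  define b where "b i j = B $ i $ j" for i j
  have eq: "A ** J_mat ** ctranspose A = B ** J_mat ** ctranspose B"
    using sa by (auto simp: P selfadjoint_pairs_def)
  have rel: "a i 1 * cnj (a j 2) - a i 2 * cnj (a j 1) = b i 1 * cnj (b j 2) - b i 2 * cnj (b j 1)" for i j
    using arg_cong[OF eq, of "\<lambda>M. M $ i $ j"]
    by (simp add: a_def b_def matrix_matrix_mult_def ctranspose_def J_mat_def sum_2 algebra_simps)
  define m1 where "m1 = mu1 P"
  define m2 where "m2 = mu2 P"
  have m1: "m1 = a 1 1 * b 2 2 - a 2 1 * b 1 2" and m2: "m2 = a 2 2 * b 1 2 - a 1 2 * b 2 2"
    by (auto simp: P mu1_def mu2_def a_def b_def m1_def m2_def)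
  have m0: "m1 \<noteq> 0" using m by (simp add: m1_def)
  \<comment> \<open>Together with \<open>m1\<close> and \<open>m2\<close> the minors in Cramer's
    rule: columns 1, 2 for \<open>dA\<close>, columns 3, 4 for \<open>dB\<close> and columns 1, 3
    for \<open>s\<close>.\<close>
  define dA where "dA = a 1 1 * a 2 2 - a 1 2 * a 2 1"
  define dB where "dB = b 1 1 * b 2 2 - b 1 2 * b 2 1"
  define s where "s = a 1 1 * b 2 1 - a 2 1 * b 1 1"
  \<comment> \<open>Pair the identity \<open>A J A\<^sup>* = B J B\<^sup>*\<close> with the rows \<open>(b\<^sub>2\<^sub>2, -b\<^sub>1\<^sub>2)\<close>, \<open>(-a\<^sub>2\<^sub>1, a\<^sub>1\<^sub>1)\<close>, which reduce
     the matrix of columns 1 and 4 of \<open>(A, B)\<close> to \<open>\<mu>\<^sub>1\<close> times the identity.\<close>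
  have dAB: "m1 * cnj dA = dB * cnj m1"
  proof -
    let ?L = "\<lambda>i j. a i 1 * cnj (a j 2) - a i 2 * cnj (a j 1)"
    let ?R = "\<lambda>i j. b i 1 * cnj (b j 2) - b i 2 * cnj (b j 1)"
    have "m1 * cnj dA = b 2 2 * cnj (- a 2 1) * ?L 1 1 + b 2 2 * cnj (a 1 1) * ?L 1 2
       + (- b 1 2) * cnj (- a 2 1) * ?L 2 1 + (- b 1 2) * cnj (a 1 1) * ?L 2 2"
      unfolding m1 dA_def by (simp add: algebra_simps)
    also have "\<dots> = b 2 2 * cnj (- a 2 1) * ?R 1 1 + b 2 2 * cnj (a 1 1) * ?R 1 2
       + (- b 1 2) * cnj (- a 2 1) * ?R 2 1 + (- b 1 2) * cnj (a 1 1) * ?R 2 2"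
      unfolding rel ..
    also have "\<dots> = dB * cnj m1"
      unfolding m1 dB_def by (simp add: algebra_simps)
    finally show ?thesis .
  qed
  \<comment> \<open>Here the row \<open>(- a 2 1, a 1 1)\<close> is paired with itself; on the side
    of \<open>A\<close> everything cancels.\<close>
  have s_real: "s * cnj m1 = m1 * cnj s"
  proof -
    let ?L = "\<lambda>i j. a i 1 * cnj (a j 2) - a i 2 * cnj (a j 1)"
    let ?R = "\<lambda>i j. b i 1 * cnj (b j 2) - b i 2 * cnj (b j 1)"
    have "0 = (- a 2 1) * cnj (- a 2 1) * ?L 1 1 + (- a 2 1) * cnj (a 1 1) * ?L 1 2
       + a 1 1 * cnj (- a 2 1) * ?L 2 1 + a 1 1 * cnj (a 1 1) * ?L 2 2"
      by (simp add: algebra_simps)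
    also have "\<dots> = (- a 2 1) * cnj (- a 2 1) * ?R 1 1 + (- a 2 1) * cnj (a 1 1) * ?R 1 2
       + a 1 1 * cnj (- a 2 1) * ?R 2 1 + a 1 1 * cnj (a 1 1) * ?R 2 2"
      unfolding rel ..
    also have "\<dots> = s * cnj m1 - m1 * cnj s"
      unfolding m1 s_def by (simp add: algebra_simps)
    finally show ?thesis by simp
  qed
  define \<zeta> where "\<zeta> = dA / m1"
  define \<beta> where "\<beta> = Re (s / m1)"
  have \<zeta>: "m1 * \<zeta> = dA" "m1 * cnj \<zeta> = dB"
    using m0 dAB by (simp_all add: \<zeta>_def field_simps)
  have "cnj (s / m1) = s / m1" using m0 s_real by (simp add: field_simps)
  then have "of_real \<beta> = s / m1" unfolding \<beta>_def by (metis Reals_cnj_iff of_real_Re)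
  then have \<beta>: "m1 * of_real \<beta> = s" using m0 by simp
  have \<eta>: "m1 * of_real (eta P) = - m2"
    using of_real_eta[OF sa] m0 by (simp add: m1_def[symmetric] m2_def[symmetric])
  have "satisfies_bc N \<omega> \<A> y \<longleftrightarrow> bc_normal N \<omega> (eta P) \<zeta> \<beta> y" for N \<omega> y
  proof -
    let ?p = "quasi_diff \<omega> y"
    let ?E1 = "a 1 1 * y 0 + a 1 2 * ?p 0 + b 1 1 * y N + b 1 2 * ?p N"
    let ?E2 = "a 2 1 * y 0 + a 2 2 * ?p 0 + b 2 1 * y N + b 2 2 * ?p N"
    let ?F1 = "y 0 + of_real (eta P) * ?p 0 + cnj \<zeta> * y N"
    let ?F2 = "\<zeta> * ?p 0 + of_real \<beta> * y N + ?p N"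
    have "m1 * ?F1 = m1 * y 0 + (m1 * of_real (eta P)) * ?p 0 + (m1 * cnj \<zeta>) * y N"
      by (simp add: algebra_simps)
    also have "\<dots> = m1 * y 0 - m2 * ?p 0 + dB * y N" unfolding \<eta> \<zeta> by simp
    also have "\<dots> = b 2 2 * ?E1 - b 1 2 * ?E2"
      unfolding m2 m1 dB_def by (simp add: algebra_simps)
    finally have F1: "m1 * ?F1 = b 2 2 * ?E1 - b 1 2 * ?E2" .
    have "m1 * ?F2 = (m1 * \<zeta>) * ?p 0 + (m1 * of_real \<beta>) * y N + m1 * ?p N"
      by (simp add: algebra_simps)
    also have "\<dots> = dA * ?p 0 + s * y N + m1 * ?p N" unfolding \<beta> \<zeta> ..
    also have "\<dots> = a 1 1 * ?E2 - a 2 1 * ?E1"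
      unfolding m1 dA_def s_def by (simp add: algebra_simps)
    finally have F2: "m1 * ?F2 = a 1 1 * ?E2 - a 2 1 * ?E1" .
    \<comment> \<open>The elimination is inverted, so that the normal form implies the original
      equations and not only conversely.\<close>
    have "m1 * ?E1 = a 1 1 * (b 2 2 * ?E1 - b 1 2 * ?E2) + b 1 2 * (a 1 1 * ?E2 - a 2 1 * ?E1)"
      "m1 * ?E2 = a 2 1 * (b 2 2 * ?E1 - b 1 2 * ?E2) + b 2 2 * (a 1 1 * ?E2 - a 2 1 * ?E1)"
      unfolding m1 by (simp_all add: algebra_simps)
    then have E: "m1 * ?E1 = a 1 1 * (m1 * ?F1) + b 1 2 * (m1 * ?F2)"
      "m1 * ?E2 = a 2 1 * (m1 * ?F1) + b 2 2 * (m1 * ?F2)"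
      unfolding F1 F2 by simp_all
    have "satisfies_bc N \<omega> \<A> y \<longleftrightarrow> ?E1 = 0 \<and> ?E2 = 0"
      unfolding satisfies_bc_representative[OF \<A>(1) \<A>(2)[unfolded P]] matrix_vector_pair_2 a_def b_def ..
    also have "\<dots> \<longleftrightarrow> ?F1 = 0 \<and> ?F2 = 0"
      using F1 F2 E m0 by (metis add_0 mult_eq_0_iff mult_zero_right diff_0_right)
    finally show ?thesis unfolding bc_normal_def .
  qed
  then show ?thesis by blast
qed

section \<open>Dependence on the equation\<close>

lemma continuous_coordinates:
  "continuous_on UNIV (\<lambda>\<omega> :: equation. recip_f \<omega> n)"
  "continuous_on UNIV (\<lambda>\<omega> :: equation. q_of \<omega> n)"
  "continuous_on UNIV (\<lambda>\<omega> :: equation. w_of \<omega> n)"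
  unfolding recip_f_def q_of_def w_of_def
  by (rule continuous_on_product_then_coordinatewise, intro continuous_intros)+

lemma tendsto_coordinates:
  fixes \<omega>0 :: equation
  shows "((\<lambda>\<omega>. recip_f \<omega> n) \<longlongrightarrow> recip_f \<omega>0 n) (at \<omega>0 within S)"
    "((\<lambda>\<omega>. q_of \<omega> n) \<longlongrightarrow> q_of \<omega>0 n) (at \<omega>0 within S)"
    "((\<lambda>\<omega>. w_of \<omega> n) \<longlongrightarrow> w_of \<omega>0 n) (at \<omega>0 within S)"
proof -
  have "(g \<longlongrightarrow> g \<omega>0) (at \<omega>0 within S)" if "continuous_on UNIV g" for g :: "equation \<Rightarrow> real"
    using that by (meson UNIV_I continuous_on_def subset_UNIV tendsto_within_subset)
  then show "((\<lambda>\<omega>. recip_f \<omega> n) \<longlongrightarrow> recip_f \<omega>0 n) (at \<omega>0 within S)"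
    "((\<lambda>\<omega>. q_of \<omega> n) \<longlongrightarrow> q_of \<omega>0 n) (at \<omega>0 within S)"
    "((\<lambda>\<omega>. w_of \<omega> n) \<longlongrightarrow> w_of \<omega>0 n) (at \<omega>0 within S)"
    using continuous_coordinates by blast+
qed

lemma Omega_recip_nonzero: "\<omega> \<in> Omega N \<Longrightarrow> n \<le> N \<Longrightarrow> recip_f \<omega> n \<noteq> 0"
  by (auto simp: Omega_def recip_f_def PiE_def Pi_def)

lemma forms_tendsto:
  assumes "\<omega>0 \<in> Omega N"
  shows "((\<lambda>\<omega>. energy_form N \<beta> \<omega> x y) \<longlongrightarrow> energy_form N \<beta> \<omega>0 x y) (at \<omega>0 within S)"
    "((\<lambda>\<omega>. weight_form N \<omega> x y) \<longlongrightarrow> weight_form N \<omega>0 x y) (at \<omega>0 within S)"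
  unfolding energy_form_def weight_form_def f_of_def
  by (intro tendsto_intros tendsto_coordinates; use Omega_recip_nonzero[OF assms] in simp)+

lemma Re_energy_form:
  "Re (energy_form N \<beta> \<omega> y y) = (\<Sum>n\<in>{1..<N}. f_of \<omega> n * (cmod (fdiff y n))\<^sup>2) +
     (\<Sum>n\<in>{1..N}. q_of \<omega> n * (cmod (y n))\<^sup>2) + \<beta> * (cmod (y N))\<^sup>2"
proof -
  have "Re (of_real a * (cnj u * u)) = a * (cmod u)\<^sup>2" for a and u :: complex
    by (simp add: cmod_power2, simp add: power2_eq_square)
  then show ?thesis unfolding energy_form_def plus_complex.sel Re_sum by presburger
qed

lemma Re_weight_form: "Re (weight_form N \<omega> y y) = (\<Sum>n\<in>{1..N}. w_of \<omega> n * (cmod (y n))\<^sup>2)"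
  unfolding weight_form_def Re_sum
  by (intro sum.cong refl) (simp add: cmod_power2, simp add: power2_eq_square)

text \<open>The values of a coordinate on \<open>C\<close> form an interval avoiding 0. A fixed sign
  is what makes \<open>f_j\<close> a decreasing function of \<open>1/f_j\<close>, hence the
  restriction to connected components in the monotonicity claims.\<close>

lemma connected_recip_sign:
  assumes "connected C" "C \<subseteq> Omega N" "\<omega> \<in> C" "\<omega>' \<in> C" "j \<le> N"
  shows "0 < recip_f \<omega> j \<longleftrightarrow> 0 < recip_f \<omega>' j"
proof -
  have "connected ((\<lambda>\<omega>. recip_f \<omega> j) ` C)"
    by (intro connected_continuous_image assms continuous_on_subset[OF continuous_coordinates(1)]) auto
  then have *: "{recip_f a j..recip_f b j} \<subseteq> (\<lambda>\<omega>. recip_f \<omega> j) ` C" if "a \<in> C" "b \<in> C" for a b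
    using that by (intro connected_contains_Icc) auto
  have "0 \<notin> (\<lambda>\<omega>. recip_f \<omega> j) ` C" using Omega_recip_nonzero assms by fastforce
  then have "\<not> (recip_f a j \<le> 0 \<and> 0 \<le> recip_f b j)" if "a \<in> C" "b \<in> C" for a b
    using *[OF that] by auto
  then show ?thesis using assms(3,4) by (meson less_eq_real_def not_le)
qed

lemma divide_one_antimono:
  fixes a b :: real
  assumes "a \<le> b" "0 < a \<or> b < 0"
  shows "1 / b \<le> 1 / a"
  using assms le_imp_inverse_le[of a b] le_imp_inverse_le_neg[of a b] by (auto simp: divide_inverse)

locale normalised_bc =
  fixes N :: nat and \<A> :: "bc_pair set" and \<eta> :: real and \<zeta> :: complex and \<beta> :: real
  assumes N: "N \<ge> 2"
    and bc: "\<And>\<omega> y. satisfies_bc N \<omega> \<A> y \<longleftrightarrow> bc_normal N \<omega> \<eta> \<zeta> \<beta> y"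
begin

abbreviation "bcf \<equiv> lin_fun {1..N} (bc_functional N \<zeta>)"

abbreviation "constraint \<equiv> hyperplane {1..N} (bc_functional N \<zeta>)"

abbreviation "form \<omega> x y \<equiv>
  energy_form N \<beta> \<omega> x y + complex_of_real (1 / (recip_f \<omega> 0 - \<eta>)) * (cnj (bcf x) * bcf y)"

text \<open>A choice of eigenvectors as a function of the equation, because the convergence lemmas
  speak about families \<open>e \<omega>\<close>. No continuity in \<open>\<omega>\<close> is
  claimed.\<close>

definition "basis_at \<omega> = (SOME e.
   (recip_f \<omega> 0 \<noteq> \<eta> \<longrightarrow> eigenbasis (supported {1..N}) (form \<omega>) (weight_form N \<omega>) N e (\<lambda>n. nth_ev N \<A> n \<omega>)) \<and>
   (recip_f \<omega> 0 = \<eta> \<longrightarrow> eigenbasis constraint (energy_form N \<beta> \<omega>) (weight_form N \<omega>) (N - 1) e (\<lambda>n. nth_ev N \<A> n \<omega>)))"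

lemma eigenbasis_basis_at:
  assumes "\<omega> \<in> Omega N"
  shows "recip_f \<omega> 0 \<noteq> \<eta> \<Longrightarrow>
      eigenbasis (supported {1..N}) (form \<omega>) (weight_form N \<omega>) N (basis_at \<omega>) (\<lambda>n. nth_ev N \<A> n \<omega>)"
    and "recip_f \<omega> 0 = \<eta> \<Longrightarrow>
      eigenbasis constraint (energy_form N \<beta> \<omega>) (weight_form N \<omega>) (N - 1) (basis_at \<omega>) (\<lambda>n. nth_ev N \<A> n \<omega>)"
proof -
  have "\<exists>e. (recip_f \<omega> 0 \<noteq> \<eta> \<longrightarrow> eigenbasis (supported {1..N}) (form \<omega>) (weight_form N \<omega>) N e (\<lambda>n. nth_ev N \<A> n \<omega>)) \<and>
   (recip_f \<omega> 0 = \<eta> \<longrightarrow> eigenbasis constraint (energy_form N \<beta> \<omega>) (weight_form N \<omega>) (N - 1) e (\<lambda>n. nth_ev N \<A> n \<omega>))"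
    using spectrum_regular(3)[OF N assms _ bc] spectrum_singular(3)[OF N assms _ bc]
    by (cases "recip_f \<omega> 0 = \<eta>") blast+
  from someI_ex[OF this, folded basis_at_def]
  show "recip_f \<omega> 0 \<noteq> \<eta> \<Longrightarrow>
      eigenbasis (supported {1..N}) (form \<omega>) (weight_form N \<omega>) N (basis_at \<omega>) (\<lambda>n. nth_ev N \<A> n \<omega>)"
    and "recip_f \<omega> 0 = \<eta> \<Longrightarrow>
      eigenbasis constraint (energy_form N \<beta> \<omega>) (weight_form N \<omega>) (N - 1) (basis_at \<omega>) (\<lambda>n. nth_ev N \<A> n \<omega>)"
    by blast+
qed

lemma coercive_weight: "\<omega> \<in> Omega N \<Longrightarrow> coercive {1..N} (weight_form N \<omega>)"
  using coercive_weight_form N by simp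

lemma one: "1 \<in> {1..N}" "bc_functional N \<zeta> 1 = 1"
  using N by (auto simp: bc_functional_def)

lemma hf_form: "hermitian_form (form \<omega>)"
  by (rule hf_add_mult[OF hf_energy_form hf_rank_one])

section \<open>Limits of the eigenvalues at regular and singular points\<close>

lemma eventually_regular:
  assumes "\<And>\<omega>. \<omega> \<in> S \<Longrightarrow> \<omega> \<in> Omega N \<and> recip_f \<omega> 0 \<noteq> \<eta>"
  shows "\<forall>\<^sub>F \<omega> in at \<omega>0 within S. coercive {1..N} (weight_form N \<omega>) \<and>
     eigenbasis (supported {1..N}) (form \<omega>) (weight_form N \<omega>) N (basis_at \<omega>) (\<lambda>n. nth_ev N \<A> n \<omega>)"
  unfolding eventually_at_filter
  by (rule always_eventually) (use assms eigenbasis_basis_at(1) coercive_weight in blast)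

lemma nth_ev_tendsto_regular:
  assumes \<omega>0: "\<omega>0 \<in> Omega N" "recip_f \<omega>0 0 \<noteq> \<eta>" and n: "n < N"
  shows "(nth_ev N \<A> n \<longlongrightarrow> nth_ev N \<A> n \<omega>0) (at \<omega>0 within {\<omega> \<in> Omega N. recip_f \<omega> 0 \<noteq> \<eta>})"
proof -
  let ?F = "at \<omega>0 within {\<omega> \<in> Omega N. recip_f \<omega> 0 \<noteq> \<eta>}"
  show ?thesis
  proof (rule eigenvalue_tendsto[where l = "\<lambda>\<omega> n. nth_ev N \<A> n \<omega>" and Q = form and W = "weight_form N",
        OF finite_atLeastAtMost hf_form hf_form hf_weight_form coercive_weight[OF \<omega>0(1)] _ forms_tendsto(2)[OF \<omega>0(1)]
        eventually_regular eigenbasis_basis_at(1)[OF \<omega>0] order.refl subsp_supported n])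
    show "((\<lambda>\<omega>. form \<omega> x y) \<longlongrightarrow> form \<omega>0 x y) ?F" for x y
      using \<omega>0(2) by (intro tendsto_intros forms_tendsto \<omega>0 tendsto_coordinates) auto
  qed auto
qed

lemma nth_ev_tendsto_singular:
  assumes \<omega>0: "\<omega>0 \<in> Omega N" "recip_f \<omega>0 0 = \<eta>" and n: "n < N - 1"
  shows "(nth_ev N \<A> n \<longlongrightarrow> nth_ev N \<A> n \<omega>0) (at \<omega>0 within {\<omega> \<in> Omega N. recip_f \<omega> 0 = \<eta>})"
proof -
  let ?F = "at \<omega>0 within {\<omega> \<in> Omega N. recip_f \<omega> 0 = \<eta>}"
  have E: "\<forall>\<^sub>F \<omega> in ?F. coercive {1..N} (weight_form N \<omega>) \<and>
     eigenbasis constraint (energy_form N \<beta> \<omega>) (weight_form N \<omega>) (N - 1) (basis_at \<omega>) (\<lambda>n. nth_ev N \<A> n \<omega>)"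
    unfolding eventually_at_filter
    by (rule always_eventually) (use eigenbasis_basis_at(2) coercive_weight in blast)
  show ?thesis
    by (rule eigenvalue_tendsto[where l = "\<lambda>\<omega> n. nth_ev N \<A> n \<omega>" and Q = "energy_form N \<beta>" and W = "weight_form N",
        OF finite_atLeastAtMost hf_energy_form hf_energy_form hf_weight_form coercive_weight[OF \<omega>0(1)]
        forms_tendsto[OF \<omega>0(1)] E eigenbasis_basis_at(2)[OF \<omega>0] hyperplane_subset subsp_hyperplane n])
qed

lemma penalty_at_top:
  assumes "recip_f \<omega>0 0 = \<eta>" "\<And>\<omega>. \<omega> \<in> S \<Longrightarrow> \<eta> < recip_f \<omega> 0"
  shows "filterlim (\<lambda>\<omega>. 1 / (recip_f \<omega> 0 - \<eta>)) at_top (at \<omega>0 within S)"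
proof -
  have "((\<lambda>\<omega>. recip_f \<omega> 0 - \<eta>) \<longlongrightarrow> recip_f \<omega>0 0 - \<eta>) (at \<omega>0 within S)"
    by (intro tendsto_intros tendsto_coordinates)
  moreover have "\<forall>\<^sub>F \<omega> in at \<omega>0 within S. 0 < recip_f \<omega> 0 - \<eta>"
    unfolding eventually_at_filter using assms(2) by (intro always_eventually) auto
  ultimately show ?thesis
    using filterlim_inverse_at_top[of "\<lambda>\<omega>. recip_f \<omega> 0 - \<eta>"] assms(1) by (simp add: divide_inverse)
qed

lemma penalty_at_bot:
  assumes "recip_f \<omega>0 0 = \<eta>" "\<And>\<omega>. \<omega> \<in> S \<Longrightarrow> recip_f \<omega> 0 < \<eta>"
  shows "filterlim (\<lambda>\<omega>. 1 / (recip_f \<omega> 0 - \<eta>)) at_bot (at \<omega>0 within S)"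
proof -
  have "((\<lambda>\<omega>. recip_f \<omega> 0 - \<eta>) \<longlongrightarrow> recip_f \<omega>0 0 - \<eta>) (at \<omega>0 within S)"
    by (intro tendsto_intros tendsto_coordinates)
  moreover have "\<forall>\<^sub>F \<omega> in at \<omega>0 within S. recip_f \<omega> 0 - \<eta> < 0"
    unfolding eventually_at_filter using assms(2) by (intro always_eventually) auto
  ultimately show ?thesis
    using filterlim_inverse_at_bot[of "\<lambda>\<omega>. recip_f \<omega> 0 - \<eta>"] assms(1) by (simp add: divide_inverse)
qed

lemma nth_ev_tendsto_from_above:
  assumes \<omega>0: "\<omega>0 \<in> Omega N" "recip_f \<omega>0 0 = \<eta>"
  defines "S \<equiv> {\<omega> \<in> Omega N. recip_f \<omega> 0 > \<eta>}"
  shows "n < N - 1 \<Longrightarrow> (nth_ev N \<A> n \<longlongrightarrow> nth_ev N \<A> n \<omega>0) (at \<omega>0 within S)"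
    and "filterlim (nth_ev N \<A> (N - 1)) at_top (at \<omega>0 within S)"
proof -
  let ?t = "\<lambda>\<omega>. 1 / (recip_f \<omega> 0 - \<eta>)"
  have E: "\<forall>\<^sub>F \<omega> in at \<omega>0 within S. coercive {1..N} (weight_form N \<omega>) \<and>
     eigenbasis (supported {1..N}) (form \<omega>) (weight_form N \<omega>) N (basis_at \<omega>) (\<lambda>n. nth_ev N \<A> n \<omega>)"
    by (rule eventually_regular) (auto simp: S_def)
  have t: "filterlim ?t at_top (at \<omega>0 within S)"
    by (rule penalty_at_top[OF \<omega>0(2)]) (auto simp: S_def)
  show "(nth_ev N \<A> n \<longlongrightarrow> nth_ev N \<A> n \<omega>0) (at \<omega>0 within S)" if n: "n < N - 1"
    by (rule penalised_eigenvalue_tendsto[where l = "\<lambda>\<omega> n. nth_ev N \<A> n \<omega>" and Q = "energy_form N \<beta>"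
        and W = "weight_form N" and t = ?t and k = 1 and g = "bc_functional N \<zeta>",
        OF finite_atLeastAtMost hf_energy_form hf_energy_form hf_weight_form coercive_weight[OF \<omega>0(1)]
        forms_tendsto[OF \<omega>0(1)] t one E eigenbasis_basis_at(2)[OF \<omega>0] _ n]) (use n in simp)
  have E': "\<forall>\<^sub>F \<omega> in at \<omega>0 within S. coercive {1..N} (weight_form N \<omega>) \<and>
     eigenbasis (supported {1..N}) (form \<omega>) (weight_form N \<omega>) (Suc (N - 1)) (basis_at \<omega>) (\<lambda>n. nth_ev N \<A> n \<omega>)"
    using E N by simp
  show "filterlim (nth_ev N \<A> (N - 1)) at_top (at \<omega>0 within S)"
    by (rule penalised_last_eigenvalue_at_top[where l = "\<lambda>\<omega> n. nth_ev N \<A> n \<omega>" and Q = "energy_form N \<beta>"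
        and W = "weight_form N" and t = ?t and k = 1 and g = "bc_functional N \<zeta>",
        OF finite_atLeastAtMost hf_energy_form hf_weight_form coercive_weight[OF \<omega>0(1)]
        forms_tendsto[OF \<omega>0(1)] t one E'])
qed

lemma nth_ev_tendsto_from_below:
  assumes \<omega>0: "\<omega>0 \<in> Omega N" "recip_f \<omega>0 0 = \<eta>"
  defines "S \<equiv> {\<omega> \<in> Omega N. recip_f \<omega> 0 < \<eta>}"
  shows "n < N - 1 \<Longrightarrow> (nth_ev N \<A> (Suc n) \<longlongrightarrow> nth_ev N \<A> n \<omega>0) (at \<omega>0 within S)"
    and "filterlim (nth_ev N \<A> 0) at_bot (at \<omega>0 within S)"
proof -
  let ?t = "\<lambda>\<omega>. 1 / (recip_f \<omega> 0 - \<eta>)"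
  have "\<forall>\<^sub>F \<omega> in at \<omega>0 within S. coercive {1..N} (weight_form N \<omega>) \<and>
     eigenbasis (supported {1..N}) (form \<omega>) (weight_form N \<omega>) N (basis_at \<omega>) (\<lambda>n. nth_ev N \<A> n \<omega>)"
    by (rule eventually_regular) (auto simp: S_def)
  then have E: "\<forall>\<^sub>F \<omega> in at \<omega>0 within S. coercive {1..N} (weight_form N \<omega>) \<and>
     eigenbasis (supported {1..N}) (form \<omega>) (weight_form N \<omega>) (Suc (N - 1)) (basis_at \<omega>) (\<lambda>n. nth_ev N \<A> n \<omega>)"
    using N by simp
  have t: "filterlim ?t at_bot (at \<omega>0 within S)"
    by (rule penalty_at_bot[OF \<omega>0(2)]) (auto simp: S_def)
  show "(nth_ev N \<A> (Suc n) \<longlongrightarrow> nth_ev N \<A> n \<omega>0) (at \<omega>0 within S)" if n: "n < N - 1"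
    by (rule penalised_eigenvalue_tendsto_below[where l = "\<lambda>\<omega> n. nth_ev N \<A> n \<omega>" and Q = "energy_form N \<beta>"
        and W = "weight_form N" and t = ?t and k = 1 and g = "bc_functional N \<zeta>",
        OF finite_atLeastAtMost hf_energy_form hf_energy_form hf_weight_form coercive_weight[OF \<omega>0(1)]
        forms_tendsto[OF \<omega>0(1)] t one E eigenbasis_basis_at(2)[OF \<omega>0] n])
  show "filterlim (nth_ev N \<A> 0) at_bot (at \<omega>0 within S)"
    by (rule penalised_first_eigenvalue_at_bot[where l = "\<lambda>\<omega> n. nth_ev N \<A> n \<omega>" and Q = "energy_form N \<beta>"
        and W = "weight_form N" and t = ?t and k = 1 and g = "bc_functional N \<zeta>",
        OF finite_atLeastAtMost hf_energy_form hf_weight_form coercive_weight[OF \<omega>0(1)]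
        forms_tendsto[OF \<omega>0(1)] t one E])
qed

section \<open>Monotonicity in the coefficients\<close>

lemma nth_ev_le:
  assumes "\<omega> \<in> Omega N" "recip_f \<omega> 0 \<noteq> \<eta>" "\<omega>' \<in> Omega N" "recip_f \<omega>' 0 \<noteq> \<eta>" and n: "n < N"
    and cmp: "\<And>y. Re (form \<omega>' y y) \<le> nth_ev N \<A> n \<omega>' * Re (weight_form N \<omega>' y y) \<Longrightarrow>
       Re (form \<omega> y y) \<le> c * Re (weight_form N \<omega> y y)"
  shows "nth_ev N \<A> n \<omega> \<le> c"
  by (rule eigenvalue_le[OF eigenbasis_basis_at(1)[OF assms(1,2)] hf_form coercive_weight[OF assms(1)]
        eigenbasis_basis_at(1)[OF assms(3,4)] hf_form hf_weight_form finite_atLeastAtMost order.refl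
        subsp_supported order.refl n n]) (rule cmp)

lemma Re_form:
  "Re (form \<omega> y y) = Re (energy_form N \<beta> \<omega> y y) + (cmod (bcf y))\<^sup>2 / (recip_f \<omega> 0 - \<eta>)"
proof -
  have "Re (of_real a * (cnj u * u)) = a * (cmod u)\<^sup>2" for a and u :: complex
    by (simp add: cmod_power2, simp add: power2_eq_square)
  then show ?thesis by (simp only: plus_complex.sel) simp
qed

text \<open>\<open>1/f_0\<close> acts only through the penalty coefficient and \<open>f_N\<close>
  does not enter the form, so \<open>f\<close> is compared on \<open>{1..<N}\<close> and the penalty
  separately. Applied in both directions this also gives independence of \<open>f_N\<close>.\<close>

lemma nth_ev_mono_form:
  assumes "\<omega> \<in> Omega N" "recip_f \<omega> 0 \<noteq> \<eta>" "\<omega>' \<in> Omega N" "recip_f \<omega>' 0 \<noteq> \<eta>" and n: "n < N"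
    and w: "w_of \<omega> = w_of \<omega>'" and q: "\<And>j. j \<in> {1..N} \<Longrightarrow> q_of \<omega> j \<le> q_of \<omega>' j"
    and f: "\<And>j. j \<in> {1..<N} \<Longrightarrow> f_of \<omega> j \<le> f_of \<omega>' j"
    and r: "1 / (recip_f \<omega> 0 - \<eta>) \<le> 1 / (recip_f \<omega>' 0 - \<eta>)"
  shows "nth_ev N \<A> n \<omega> \<le> nth_ev N \<A> n \<omega>'"
proof (rule nth_ev_le[OF assms(1-5)])
  fix y assume "Re (form \<omega>' y y) \<le> nth_ev N \<A> n \<omega>' * Re (weight_form N \<omega>' y y)"
  moreover have "Re (form \<omega> y y) \<le> Re (form \<omega>' y y)"
    unfolding Re_form Re_energy_form
    using mult_right_mono[OF r, of "(cmod (bcf y))\<^sup>2"]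
    by (intro add_mono sum_mono mult_right_mono q f) auto
  moreover have "weight_form N \<omega> = weight_form N \<omega>'" by (simp add: weight_form_def w fun_eq_iff)
  ultimately show "Re (form \<omega> y y) \<le> nth_ev N \<A> n \<omega>' * Re (weight_form N \<omega> y y)" by simp
qed

text \<open>Enlarging \<open>W\<close> weakens the bound \<open>Q \<le> c * W\<close> for
  \<open>c \<ge> 0\<close> and strengthens it for \<open>c < 0\<close>. This change of direction is
  why positive and negative parts behave oppositely.\<close>

lemma nth_ev_weight_mono:
  assumes "\<omega> \<in> Omega N" "recip_f \<omega> 0 \<noteq> \<eta>" "\<omega>' \<in> Omega N" "recip_f \<omega>' 0 \<noteq> \<eta>" and n: "n < N"
    and eq: "recip_f \<omega> = recip_f \<omega>'" "q_of \<omega> = q_of \<omega>'"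
    and w: "\<And>j. j \<in> {1..N} \<Longrightarrow> w_of \<omega> j \<le> w_of \<omega>' j"
  shows "max (nth_ev N \<A> n \<omega>') 0 \<le> max (nth_ev N \<A> n \<omega>) 0"
    and "min (nth_ev N \<A> n \<omega>) 0 \<le> min (nth_ev N \<A> n \<omega>') 0"
proof -
  have "f_of \<omega> = f_of \<omega>'" by (simp add: f_of_def eq fun_eq_iff)
  then have form: "Re (form \<omega> y y) = Re (form \<omega>' y y)" for y
    unfolding Re_form Re_energy_form by (simp add: eq)
  have Wle: "Re (weight_form N \<omega> y y) \<le> Re (weight_form N \<omega>' y y)" for y
    unfolding Re_weight_form by (intro sum_mono mult_right_mono w) auto
  have W0: "0 \<le> Re (weight_form N \<omega> y y)" for y
    unfolding Re_weight_form using assms(1)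
    by (intro sum_nonneg mult_nonneg_nonneg) (auto simp: Omega_def w_of_def PiE_def Pi_def less_imp_le)
  \<comment> \<open>Replacing the eigenvalue by its positive part makes the factor nonnegative, so
    the weight may be enlarged.\<close>
  have "nth_ev N \<A> n \<omega>' \<le> max (nth_ev N \<A> n \<omega>) 0"
  proof (rule nth_ev_le[OF assms(3,4,1,2) n])
    fix y assume "Re (form \<omega> y y) \<le> nth_ev N \<A> n \<omega> * Re (weight_form N \<omega> y y)"
    also have "\<dots> \<le> max (nth_ev N \<A> n \<omega>) 0 * Re (weight_form N \<omega> y y)"
      using W0 by (intro mult_right_mono) auto
    also have "\<dots> \<le> max (nth_ev N \<A> n \<omega>) 0 * Re (weight_form N \<omega>' y y)"
      using Wle by (intro mult_left_mono) auto
    finally show "Re (form \<omega>' y y) \<le> max (nth_ev N \<A> n \<omega>) 0 * Re (weight_form N \<omega>' y y)"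
      unfolding form .
  qed
  then show "max (nth_ev N \<A> n \<omega>') 0 \<le> max (nth_ev N \<A> n \<omega>) 0" by simp
  have "nth_ev N \<A> n \<omega> \<le> nth_ev N \<A> n \<omega>'" if neg: "nth_ev N \<A> n \<omega>' < 0"
  proof (rule nth_ev_le[OF assms(1-5)])
    fix y assume "Re (form \<omega>' y y) \<le> nth_ev N \<A> n \<omega>' * Re (weight_form N \<omega>' y y)"
    also have "\<dots> \<le> nth_ev N \<A> n \<omega>' * Re (weight_form N \<omega> y y)"
      using neg Wle by (intro mult_left_mono_neg) auto
    finally show "Re (form \<omega> y y) \<le> nth_ev N \<A> n \<omega>' * Re (weight_form N \<omega> y y)"
      unfolding form .
  qed
  then show "min (nth_ev N \<A> n \<omega>) 0 \<le> min (nth_ev N \<A> n \<omega>') 0"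
    by (cases "nth_ev N \<A> n \<omega>' < 0") auto
qed

end

text \<open>Approach along the curve that lowers \<open>1/f_0\<close> from \<open>\<eta>\<close> to
  \<open>\<eta> - s\<close>. Without nearby points of this set, limits within it would not be
  unique.\<close>

lemma singular_point_not_isolated:
  assumes \<omega>0: "\<omega>0 \<in> Omega N" "recip_f \<omega>0 0 = \<eta>" and \<eta>: "\<eta> \<noteq> 0"
  shows "at \<omega>0 within {\<omega> \<in> Omega N. recip_f \<omega> 0 < \<eta>} \<noteq> bot"
proof
  let ?S = "{\<omega> \<in> Omega N. recip_f \<omega> 0 < \<eta>}"
  assume bot: "at \<omega>0 within ?S = bot"
  obtain r q w where rqw: "\<omega>0 = (r, q, w)" by (cases \<omega>0)
  define \<phi> :: "real \<Rightarrow> equation" where "\<phi> s = (r(0 := \<eta> - s), q, w)" for s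
  have \<phi>0: "\<phi> 0 = \<omega>0" using \<omega>0(2) by (auto simp: \<phi>_def rqw recip_f_def)
  have "continuous_on UNIV \<phi>"
    unfolding \<phi>_def
  proof (intro continuous_on_Pair continuous_on_const continuous_on_coordinatewise_then_product)
    show "continuous_on UNIV (\<lambda>s. (r(0 := \<eta> - s)) i)" for i
      by (cases "i = 0") (auto intro!: continuous_intros)
  qed
  then have lim: "(\<phi> \<longlongrightarrow> \<omega>0) (at_right 0)"
    using \<phi>0 by (metis UNIV_I continuous_on_def tendsto_within_subset subset_UNIV)
  \<comment> \<open>The bound by \<open>\<bar>\<eta>\<bar>\<close> keeps \<open>\<eta> - s\<close>
    nonzero, as membership in \<open>Omega N\<close> demands.\<close>
  have "\<forall>\<^sub>F s in at_right 0. 0 < s \<and> s < \<bar>\<eta>\<bar>"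
    using \<eta> eventually_at_right_real[of 0 "\<bar>\<eta>\<bar>"] by (auto elim: eventually_mono)
  then have "\<forall>\<^sub>F s in at_right 0. \<phi> s \<in> ?S \<and> \<phi> s \<noteq> \<omega>0"
  proof eventually_elim
    case (elim s)
    then have "\<eta> - s \<noteq> 0" by auto
    then have "\<phi> s \<in> ?S" using \<omega>0(1) elim
      by (auto simp: \<phi>_def rqw Omega_def recip_f_def PiE_iff extensional_def)
    moreover have "recip_f (\<phi> s) 0 \<noteq> recip_f \<omega>0 0" using elim \<omega>0(2) by (simp add: \<phi>_def recip_f_def)
    ultimately show ?case by auto
  qed
  with lim have "filterlim \<phi> (at \<omega>0 within ?S) (at_right 0)" by (simp add: filterlim_at)
  then have "at_right (0 :: real) = bot"
    unfolding bot by (simp add: filterlim_def bot_unique filtermap_bot_iff)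
  then show False by simp
qed

theorem theorem3p1:
  fixes N :: nat and \<A> :: "bc_pair set" and P :: bc_pair
  assumes "N \<ge> 2"
    and "\<A> \<in> bc_space" and "P \<in> \<A>"
    and "mu1 P \<noteq> 0" and "mu2 P \<noteq> 0"
  shows
    "(\<forall>\<omega>\<in>Omega N. eigenvalues N \<omega> \<A> \<subseteq> \<real>)
   \<and> (\<forall>\<omega>\<in>E_sing N P. num_eigenvalues N \<omega> \<A> = N - 1)
   \<and> (\<forall>\<omega>\<in>Omega N - E_sing N P. num_eigenvalues N \<omega> \<A> = N)

   \<and> (\<forall>n\<le>N - 1. continuous_on (Omega N - E_sing N P) (nth_ev N \<A> n))

   \<and> (\<forall>n\<le>N - 1. \<forall>C\<in>components (E_plus N P) \<union> components (E_minus N P).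
        \<forall>r q w x. (r, q, w) \<in> C \<longrightarrow>
          (\<forall>j\<in>{0..N}. (r(j := x), q, w) \<in> C \<and> r j \<le> x \<longrightarrow>
             nth_ev N \<A> n (r(j := x), q, w) \<le> nth_ev N \<A> n (r, q, w))
        \<and> ((r(N := x), q, w) \<in> C \<longrightarrow> nth_ev N \<A> n (r(N := x), q, w) = nth_ev N \<A> n (r, q, w))
        \<and> (\<forall>j\<in>{1..N}. (r, q(j := x), w) \<in> C \<and> q j \<le> x \<longrightarrow>
             nth_ev N \<A> n (r, q, w) \<le> nth_ev N \<A> n (r, q(j := x), w))
        \<and> (\<forall>j\<in>{1..N}. (r, q, w(j := x)) \<in> C \<and> w j \<le> x \<longrightarrow>
             max (nth_ev N \<A> n (r, q, w(j := x))) 0 \<le> max (nth_ev N \<A> n (r, q, w)) 0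
           \<and> min (nth_ev N \<A> n (r, q, w)) 0 \<le> min (nth_ev N \<A> n (r, q, w(j := x))) 0))

   \<and> (\<forall>\<omega>\<^sub>0\<in>E_sing N P.
        (\<forall>n\<le>N - 1. \<not> (1 \<le> n \<and> n \<le> N - 2 \<and> nth_ev N \<A> (n - 1) \<omega>\<^sub>0 = nth_ev N \<A> n \<omega>\<^sub>0) \<longrightarrow>
           \<not> nth_ev_continuous_at N \<A> n \<omega>\<^sub>0)
      \<and> filterlim (nth_ev N \<A> 0) at_bot (at \<omega>\<^sub>0 within E_minus N P)
      \<and> (\<forall>n\<in>{1..N - 1}. (nth_ev N \<A> n \<longlongrightarrow> nth_ev N \<A> (n - 1) \<omega>\<^sub>0) (at \<omega>\<^sub>0 within E_minus N P))
      \<and> (\<forall>n\<le>N - 2. (nth_ev N \<A> n \<longlongrightarrow> nth_ev N \<A> n \<omega>\<^sub>0) (at \<omega>\<^sub>0 within E_plus N P \<union> E_sing N P))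
      \<and> filterlim (nth_ev N \<A> (N - 1)) at_top (at \<omega>\<^sub>0 within E_plus N P))

   \<and> (\<forall>n\<le>N - 2. continuous_on (E_plus N P \<union> E_sing N P) (nth_ev N \<A> n))"
proof -
  obtain \<zeta> \<beta> where nf: "\<And>N \<omega> y. satisfies_bc N \<omega> \<A> y \<longleftrightarrow> bc_normal N \<omega> (eta P) \<zeta> \<beta> y"
    using bc_normal_form[OF assms(2-4)] by blast
  define \<eta> where "\<eta> = eta P"
  interpret normalised_bc N \<A> \<eta> \<zeta> \<beta>
    by unfold_locales (use assms(1) nf in \<open>auto simp: \<eta>_def\<close>)
  have "P \<in> selfadjoint_pairs"
    using assms(2,3) by (auto simp: bc_space_def quotient_def left_GL_rel_def)
  \<comment> \<open>The assumption on \<open>mu2 P\<close> enters here.\<close>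
  then have \<eta>0: "\<eta> \<noteq> 0" using of_real_eta[of P] assms(4,5) by (auto simp: \<eta>_def)
  have reg_eq: "Omega N - E_sing N P = {\<omega> \<in> Omega N. recip_f \<omega> 0 \<noteq> \<eta>}"
    and sing_eq: "E_sing N P = {\<omega> \<in> Omega N. recip_f \<omega> 0 = \<eta>}"
    and plus_eq: "E_plus N P = {\<omega> \<in> Omega N. recip_f \<omega> 0 > \<eta>}"
    and minus_eq: "E_minus N P = {\<omega> \<in> Omega N. recip_f \<omega> 0 < \<eta>}"
    by (auto simp: E_sing_def E_plus_def E_minus_def \<eta>_def)
  have le_less: "n \<le> N - 1 \<longleftrightarrow> n < N" "n \<le> N - 2 \<longleftrightarrow> n < N - 1" for n using N by auto

  have real: "\<forall>\<omega>\<in>Omega N. eigenvalues N \<omega> \<A> \<subseteq> \<real>"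
    using spectrum_regular(1)[OF N _ _ bc] spectrum_singular(1)[OF N _ _ bc] by blast
  have num_sing: "\<forall>\<omega>\<in>E_sing N P. num_eigenvalues N \<omega> \<A> = N - 1"
    using spectrum_singular(2)[OF N _ _ bc] by (auto simp: sing_eq)
  have num_reg: "\<forall>\<omega>\<in>Omega N - E_sing N P. num_eigenvalues N \<omega> \<A> = N"
    using spectrum_regular(2)[OF N _ _ bc] by (auto simp: reg_eq)
  have cont_reg: "\<forall>n\<le>N - 1. continuous_on (Omega N - E_sing N P) (nth_ev N \<A> n)"
    unfolding reg_eq continuous_on_def le_less using nth_ev_tendsto_regular by auto

  have below: "(nth_ev N \<A> n \<longlongrightarrow> nth_ev N \<A> (n - 1) \<omega>) (at \<omega> within E_minus N P)"
    if "\<omega> \<in> E_sing N P" "n \<in> {1..N - 1}" for \<omega> n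
    using nth_ev_tendsto_from_below(1)[of \<omega> "n - 1"] that by (auto simp: sing_eq minus_eq)
  have first: "filterlim (nth_ev N \<A> 0) at_bot (at \<omega> within E_minus N P)" if "\<omega> \<in> E_sing N P" for \<omega>
    using nth_ev_tendsto_from_below(2)[of \<omega>] that by (auto simp: sing_eq minus_eq)
  have above: "(nth_ev N \<A> n \<longlongrightarrow> nth_ev N \<A> n \<omega>) (at \<omega> within E_plus N P \<union> E_sing N P)"
    if "\<omega> \<in> E_sing N P" "n \<le> N - 2" for \<omega> n
    \<comment> \<open>The filter within the union is the supremum of the two separate ones: the
      penalty limit handles \<open>E_plus N P\<close>, continuity of the constrained pencil handles
      \<open>E_sing N P\<close>.\<close>
    unfolding at_within_union
    by (rule filterlim_sup)
      (use nth_ev_tendsto_from_above(1)[of \<omega> n] nth_ev_tendsto_singular[of \<omega> n] that in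
        \<open>auto simp: sing_eq plus_eq le_less\<close>)
  have last: "filterlim (nth_ev N \<A> (N - 1)) at_top (at \<omega> within E_plus N P)" if "\<omega> \<in> E_sing N P" for \<omega>
    using nth_ev_tendsto_from_above(2)[of \<omega>] that by (auto simp: sing_eq plus_eq)
  \<comment> \<open>For \<open>n = N - 1\<close> the eigenvalue is undefined at the point, and for
    \<open>n = 0\<close> it diverges from below. Otherwise continuity would identify the limit
    \<open>nth_ev N \<A> (n - 1) \<omega>\<close> from below with the value at the point, which
    \<open>neq\<close> excludes.\<close>
  have discont: "\<not> nth_ev_continuous_at N \<A> n \<omega>"
    if \<omega>: "\<omega> \<in> E_sing N P" and n: "n \<le> N - 1"
      and neq: "\<not> (1 \<le> n \<and> n \<le> N - 2 \<and> nth_ev N \<A> (n - 1) \<omega> = nth_ev N \<A> n \<omega>)" for \<omega> n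
  proof
    assume cont: "nth_ev_continuous_at N \<A> n \<omega>"
    then have n1: "n < N - 1" using num_sing \<omega> by (simp add: nth_ev_continuous_at_def)
    have "E_minus N P \<subseteq> {\<omega>'\<in>Omega N. n < num_eigenvalues N \<omega>' \<A>}"
      using num_reg n1 by (auto simp: minus_eq reg_eq)
    then have lim: "(nth_ev N \<A> n \<longlongrightarrow> nth_ev N \<A> n \<omega>) (at \<omega> within E_minus N P)"
      using cont by (auto simp: nth_ev_continuous_at_def continuous_within intro: tendsto_within_subset)
    have nontriv: "at \<omega> within E_minus N P \<noteq> bot"
      using singular_point_not_isolated[OF _ _ \<eta>0, of \<omega> N] \<omega> by (auto simp: sing_eq minus_eq)
    show False
    proof (cases "n = 0")
      case True
      then show False
        using not_tendsto_and_filterlim_at_infinity[OF nontriv lim]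
          filterlim_at_bot_imp_at_infinity[OF first[OF \<omega>]] by simp
    next
      case False
      then have "nth_ev N \<A> (n - 1) \<omega> = nth_ev N \<A> n \<omega>"
        using tendsto_unique[OF nontriv below[OF \<omega>, of n] lim] n1 by auto
      then show False using neq False n1 by auto
    qed
  qed
  have cont_sing: "\<forall>n\<le>N - 2. continuous_on (E_plus N P \<union> E_sing N P) (nth_ev N \<A> n)"
    unfolding continuous_on_def
  proof (intro allI impI ballI)
    fix n \<omega> assume n: "n \<le> N - 2" and \<omega>: "\<omega> \<in> E_plus N P \<union> E_sing N P"
    show "(nth_ev N \<A> n \<longlongrightarrow> nth_ev N \<A> n \<omega>) (at \<omega> within E_plus N P \<union> E_sing N P)"
    proof (cases "\<omega> \<in> E_sing N P")
      case True
      then show ?thesis using above n by blast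
    next
      case False
      let ?U = "{\<omega>. \<eta> < recip_f \<omega> 0}"
      have \<omega>p: "\<omega> \<in> E_plus N P" using False \<omega> by blast
      \<comment> \<open>Near a point of \<open>E_plus N P\<close> there are no points of
        \<open>E_sing N P\<close>, so adjoining that set leaves the filter unchanged.\<close>
      have "open ?U" by (intro open_Collect_less continuous_on_const continuous_coordinates)
      then have "at \<omega> within E_plus N P \<union> E_sing N P = at \<omega> within E_plus N P"
        using \<omega>p by (intro at_within_nhd[of _ ?U]) (auto simp: plus_eq sing_eq)
      moreover have "(nth_ev N \<A> n \<longlongrightarrow> nth_ev N \<A> n \<omega>) (at \<omega> within E_plus N P)"
        using \<omega>p n N by (intro tendsto_within_subset[OF nth_ev_tendsto_regular]) (auto simp: plus_eq)
      ultimately show ?thesis by simp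
    qed
  qed

  have mono: "(\<forall>j\<in>{0..N}. (r(j := x), q, w) \<in> C \<and> r j \<le> x \<longrightarrow>
             nth_ev N \<A> n (r(j := x), q, w) \<le> nth_ev N \<A> n (r, q, w))
        \<and> ((r(N := x), q, w) \<in> C \<longrightarrow> nth_ev N \<A> n (r(N := x), q, w) = nth_ev N \<A> n (r, q, w))
        \<and> (\<forall>j\<in>{1..N}. (r, q(j := x), w) \<in> C \<and> q j \<le> x \<longrightarrow>
             nth_ev N \<A> n (r, q, w) \<le> nth_ev N \<A> n (r, q(j := x), w))
        \<and> (\<forall>j\<in>{1..N}. (r, q, w(j := x)) \<in> C \<and> w j \<le> x \<longrightarrow>
             max (nth_ev N \<A> n (r, q, w(j := x))) 0 \<le> max (nth_ev N \<A> n (r, q, w)) 0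
           \<and> min (nth_ev N \<A> n (r, q, w)) 0 \<le> min (nth_ev N \<A> n (r, q, w(j := x))) 0)"
    if n: "n \<le> N - 1" and C: "C \<in> components (E_plus N P) \<union> components (E_minus N P)"
      and rqw: "(r, q, w) \<in> C" for n C r q w x
  proof -
    have n: "n < N" using n le_less by simp
    have conn: "connected C" using C in_components_connected by blast
    have side: "(\<forall>\<omega>\<in>C. \<eta> < recip_f \<omega> 0) \<or> (\<forall>\<omega>\<in>C. recip_f \<omega> 0 < \<eta>)" and sub: "C \<subseteq> Omega N"
      using C in_components_subset by (fastforce simp: plus_eq minus_eq)+
    have reg: "\<omega> \<in> Omega N" "recip_f \<omega> 0 \<noteq> \<eta>" if "\<omega> \<in> C" for \<omega> using side sub that by auto
    have "nth_ev N \<A> n (r(j := x), q, w) \<le> nth_ev N \<A> n (r, q, w)"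
      if j: "j \<le> N" "(r(j := x), q, w) \<in> C" "r j \<le> x" for j
    proof (rule nth_ev_mono_form[OF reg[OF j(2)] reg[OF rqw] n])
      \<comment> \<open>Both equations lie in \<open>C\<close>, so \<open>r j\<close> and
        \<open>x\<close> have the same sign, and taking reciprocals reverses their order.\<close>
      have "0 < r j \<or> x < 0"
        using connected_recip_sign[OF conn sub rqw j(2,1)] Omega_recip_nonzero[OF reg(1)[OF j(2)] j(1)]
          Omega_recip_nonzero[OF reg(1)[OF rqw] j(1)] by (auto simp: recip_f_def)
      then show "f_of (r(j := x), q, w) i \<le> f_of (r, q, w) i" for i
        using divide_one_antimono[OF j(3)] by (simp add: f_of_def recip_f_def)
      show "1 / (recip_f (r(j := x), q, w) 0 - \<eta>) \<le> 1 / (recip_f (r, q, w) 0 - \<eta>)"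
      proof (rule divide_one_antimono)
        show "recip_f (r, q, w) 0 - \<eta> \<le> recip_f (r(j := x), q, w) 0 - \<eta>"
          using j(3) by (cases "j = 0") (auto simp: recip_f_def)
        \<comment> \<open>The same argument with \<open>\<eta>\<close> in place of 0: the component
          lies entirely on one side of the singular set.\<close>
        show "0 < recip_f (r, q, w) 0 - \<eta> \<or> recip_f (r(j := x), q, w) 0 - \<eta> < 0"
          using side rqw j(2) by fastforce
      qed
    qed (auto simp: w_of_def q_of_def)
    moreover have "nth_ev N \<A> n (r(N := x), q, w) = nth_ev N \<A> n (r, q, w)"
      if x: "(r(N := x), q, w) \<in> C"
    proof (rule antisym)
      show "nth_ev N \<A> n (r(N := x), q, w) \<le> nth_ev N \<A> n (r, q, w)"
        by (rule nth_ev_mono_form[OF reg[OF x] reg[OF rqw] n])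
          (use N in \<open>auto simp: w_of_def q_of_def f_of_def recip_f_def\<close>)
      show "nth_ev N \<A> n (r, q, w) \<le> nth_ev N \<A> n (r(N := x), q, w)"
        by (rule nth_ev_mono_form[OF reg[OF rqw] reg[OF x] n])
          (use N in \<open>auto simp: w_of_def q_of_def f_of_def recip_f_def\<close>)
    qed
    moreover have "nth_ev N \<A> n (r, q, w) \<le> nth_ev N \<A> n (r, q(j := x), w)"
      if j: "(r, q(j := x), w) \<in> C" "q j \<le> x" for j
      by (rule nth_ev_mono_form[OF reg[OF rqw] reg[OF j(1)] n])
        (use j in \<open>auto simp: w_of_def q_of_def f_of_def recip_f_def\<close>)
    moreover have "max (nth_ev N \<A> n (r, q, w(j := x))) 0 \<le> max (nth_ev N \<A> n (r, q, w)) 0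
           \<and> min (nth_ev N \<A> n (r, q, w)) 0 \<le> min (nth_ev N \<A> n (r, q, w(j := x))) 0"
      if j: "(r, q, w(j := x)) \<in> C" "w j \<le> x" for j
      by (intro conjI; rule nth_ev_weight_mono[OF reg[OF rqw] reg[OF j(1)] n];
          use j in \<open>auto simp: w_of_def q_of_def recip_f_def\<close>)
    ultimately show ?thesis by (meson atLeastAtMost_iff)
  qed

  show ?thesis
  proof (intro conjI real num_sing num_reg cont_reg cont_sing)
    show "\<forall>\<omega>\<^sub>0\<in>E_sing N P.
        (\<forall>n\<le>N - 1. \<not> (1 \<le> n \<and> n \<le> N - 2 \<and> nth_ev N \<A> (n - 1) \<omega>\<^sub>0 = nth_ev N \<A> n \<omega>\<^sub>0) \<longrightarrow>
           \<not> nth_ev_continuous_at N \<A> n \<omega>\<^sub>0)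
      \<and> filterlim (nth_ev N \<A> 0) at_bot (at \<omega>\<^sub>0 within E_minus N P)
      \<and> (\<forall>n\<in>{1..N - 1}. (nth_ev N \<A> n \<longlongrightarrow> nth_ev N \<A> (n - 1) \<omega>\<^sub>0) (at \<omega>\<^sub>0 within E_minus N P))
      \<and> (\<forall>n\<le>N - 2. (nth_ev N \<A> n \<longlongrightarrow> nth_ev N \<A> n \<omega>\<^sub>0) (at \<omega>\<^sub>0 within E_plus N P \<union> E_sing N P))
      \<and> filterlim (nth_ev N \<A> (N - 1)) at_top (at \<omega>\<^sub>0 within E_plus N P)"
    proof (rule ballI)
      fix \<omega> assume \<omega>: "\<omega> \<in> E_sing N P"
      show "(\<forall>n\<le>N - 1. \<not> (1 \<le> n \<and> n \<le> N - 2 \<and> nth_ev N \<A> (n - 1) \<omega> = nth_ev N \<A> n \<omega>) \<longrightarrow>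
           \<not> nth_ev_continuous_at N \<A> n \<omega>)
        \<and> filterlim (nth_ev N \<A> 0) at_bot (at \<omega> within E_minus N P)
        \<and> (\<forall>n\<in>{1..N - 1}. (nth_ev N \<A> n \<longlongrightarrow> nth_ev N \<A> (n - 1) \<omega>) (at \<omega> within E_minus N P))
        \<and> (\<forall>n\<le>N - 2. (nth_ev N \<A> n \<longlongrightarrow> nth_ev N \<A> n \<omega>) (at \<omega> within E_plus N P \<union> E_sing N P))
        \<and> filterlim (nth_ev N \<A> (N - 1)) at_top (at \<omega> within E_plus N P)"
        by (intro conjI allI ballI impI first[OF \<omega>] last[OF \<omega>] below[OF \<omega>] above[OF \<omega>] discont[OF \<omega>])
    qed
  qed (intro allI impI ballI; rule mono; assumption)
qed

end
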